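(* Let $U\subset\mathbb{C}^2$ be a neighbourhood of the origin, let $F=(f_1,\ldots,f_m):U\to\mathbb{C}^m$ be a holomorphic mapping, and suppose $F(0)=0$. Put $f:=f_1\cdot\ldots\cdot f_m$. If $\hat f\neq 0$ and $\hat f=\hat h_1\cdot\ldots\cdot\hat h_r$ is a factorization of $\hat f$ into irreducible germs in $\mathcal{O}^2$, then $$\mathcal{L}_0(F)=\max_{1\le i\le r}\ \frac{1}{\operatorname{ord} h_i}\ \min_{1\le j\le m}\mu(h_i,f_j).$$
   Context: $\mathcal{O}^2$ is the ring of germs of holomorphic functions at $0\in\mathbb{C}^2$. For a function $h$ holomorphic in a neighbourhood of $0\in\mathbb{C}^2$, $\hat h\in\mathcal{O}^2$ denotes its germ at $0$ and $\operatorname{ord} h$ denotes its order at $0$ (the lowest degree of a nonzero term of its Taylor expansion at $0$). For holomorphic functions $f,g$ near $0$ vanishing at $0$, $\mu(f,g)$ denotes the intersection multiplicity at $0$ of the mapping $(f,g)$, i.e. $\mu(f,g)=\dim_{\mathbb{C}}\mathcal{O}^2/(\hat f,\hat g)$, which is $+\infty$ when $(f,g)$ does not have an isolated zero at $0$. The $h_i$ are holomorphic functions near $0$ representing the germs $\hat h_i$. $|\cdot|$ denotes the polycylindric (maximum) norm on $\mathbb{C}^2$ and $\mathbb{C}^m$, i.e. $|z|=\max_i|z_i|$. For a holomorphic mapping $F:U\to\mathbb{C}^m$ put $$N(F):=\{\nu\in\mathbb{R}_+ : \exists A>0,\ \exists B>0,\ \forall z\in U,\ |z|<B\Rightarrow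 A|z|^\nu\le|F(z)|\}.$$ The Łojasiewicz exponent of $F$ at $0$ is $\mathcal{L}_0(F):=\inf N(F)$, with $\inf\emptyset=+\infty$. *)

theory Defs
  imports
    "HOL-Analysis.Analysis"
    "HOL-Computational_Algebra.Factorial_Ring"
    "HOL-Algebra.Embedded_Algebras"
    "HOL-Algebra.QuotRing"
    "HOL-Algebra.Algebraic_Closure_Type"
begin

section \<open>Holomorphic functions of two variables\<close>

text \<open>
  Complex differentiability in the sense of several complex variables: the real Frechet
  derivative exists and is complex linear.
\<close>

definition complex_differentiable_at :: "(complex^2 \<Rightarrow> complex) \<Rightarrow> complex^2 \<Rightarrow> bool" where
  "complex_differentiable_at f z \<longleftrightarrow>
     (\<exists>a :: complex^2. (f has_derivative (\<lambda>v. \<Sum>i\<in>UNIV. a $ i * v $ i)) (at z))"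

definition holomorphic2_on :: "(complex^2 \<Rightarrow> complex) \<Rightarrow> (complex^2) set \<Rightarrow> bool" where
  "holomorphic2_on f U \<longleftrightarrow> (\<forall>z\<in>U. complex_differentiable_at f z)"

definition holomorphic2_near_0 :: "(complex^2 \<Rightarrow> complex) \<Rightarrow> bool" where
  "holomorphic2_near_0 f \<longleftrightarrow> (\<exists>V. open V \<and> 0 \<in> V \<and> holomorphic2_on f V)"

lemma complex_differentiable_at_const: "complex_differentiable_at (\<lambda>_. c) z"
  unfolding complex_differentiable_at_def
  by (rule exI[of _ 0]) simp

lemma complex_differentiable_at_add:
  assumes "complex_differentiable_at f z" "complex_differentiable_at g z"
  shows "complex_differentiable_at (\<lambda>z. f z + g z) z"
proof -
  from assms obtain a b :: "complex^2"
    where "(f has_derivative (\<lambda>v. \<Sum>i\<in>UNIV. a $ i * v $ i)) (at z)"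
      and "(g has_derivative (\<lambda>v. \<Sum>i\<in>UNIV. b $ i * v $ i)) (at z)"
    unfolding complex_differentiable_at_def by blast
  from has_derivative_add[OF this] show ?thesis
    unfolding complex_differentiable_at_def
    by (intro exI[of _ "a + b"]) (simp add: distrib_right sum.distrib)
qed

lemma complex_differentiable_at_mult:
  assumes "complex_differentiable_at f z" "complex_differentiable_at g z"
  shows "complex_differentiable_at (\<lambda>z. f z * g z) z"
proof -
  from assms obtain a b :: "complex^2"
    where "(f has_derivative (\<lambda>v. \<Sum>i\<in>UNIV. a $ i * v $ i)) (at z)"
      and "(g has_derivative (\<lambda>v. \<Sum>i\<in>UNIV. b $ i * v $ i)) (at z)"
    unfolding complex_differentiable_at_def by blast
  from has_derivative_mult[OF this] show ?thesis
    unfolding complex_differentiable_at_def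
    by (intro exI[of _ "f z *s b + g z *s a"])
       (simp add: distrib_left distrib_right sum.distrib sum_distrib_left sum_distrib_right mult_ac)
qed

lemma holomorphic2_near_0_const: "holomorphic2_near_0 (\<lambda>_. c)"
  unfolding holomorphic2_near_0_def holomorphic2_on_def
  using complex_differentiable_at_const by (intro exI[of _ UNIV]) auto

lemma holomorphic2_near_0_add:
  assumes "holomorphic2_near_0 f" "holomorphic2_near_0 g"
  shows "holomorphic2_near_0 (\<lambda>z. f z + g z)"
proof -
  from assms obtain V W where "open V" "0 \<in> V" "holomorphic2_on f V"
    "open W" "0 \<in> W" "holomorphic2_on g W"
    unfolding holomorphic2_near_0_def by blast
  then show ?thesis
    unfolding holomorphic2_near_0_def holomorphic2_on_def
    by (intro exI[of _ "V \<inter> W"]) (auto intro: complex_differentiable_at_add)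
qed

lemma holomorphic2_near_0_mult:
  assumes "holomorphic2_near_0 f" "holomorphic2_near_0 g"
  shows "holomorphic2_near_0 (\<lambda>z. f z * g z)"
proof -
  from assms obtain V W where "open V" "0 \<in> V" "holomorphic2_on f V"
    "open W" "0 \<in> W" "holomorphic2_on g W"
    unfolding holomorphic2_near_0_def by blast
  then show ?thesis
    unfolding holomorphic2_near_0_def holomorphic2_on_def
    by (intro exI[of _ "V \<inter> W"]) (auto intro: complex_differentiable_at_mult)
qed

lemma holomorphic2_near_0_uminus:
  assumes "holomorphic2_near_0 f"
  shows "holomorphic2_near_0 (\<lambda>z. - f z)"
  using holomorphic2_near_0_mult[OF holomorphic2_near_0_const[of "-1"] assms] by simp

lemma holomorphic2_near_0_diff:
  assumes "holomorphic2_near_0 f" "holomorphic2_near_0 g"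
  shows "holomorphic2_near_0 (\<lambda>z. f z - g z)"
  using holomorphic2_near_0_add[OF assms(1) holomorphic2_near_0_uminus[OF assms(2)]] by simp

section \<open>The ring of germs at the origin\<close>

definition germ_eq :: "(complex^2 \<Rightarrow> complex) \<Rightarrow> (complex^2 \<Rightarrow> complex) \<Rightarrow> bool" where
  "germ_eq f g \<longleftrightarrow>
     holomorphic2_near_0 f \<and> holomorphic2_near_0 g \<and> (\<forall>\<^sub>F z in nhds 0. f z = g z)"

lemma germ_eq_part_equivp: "part_equivp germ_eq"
proof (rule part_equivpI)
  show "\<exists>f. germ_eq f f"
    using holomorphic2_near_0_const[of 0] by (intro exI[of _ "\<lambda>_. 0"]) (simp add: germ_eq_def)
  show "symp germ_eq"
    by (rule sympI) (auto simp: germ_eq_def elim: eventually_mono)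
  show "transp germ_eq"
    by (rule transpI) (auto simp: germ_eq_def elim: eventually_elim2)
qed

text \<open>
  A partial quotient: only functions that are holomorphic near 0 represent germs.  The germ of any
  other function is a junk value.
\<close>

quotient_type germ = "complex^2 \<Rightarrow> complex" / partial: germ_eq
  by (rule germ_eq_part_equivp)

definition germ_of :: "(complex^2 \<Rightarrow> complex) \<Rightarrow> germ" where
  "germ_of f = abs_germ f"

instantiation germ :: comm_ring_1
begin

lift_definition zero_germ :: germ is "\<lambda>_. 0"
  by (simp add: germ_eq_def holomorphic2_near_0_const)

lift_definition one_germ :: germ is "\<lambda>_. 1"
  by (simp add: germ_eq_def holomorphic2_near_0_const)

lift_definition plus_germ :: "germ \<Rightarrow> germ \<Rightarrow> germ" is "\<lambda>f g z. f z + g z"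
  by (auto simp: germ_eq_def intro: holomorphic2_near_0_add elim: eventually_elim2)

lift_definition minus_germ :: "germ \<Rightarrow> germ \<Rightarrow> germ" is "\<lambda>f g z. f z - g z"
  by (auto simp: germ_eq_def intro: holomorphic2_near_0_diff elim: eventually_elim2)

lift_definition uminus_germ :: "germ \<Rightarrow> germ" is "\<lambda>f z. - f z"
  by (auto simp: germ_eq_def intro: holomorphic2_near_0_uminus elim: eventually_mono)

lift_definition times_germ :: "germ \<Rightarrow> germ \<Rightarrow> germ" is "\<lambda>f g z. f z * g z"
  by (auto simp: germ_eq_def intro: holomorphic2_near_0_mult elim: eventually_elim2)

instance
proof
  fix a b c :: germ
  show "a * b * c = a * (b * c)"
    by transfer (auto simp: germ_eq_def mult.assoc intro!: holomorphic2_near_0_mult)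
  show "a * b = b * a"
    by transfer (auto simp: germ_eq_def mult.commute intro!: holomorphic2_near_0_mult)
  show "1 * a = a"
    by transfer (auto simp: germ_eq_def)
  show "a + b + c = a + (b + c)"
    by transfer (auto simp: germ_eq_def add.assoc intro!: holomorphic2_near_0_add)
  show "a + b = b + a"
    by transfer (auto simp: germ_eq_def add.commute intro!: holomorphic2_near_0_add)
  show "0 + a = a"
    by transfer (auto simp: germ_eq_def)
  show "- a + a = 0"
    by transfer (auto simp: germ_eq_def holomorphic2_near_0_const)
  show "a - b = a + - b"
    by transfer (auto simp: germ_eq_def intro!: holomorphic2_near_0_diff)
  show "(a + b) * c = a * c + b * c"
    by transfer (auto simp: germ_eq_def distrib_right
      intro!: holomorphic2_near_0_add holomorphic2_near_0_mult)
  show "(0::germ) \<noteq> 1"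
    by transfer (auto simp: germ_eq_def dest: eventually_nhds_x_imp_x)
qed

end

section \<open>Order and intersection multiplicity\<close>

definition partial_deriv :: "2 \<Rightarrow> (complex^2 \<Rightarrow> complex) \<Rightarrow> complex^2 \<Rightarrow> complex" where
  "partial_deriv i f z = deriv (\<lambda>t. f (z + axis i t)) 0"

definition taylor_coeff :: "(complex^2 \<Rightarrow> complex) \<Rightarrow> nat \<Rightarrow> nat \<Rightarrow> complex" where
  "taylor_coeff f k l =
     ((partial_deriv 1 ^^ k) ((partial_deriv 2 ^^ l) f)) 0 / (fact k * fact l)"

text \<open>The order is \<open>\<infinity>\<close> when all Taylor coefficients at 0 vanish.\<close>

definition ord_at_0 :: "(complex^2 \<Rightarrow> complex) \<Rightarrow> enat" where
  "ord_at_0 f = Inf {enat (k + l) | k l. taylor_coeff f k l \<noteq> 0}"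

text \<open>
  The quotient of the ring of germs by the ideal generated by two germs is viewed as a vector space
  over the image of the constant germs, which is a copy of the complex numbers when the ideal is
  proper.  The dimension is unique if it exists; otherwise the infimum is taken over the empty set
  and equals \<open>\<infinity>\<close>.
\<close>

definition intersection_mult ::
    "(complex^2 \<Rightarrow> complex) \<Rightarrow> (complex^2 \<Rightarrow> complex) \<Rightarrow> enat" where
  "intersection_mult f g =
     (let R = (ring_of_type_algebra :: germ ring);
          I = Idl\<^bsub>R\<^esub> {germ_of f, germ_of g};
          Q = R Quot I;
          K = range (\<lambda>c. I +>\<^bsub>R\<^esub> germ_of (\<lambda>_. c))
      in Inf {enat n | n. ring.dimension Q n K (carrier Q)})"

section \<open>The Lojasiewicz exponent\<close>

definition max_norm :: "complex^'n \<Rightarrow> real" where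
  "max_norm z = (MAX i. cmod (z $ i))"

definition lojasiewicz_set :: "(complex^2) set \<Rightarrow> (complex^2 \<Rightarrow> complex^'m) \<Rightarrow> real set" where
  "lojasiewicz_set U F =
     {\<nu>. 0 \<le> \<nu> \<and> (\<exists>A>0. \<exists>B>0. \<forall>z\<in>U. max_norm z < B \<longrightarrow>
        A * max_norm z powr \<nu> \<le> max_norm (F z))}"

text \<open>In \<^typ>\<open>ereal\<close> the infimum of the empty set is \<open>\<infinity>\<close>.\<close>

definition lojasiewicz_exponent :: "(complex^2) set \<Rightarrow> (complex^2 \<Rightarrow> complex^'m) \<Rightarrow> ereal" where
  "lojasiewicz_exponent U F = Inf (ereal ` lojasiewicz_set U F)"

end

theory Submission
  imports Defs "HOL-Complex_Analysis.Complex_Analysis"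
begin

text \<open>
  For a generic shear \<open>(x, y) \<mapsto> (x + a y, y)\<close> every irreducible factor \<open>h\<^sub>i\<close> of \<open>f\<close> becomes a unit times
  \<open>\<Prod>\<^sub>\<omega> (y - \<phi>\<^sub>i (\<omega> t))\<close>, where \<open>x = t\<^sup>n\<close>, \<open>n = ord h\<^sub>i\<close>, \<open>\<omega>\<close> runs over the \<open>n\<close>-th roots of unity and
  \<open>t \<mapsto> (t\<^sup>n, \<phi>\<^sub>i t)\<close> is a Puiseux parametrization \<open>\<gamma>\<^sub>i\<close>, obtained by lifting \<open>exp\<close> from a half plane
  to the covering of the punctured disc by the zero set of \<open>h\<^sub>i\<close>.  Pulling back along \<open>\<gamma>\<^sub>i\<close> has kernel \<open>(h\<^sub>i)\<close>
  and an image that contains all power series of large order; counting orders gives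
  \<open>\<mu>(h\<^sub>i, g) = ord (g \<circ> \<gamma>\<^sub>i)\<close>.  Hence the \<open>i\<close>-th term of the maximum is the growth exponent of \<open>F\<close> along the
  \<open>i\<close>-th branch, which bounds the Lojasiewicz exponent from below.  Conversely, each \<open>f\<^sub>j\<close> is a unit times
  a product of some of the \<open>h\<^sub>i\<close>, and replacing \<open>(x, y)\<close> by the nearest root of \<open>f\<close> over \<open>x\<close> at most doubles
  the distance to every other root; so up to a constant the whole of \<open>F\<close> is at least as large as at a
  point of the same size on a branch.
\<close>

text \<open>Since each component divides \<open>f\<close>, all its roots over an abscissa are roots
  of \<open>f\<close>; moving to the nearest root of \<open>f\<close> therefore enlarges no
  component by more than a constant factor, and whichever component is large on the branch was
  already large at the original point. The shear keeps the line x = 0 away from the tangents of all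
  branches. Only then is the degree of the parametrization the order of \<open>h\<^sub>i\<close>,
  and only then is \<open>\<phi>\<^sub>i t\<close> bounded by a multiple of
  \<open>t\<^sup>n\<close>, so that the abscissa measures the size of a point of the branch. A
  single root need not be holomorphic in x, but weighted power sums of all roots are, by the
  argument principle; the covering comes from them. One parametrized root suffices: its conjugates
  give a monic polynomial W dividing \<open>h\<^sub>i\<close>, and irreducibility makes the quotient
  a unit. Lagrange interpolation at the conjugate roots, with its denominators left out, realizes
  every multiple of the y-derivative of W along the branch; from the order of that derivative on,
  the orders of pullbacks have no gaps.\<close>

no_notation fps_nth (infixl "$" 75)

section \<open>Holomorphic functions of two variables\<close>

definition vec2 :: "complex \<Rightarrow> complex \<Rightarrow> complex^2" where
  "vec2 x y = (\<chi> i. if i = 1 then x else y)"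

lemma vec2_nth [simp]: "vec2 x y $ 1 = x" "vec2 x y $ 2 = y"
  by (simp_all add: vec2_def)

lemma vec2_collapse [simp]: "vec2 (z $ 1) (z $ 2) = z"
  by (simp add: vec_eq_iff forall_2)

lemma vec2_0 [simp]: "vec2 0 0 = 0"
  by (simp add: vec_eq_iff forall_2)

lemma bounded_linear_vec2: "bounded_linear (\<lambda>p. vec2 (fst p) (snd p))"
  unfolding linear_conv_bounded_linear[symmetric]
  by (rule linearI) (auto simp: vec_eq_iff forall_2)

lemma continuous_on_vec2 [continuous_intros]:
  assumes "continuous_on S a" "continuous_on S b"
  shows "continuous_on S (\<lambda>s. vec2 (a s) (b s))"
  using bounded_linear.continuous_on[OF bounded_linear_vec2 continuous_on_Pair[OF assms]] by simp

lemma tendsto_vec2 [tendsto_intros]: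
  assumes "(a \<longlongrightarrow> x) G" "(b \<longlongrightarrow> y) G"
  shows "((\<lambda>s. vec2 (a s) (b s)) \<longlongrightarrow> vec2 x y) G"
  using bounded_linear.tendsto[OF bounded_linear_vec2 tendsto_Pair[OF assms]] by simp

lemma norm_vec2_le: "norm (vec2 x y) \<le> norm x + norm y"
  unfolding norm_vec_def L2_set_def using sqrt_sum_squares_le_sum[of "norm x" "norm y"]
  by (simp add: sum_2)

lemma complex_differentiable_at_compose_curve:
  assumes f: "complex_differentiable_at f (vec2 (a t) (b t))"
    and a: "(a has_field_derivative a') (at t)" and b: "(b has_field_derivative b') (at t)"
  shows "(\<lambda>s. f (vec2 (a s) (b s))) field_differentiable (at t)"
proof -
  obtain c where c: "(f has_derivative (\<lambda>v. \<Sum>i\<in>UNIV. c $ i * v $ i)) (at (vec2 (a t) (b t)))"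
    using f unfolding complex_differentiable_at_def by blast
  have "((\<lambda>s. (a s, b s)) has_derivative (\<lambda>s. (a' * s, b' * s))) (at t)"
    using a b unfolding has_field_derivative_def by (intro has_derivative_Pair)
  from bounded_linear.has_derivative[OF bounded_linear_vec2 this]
  have "((\<lambda>s. vec2 (a s) (b s)) has_derivative (\<lambda>s. vec2 (a' * s) (b' * s))) (at t)" by simp
  from has_derivative_compose[OF this c]
  have "((\<lambda>s. f (vec2 (a s) (b s))) has_derivative (\<lambda>s. c $ 1 * (a' * s) + c $ 2 * (b' * s))) (at t)"
    by (simp add: sum_2)
  then have "((\<lambda>s. f (vec2 (a s) (b s))) has_field_derivative (c $ 1 * a' + c $ 2 * b')) (at t)"
    unfolding has_field_derivative_def by (rule has_derivative_eq_rhs) (auto simp: algebra_simps)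
  then show ?thesis by (auto simp: field_differentiable_def)
qed

lemma complex_differentiable_at_imp_continuous:
  "complex_differentiable_at f z \<Longrightarrow> continuous (at z) f"
  unfolding complex_differentiable_at_def using has_derivative_continuous by blast

text \<open>Joint continuity plus separate holomorphy is the notion that circle integrals in one
  variable preserve, and its slices are accessible to one-variable theory. On an open set times a
  disc about 0 it gives back \<open>complex_differentiable_at\<close>, see
  \<open>complex_differentiable_at_if_hol2\<close>.\<close>

definition hol2 :: "complex set \<Rightarrow> complex set \<Rightarrow> (complex \<Rightarrow> complex \<Rightarrow> complex) \<Rightarrow> bool" where
  "hol2 A B G \<longleftrightarrow> continuous_on (A \<times> B) (\<lambda>(x, y). G x y) \<and>
     (\<forall>y\<in>B. (\<lambda>x. G x y) holomorphic_on A) \<and> (\<forall>x\<in>A. G x holomorphic_on B)"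

lemma hol2_subset: "hol2 A B G \<Longrightarrow> A' \<subseteq> A \<Longrightarrow> B' \<subseteq> B \<Longrightarrow> hol2 A' B' G"
  unfolding hol2_def
  by (auto intro: continuous_on_subset holomorphic_on_subset dest: subsetD)

lemma hol2_cong: "(\<And>x y. x \<in> A \<Longrightarrow> y \<in> B \<Longrightarrow> G x y = H x y) \<Longrightarrow> hol2 A B G \<longleftrightarrow> hol2 A B H"
  unfolding hol2_def by (intro conj_cong continuous_on_cong ball_cong holomorphic_cong) auto

lemma hol2_continuous: "hol2 A B G \<Longrightarrow> continuous_on (A \<times> B) (\<lambda>(x, y). G x y)"
  by (simp add: hol2_def)

lemma hol2_holomorphic1: "hol2 A B G \<Longrightarrow> y \<in> B \<Longrightarrow> (\<lambda>x. G x y) holomorphic_on A"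
  by (simp add: hol2_def)

lemma hol2_holomorphic2: "hol2 A B G \<Longrightarrow> x \<in> A \<Longrightarrow> G x holomorphic_on B"
  by (simp add: hol2_def)

lemma hol2_mult: "hol2 A B G \<Longrightarrow> hol2 A B H \<Longrightarrow> hol2 A B (\<lambda>x y. G x y * H x y)"
  unfolding hol2_def by (auto simp: case_prod_unfold intro!: continuous_intros holomorphic_intros)

lemma hol2_sum: "(\<And>i. i \<in> I \<Longrightarrow> hol2 A B (G i)) \<Longrightarrow> hol2 A B (\<lambda>x y. \<Sum>i\<in>I. G i x y)"
  unfolding hol2_def by (auto simp: case_prod_unfold intro!: continuous_intros holomorphic_intros)

lemma hol2_fst: "f holomorphic_on A \<Longrightarrow> hol2 A B (\<lambda>x y. f x)"
  unfolding hol2_def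
  by (auto simp: case_prod_unfold intro!: continuous_intros
      continuous_on_compose2[OF holomorphic_on_imp_continuous_on, of f A])

lemma hol2_snd: "f holomorphic_on B \<Longrightarrow> hol2 A B (\<lambda>x y. f y)"
  unfolding hol2_def
  by (auto simp: case_prod_unfold intro!: continuous_intros
      continuous_on_compose2[OF holomorphic_on_imp_continuous_on, of f B])

lemma hol2_if_holomorphic2_on:
  assumes f: "holomorphic2_on f V" and V: "\<And>x y. x \<in> A \<Longrightarrow> y \<in> B \<Longrightarrow> vec2 x y \<in> V"
  shows "hol2 A B (\<lambda>x y. f (vec2 x y))"
  unfolding hol2_def
proof (intro conjI ballI)
  have "continuous_on V f"
    using f unfolding holomorphic2_on_def
    by (meson complex_differentiable_at_imp_continuous continuous_at_imp_continuous_on)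
  then show "continuous_on (A \<times> B) (\<lambda>(x, y). f (vec2 x y))"
    using V by (auto simp: case_prod_unfold intro!: continuous_intros continuous_on_compose2[of V f])
next
  fix y assume "y \<in> B"
  then show "(\<lambda>x. f (vec2 x y)) holomorphic_on A"
    unfolding holomorphic_on_def
    using f V complex_differentiable_at_compose_curve[OF _ DERIV_ident DERIV_const]
    by (meson field_differentiable_at_within holomorphic2_on_def)
next
  fix x assume "x \<in> A"
  then show "(\<lambda>y. f (vec2 x y)) holomorphic_on B"
    unfolding holomorphic_on_def
    using f V complex_differentiable_at_compose_curve[OF _ DERIV_const DERIV_ident]
    by (meson field_differentiable_at_within holomorphic2_on_def)
qed

lemma hol2_if_holomorphic2_near_0:
  assumes "holomorphic2_near_0 f"
  obtains R where "R > 0" "hol2 (ball 0 R) (ball 0 R) (\<lambda>x y. f (vec2 x y))"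
proof -
  obtain V where V: "open V" "0 \<in> V" "holomorphic2_on f V"
    using assms unfolding holomorphic2_near_0_def by blast
  then obtain e where e: "e > 0" "ball 0 e \<subseteq> V" by (meson openE)
  have "vec2 x y \<in> V" if "x \<in> ball 0 (e/2)" "y \<in> ball 0 (e/2)" for x y
    using e(2) that norm_vec2_le[of x y] by (intro subsetD[OF e(2)]) auto
  then have "hol2 (ball 0 (e/2)) (ball 0 (e/2)) (\<lambda>x y. f (vec2 x y))"
    by (rule hol2_if_holomorphic2_on[OF V(3)])
  then show ?thesis using that[of "e/2"] e(1) by auto
qed

section \<open>Circle integrals depending on a parameter\<close>

lemma continuous_on_contour_integral_circlepath:
  fixes K :: "'a::topological_space \<Rightarrow> complex \<Rightarrow> complex"
  assumes "continuous_on (P \<times> sphere z r) (\<lambda>(p, w). K p w)" "r \<ge> 0"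
  shows "continuous_on P (\<lambda>p. contour_integral (circlepath z r) (K p))"
proof -
  have "continuous_on (P \<times> cbox 0 1) (\<lambda>(p, t). K p (circlepath z r t) * vector_derivative (circlepath z r) (at t))"
    unfolding case_prod_unfold vector_derivative_circlepath
    using assms(2) unfolding circlepath
    by (intro continuous_intros continuous_on_compose2[OF assms(1)[unfolded case_prod_unfold],
          where f = "\<lambda>x. (fst x, z + r * exp (2 * complex_of_real pi * \<i> * complex_of_real (snd x)))", simplified])
      (auto simp: dist_norm norm_mult)
  from integral_continuous_on_param[OF this] show ?thesis
    by (simp add: contour_integral_integral)
qed

lemma continuous_on_vector_derivative_circlepath:
  "continuous_on S (\<lambda>t. vector_derivative (circlepath z r) (at t))"
  unfolding vector_derivative_circlepath by (intro continuous_intros)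

text \<open>The integral satisfies Cauchy's formula on a circle about any point of \<open>A\<close>:
  exchange the two contour integrals and apply the formula to the kernel for fixed \<open>w\<close>.
  A continuous function that is its own Cauchy integral is differentiable, so nothing is
  differentiated under the integral sign.\<close>

lemma holomorphic_on_contour_integral_circlepath:
  assumes A: "open A" and r: "r \<ge> 0"
    and cont: "continuous_on (A \<times> sphere z r) (\<lambda>(x, w). K x w)"
    and hol: "\<And>w. w \<in> sphere z r \<Longrightarrow> (\<lambda>x. K x w) holomorphic_on A"
  shows "(\<lambda>x. contour_integral (circlepath z r) (K x)) holomorphic_on A"
  unfolding holomorphic_on_open[OF A]
proof
  fix x0 assume "x0 \<in> A"
  then obtain \<rho> where \<rho>: "\<rho> > 0" "cball x0 \<rho> \<subseteq> A" using A open_contains_cball by blast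
  define F where "F = (\<lambda>x. contour_integral (circlepath z r) (K x))"
  have contF: "continuous_on A F"
    unfolding F_def by (rule continuous_on_contour_integral_circlepath[OF cont r])
  \<comment> \<open>The exponent 1 is kept to match the hypothesis of
    \<open>Cauchy_next_derivative_circlepath\<close>.\<close>
  have "((\<lambda>u. F u / (u - x) ^ 1) has_contour_integral (2 * pi * \<i> * F x)) (circlepath x0 \<rho>)"
    if x: "x \<in> ball x0 \<rho>" for x
  proof -
    have sub: "sphere x0 \<rho> \<subseteq> A" using \<rho> by auto
    have "continuous_on (sphere x0 \<rho>) (\<lambda>u. F u / (u - x) ^ 1)"
      using x by (intro continuous_intros continuous_on_subset[OF contF sub]) auto
    then have "(\<lambda>u. F u / (u - x) ^ 1) contour_integrable_on circlepath x0 \<rho>"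
      using \<rho> by (intro contour_integrable_continuous_circlepath) auto
    moreover have "contour_integral (circlepath x0 \<rho>) (\<lambda>u. F u / (u - x) ^ 1) = 2 * pi * \<i> * F x"
    proof -
    have "contour_integral (circlepath x0 \<rho>) (\<lambda>u. F u / (u - x) ^ 1) =
        contour_integral (circlepath x0 \<rho>) (\<lambda>u. contour_integral (circlepath z r) (\<lambda>w. K u w / (u - x)))"
    proof (rule contour_integral_eq)
      fix u assume "u \<in> path_image (circlepath x0 \<rho>)"
      then have "u \<in> A" using sub \<rho> by auto
      have "continuous_on (sphere z r) (K u)"
        using \<open>u \<in> A\<close> by (intro continuous_on_compose2[OF cont, of _ "\<lambda>w. (u, w)", simplified] continuous_intros) auto
      then have "K u contour_integrable_on circlepath z r"
        using r by (intro contour_integrable_continuous_circlepath) auto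
      then show "F u / (u - x) ^ 1 = contour_integral (circlepath z r) (\<lambda>w. K u w / (u - x))"
        by (simp add: F_def contour_integral_div)
    qed
    also have "\<dots> = contour_integral (circlepath z r) (\<lambda>w. contour_integral (circlepath x0 \<rho>) (\<lambda>u. K u w / (u - x)))"
    proof (rule contour_integral_swap)
      show "continuous_on (path_image (circlepath x0 \<rho>) \<times> path_image (circlepath z r)) (\<lambda>(u, w). K u w / (u - x))"
        unfolding case_prod_unfold using sub \<rho> r x
        by (intro continuous_intros continuous_on_subset[OF cont, unfolded case_prod_unfold]) auto
    qed (auto intro: continuous_on_vector_derivative_circlepath)
    also have "\<dots> = contour_integral (circlepath z r) (\<lambda>w. (2 * pi * \<i>) * K x w)"
    proof (rule contour_integral_eq)
      fix w assume "w \<in> path_image (circlepath z r)"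
      then have w: "w \<in> sphere z r" using r by auto
      have "continuous_on (cball x0 \<rho>) (\<lambda>x. K x w)" "(\<lambda>x. K x w) holomorphic_on ball x0 \<rho>"
        using hol[OF w] \<rho> ball_subset_cball[of x0 \<rho>]
        by (meson holomorphic_on_imp_continuous_on holomorphic_on_subset subset_trans)+
      from Cauchy_integral_circlepath[OF this] x
      show "contour_integral (circlepath x0 \<rho>) (\<lambda>u. K u w / (u - x)) = (2 * pi * \<i>) * K x w"
        by (intro contour_integral_unique) (auto simp: dist_norm norm_minus_commute)
    qed
    also have "\<dots> = (2 * pi * \<i>) * F x"
    proof -
      have "x \<in> A" using x \<rho> by auto
      have "continuous_on (sphere z r) (K x)"
        using \<open>x \<in> A\<close> by (intro continuous_on_compose2[OF cont, of _ "\<lambda>w. (x, w)", simplified] continuous_intros) auto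
      then have "K x contour_integrable_on circlepath z r"
        using r by (intro contour_integrable_continuous_circlepath) auto
      then show ?thesis by (simp add: F_def contour_integral_lmul)
    qed
    finally show ?thesis .
    qed
    ultimately show ?thesis by (metis has_contour_integral_integral)
  qed
  from Cauchy_next_derivative_circlepath(2)[OF _ this _ centre_in_ball[THEN iffD2, OF \<rho>(1)]]
  obtain D where "((\<lambda>x. 2 * pi * \<i> * F x) has_field_derivative D) (at x0)"
    using \<rho> by (force intro: continuous_on_subset[OF contF])
  from DERIV_cmult[OF this, of "1 / (2 * pi * \<i>)"]
  show "\<exists>D. ((\<lambda>x. contour_integral (circlepath z r) (K x)) has_field_derivative D) (at x0)"
    unfolding F_def by (intro exI) (simp add: field_simps)
qed

text \<open>Used for two kernels: the function itself with exponent l + 1, which represents its l-th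
  derivative, and the quotient \<open>g / W\<close> with exponent 1 in the division by
  \<open>W\<close>.\<close>

lemma hol2_Cauchy_kernel:
  assumes A: "open A" and e: "e > 0"
    and cont: "continuous_on (A \<times> sphere 0 e) (\<lambda>(x, w). K x w)"
    and hol: "\<And>w. w \<in> sphere 0 e \<Longrightarrow> (\<lambda>x. K x w) holomorphic_on A"
  shows "hol2 A (ball 0 e) (\<lambda>x y. contour_integral (circlepath 0 e) (\<lambda>w. K x w / (w - y) ^ n))"
  unfolding hol2_def
proof (intro conjI ballI)
  have "continuous_on ((A \<times> ball 0 e) \<times> sphere 0 e) (\<lambda>(p, w). K (fst p) w / (w - snd p) ^ n)"
    unfolding case_prod_unfold
    by (intro continuous_intros continuous_on_compose2[OF cont[unfolded case_prod_unfold],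
          where f = "\<lambda>x. (fst (fst x), snd x)", simplified]) auto
  from continuous_on_contour_integral_circlepath[OF this] e
  show "continuous_on (A \<times> ball 0 e) (\<lambda>(x, y). contour_integral (circlepath 0 e) (\<lambda>w. K x w / (w - y) ^ n))"
    by (simp add: case_prod_unfold)
next
  fix y :: complex assume y: "y \<in> ball 0 e"
  show "(\<lambda>x. contour_integral (circlepath 0 e) (\<lambda>w. K x w / (w - y) ^ n)) holomorphic_on A"
  proof (rule holomorphic_on_contour_integral_circlepath)
    show "continuous_on (A \<times> sphere 0 e) (\<lambda>(x, w). K x w / (w - y) ^ n)"
      unfolding case_prod_unfold using y
      by (intro continuous_intros cont[unfolded case_prod_unfold]) auto
    show "(\<lambda>x. K x w / (w - y) ^ n) holomorphic_on A" if "w \<in> sphere 0 e" for w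
      using that y by (intro holomorphic_intros hol) auto
  qed (use A e in auto)
next
  fix x assume x: "x \<in> A"
  have K: "continuous_on (sphere 0 e) (K x)"
    using x by (intro continuous_on_compose2[OF cont, of _ "\<lambda>w. (x, w)", simplified] continuous_intros) auto
  show "(\<lambda>y. contour_integral (circlepath 0 e) (\<lambda>w. K x w / (w - y) ^ n)) holomorphic_on ball 0 e"
  proof (rule holomorphic_on_contour_integral_circlepath)
    show "continuous_on (ball 0 e \<times> sphere 0 e) (\<lambda>(y, w). K x w / (w - y) ^ n)"
      unfolding case_prod_unfold
      by (intro continuous_intros continuous_on_compose2[OF K]) auto
    show "(\<lambda>y. K x w / (w - y) ^ n) holomorphic_on ball 0 e" if "w \<in> sphere 0 e" for w
      using that by (intro holomorphic_intros) auto
  qed (use e in auto)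
qed

lemma hol2_on_cylinder:
  assumes "hol2 A (ball 0 R) G" "e < R"
  shows "continuous_on (A \<times> sphere 0 e) (\<lambda>(x, w). G x w)"
    and "\<And>w. w \<in> sphere 0 e \<Longrightarrow> (\<lambda>x. G x w) holomorphic_on A"
    and "\<And>x. x \<in> A \<Longrightarrow> continuous_on (cball 0 e) (G x)"
    and "\<And>x. x \<in> A \<Longrightarrow> G x holomorphic_on ball 0 e"
proof -
  show "continuous_on (A \<times> sphere 0 e) (\<lambda>(x, w). G x w)"
    by (rule continuous_on_subset[OF hol2_continuous[OF assms(1)]]) (use assms(2) in auto)
  show "\<And>w. w \<in> sphere 0 e \<Longrightarrow> (\<lambda>x. G x w) holomorphic_on A"
    using hol2_holomorphic1[OF assms(1)] assms(2) by auto
  have "G x holomorphic_on cball 0 e" if "x \<in> A" for x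
    by (rule holomorphic_on_subset[OF hol2_holomorphic2[OF assms(1) that]]) (use assms(2) in auto)
  then show "continuous_on (cball 0 e) (G x)" "G x holomorphic_on ball 0 e" if "x \<in> A" for x
    using that holomorphic_on_imp_continuous_on holomorphic_on_subset[OF _ ball_subset_cball] by blast+
qed

text \<open>On a disc of radius e < R the derivative is a Cauchy integral over the circle of radius
  e, to which \<open>hol2_Cauchy_kernel\<close> applies. Each y lies in such a disc, and joint
  continuity and holomorphy in x need only be known near each y.\<close>

lemma hol2_higher_deriv:
  assumes A: "open A" and G: "hol2 A (ball 0 R) G"
  shows "hol2 A (ball 0 R) (\<lambda>x. (deriv ^^ l) (G x))"
  unfolding hol2_def
proof (intro conjI ballI)
  have loc: "hol2 A (ball 0 e) (\<lambda>x. (deriv ^^ l) (G x))" if e: "0 < e" "e < R" for e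
  proof -
    note c = hol2_on_cylinder[OF G e(2)]
    have "hol2 A (ball 0 e) (\<lambda>x y. (fact l / (2 * pi * \<i>)) * contour_integral (circlepath 0 e) (\<lambda>w. G x w / (w - y) ^ Suc l))"
      by (intro hol2_mult hol2_Cauchy_kernel A e(1) c(1,2) hol2_fst holomorphic_on_const)
    moreover have "(fact l / (2 * pi * \<i>)) * contour_integral (circlepath 0 e) (\<lambda>w. G x w / (w - y) ^ Suc l) = (deriv ^^ l) (G x) y"
      if "x \<in> A" "y \<in> ball 0 e" for x y
      using contour_integral_unique[OF Cauchy_has_contour_integral_higher_derivative_circlepath[OF c(3,4)[OF that(1)] that(2), of l]]
      by (simp add: field_simps)
    ultimately show ?thesis by (subst (asm) hol2_cong) auto
  qed
  have "continuous (at p) (\<lambda>(x, y). (deriv ^^ l) (G x) y)" if p: "p \<in> A \<times> ball 0 R" for p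
  proof -
    obtain e where e: "norm (snd p) < e" "e < R" using p dense[of "norm (snd p)" R] by (auto simp: mem_Times_iff)
    then have "0 < e" by (meson norm_ge_zero le_less_trans)
    have "open (A \<times> ball (0::complex) e)" using A by (intro open_Times) auto
    then show ?thesis using loc[OF \<open>0 < e\<close> e(2), THEN hol2_continuous] e(1) p
      by (cases p) (auto simp: continuous_on_eq_continuous_at)
  qed
  then show "continuous_on (A \<times> ball 0 R) (\<lambda>(x, y). (deriv ^^ l) (G x) y)"
    by (rule continuous_at_imp_continuous_on[OF ballI])
  fix y :: complex assume "y \<in> ball 0 R"
  then obtain e where e: "norm y < e" "e < R" using dense[of "norm y" R] by auto
  then have "0 < e" by (meson norm_ge_zero le_less_trans)
  then show "(\<lambda>x. (deriv ^^ l) (G x) y) holomorphic_on A"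
    using hol2_holomorphic1[OF loc[OF _ e(2)], of y] e(1) by auto
next
  fix x assume "x \<in> A"
  then show "(deriv ^^ l) (G x) holomorphic_on ball 0 R"
    using hol2_holomorphic2[OF G] by (intro holomorphic_higher_deriv) auto
qed

text \<open>Osgood's lemma: Cauchy's formula makes the second partial derivative jointly continuous.\<close>

lemma complex_differentiable_at_if_hol2:
  assumes A: "open A" and G: "hol2 A (ball 0 R) G" and x: "x \<in> A" and y: "y \<in> ball 0 R"
  shows "complex_differentiable_at (\<lambda>z. G (z $ 1) (z $ 2)) (vec2 x y)"
proof -
  define D where "D = (\<lambda>x. deriv (G x))"
  have D: "continuous_on (A \<times> ball 0 R) (\<lambda>(x, y). D x y)"
    using hol2_continuous[OF hol2_higher_deriv[OF A G, of 1]] by (simp add: D_def)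
  obtain d where d: "((\<lambda>x. G x y) has_field_derivative d) (at x)"
    using hol2_holomorphic1[OF G y] x A by (auto simp: holomorphic_on_open)
  have op: "open (A \<times> ball (0::complex) R)" using A by (intro open_Times) auto
  have "((\<lambda>(x, y). G x y) has_derivative (\<lambda>(tx, ty). d * tx + blinfun_mult_right (D x y) ty))
      (at (x, y) within A \<times> ball 0 R)"
  proof (rule has_derivative_partialsI)
    show "((\<lambda>x. G x y) has_derivative (*) d) (at x within A)"
      using d unfolding has_field_derivative_def by (rule has_derivative_at_withinI)
    show "(G x has_derivative blinfun_apply (blinfun_mult_right (D x y))) (at y within ball 0 R)"
      if "x \<in> A" "y \<in> ball 0 R" for x y
    proof -
      have "(G x has_field_derivative D x y) (at y)"
        unfolding D_def using hol2_holomorphic2[OF G that(1)] that(2)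
        by (intro holomorphic_derivI) auto
      then show ?thesis
        unfolding has_field_derivative_def by (auto intro: has_derivative_at_withinI)
    qed
    have "continuous (at (x, y) within A \<times> ball 0 R) (\<lambda>(x, y). D x y)"
      using D x y by (auto simp: continuous_on_eq_continuous_within)
    from bounded_linear.continuous[OF bounded_linear_blinfun_mult_right this]
    show "continuous (at (x, y) within A \<times> ball 0 R) (\<lambda>(x, y). blinfun_mult_right (D x y))"
      by (simp add: case_prod_unfold)
  qed (use y in auto)
  then have "((\<lambda>(x, y). G x y) has_derivative (\<lambda>(tx, ty). d * tx + D x y * ty)) (at (x, y))"
    using at_within_open[OF _ op, of "(x, y)"] x y by simp
  moreover have "((\<lambda>z::complex^2. (z $ 1, z $ 2)) has_derivative (\<lambda>v. (v $ 1, v $ 2))) (at (vec2 x y))"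
    by (intro has_derivative_Pair bounded_linear.has_derivative[OF bounded_linear_vec_nth] has_derivative_ident)
  ultimately have "((\<lambda>z. G (z $ 1) (z $ 2)) has_derivative (\<lambda>v. d * v $ 1 + D x y * v $ 2)) (at (vec2 x y))"
    using has_derivative_compose[of "\<lambda>z::complex^2. (z $ 1, z $ 2)" "\<lambda>v. (v $ 1, v $ 2)" "vec2 x y" UNIV
      "\<lambda>(x, y). G x y" "\<lambda>(tx, ty). d * tx + D x y * ty"] by simp
  then show ?thesis unfolding complex_differentiable_at_def
    by (intro exI[of _ "vec2 d (D x y)"]) (simp add: sum_2)
qed

lemma holomorphic2_near_0_if_hol2:
  assumes A: "open A" "0 \<in> A" and R: "R > 0" and G: "hol2 A (ball 0 R) G"
  shows "holomorphic2_near_0 (\<lambda>z. G (z $ 1) (z $ 2))"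
  unfolding holomorphic2_near_0_def holomorphic2_on_def
proof (intro exI conjI ballI)
  have "open ((\<lambda>z::complex^2. (z $ 1, z $ 2)) -` (A \<times> ball 0 R))"
    using A by (intro open_vimage open_Times continuous_intros) auto
  moreover have "(\<lambda>z::complex^2. (z $ 1, z $ 2)) -` (A \<times> ball 0 R) = {z. z $ 1 \<in> A \<and> z $ 2 \<in> ball 0 R}"
    by auto
  ultimately show "open {z::complex^2. z $ 1 \<in> A \<and> z $ 2 \<in> ball 0 R}" by simp
  show "complex_differentiable_at (\<lambda>z. G (z $ 1) (z $ 2)) z"
    if "z \<in> {z. z $ 1 \<in> A \<and> z $ 2 \<in> ball 0 R}" for z
    using complex_differentiable_at_if_hol2[OF A(1) G, of "z $ 1" "z $ 2"] that by simp
qed (use A R in auto)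

section \<open>Taylor expansion and initial forms\<close>

lemma eventually_nhds_0_vec2:
  "eventually P (nhds (0::complex^2)) \<longleftrightarrow> (\<exists>r>0. \<forall>x y. norm x < r \<longrightarrow> norm y < r \<longrightarrow> P (vec2 x y))"
proof
  assume "eventually P (nhds 0)"
  then obtain d where d: "d > 0" "\<And>z. dist z 0 < d \<Longrightarrow> P z" by (auto simp: eventually_nhds_metric)
  have "P (vec2 x y)" if "norm x < d / 2" "norm y < d / 2" for x y
    using that norm_vec2_le[of x y] by (intro d(2)) simp
  then show "\<exists>r>0. \<forall>x y. norm x < r \<longrightarrow> norm y < r \<longrightarrow> P (vec2 x y)"
    using d(1) by (intro exI[of _ "d / 2"]) auto
next
  assume "\<exists>r>0. \<forall>x y. norm x < r \<longrightarrow> norm y < r \<longrightarrow> P (vec2 x y)"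
  then obtain r where r: "r > 0" "\<And>x y. norm x < r \<Longrightarrow> norm y < r \<Longrightarrow> P (vec2 x y)" by blast
  have "P z" if "dist z 0 < r" for z
    using r(2)[of "z $ 1" "z $ 2"] that Finite_Cartesian_Product.norm_nth_le[of z 1] Finite_Cartesian_Product.norm_nth_le[of z 2] by simp
  then show "eventually P (nhds 0)" unfolding eventually_nhds_metric using r(1) by blast
qed

section \<open>Germs and their representatives\<close>

lemma germ_of_eq_iff:
  assumes "holomorphic2_near_0 f" "holomorphic2_near_0 g"
  shows "germ_of f = germ_of g \<longleftrightarrow> (\<forall>\<^sub>F z in nhds 0. f z = g z)"
  using Quotient3_rel[OF Quotient3_germ, of f g] assms by (auto simp: germ_of_def germ_eq_def)

lemma germ_of_add: 
  "holomorphic2_near_0 f \<Longrightarrow> holomorphic2_near_0 g \<Longrightarrow> germ_of f + germ_of g = germ_of (\<lambda>z. f z + g z)"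
  unfolding germ_of_def by (intro plus_germ.abs_eq) (auto simp: germ_eq_def)

lemma germ_of_mult: 
  "holomorphic2_near_0 f \<Longrightarrow> holomorphic2_near_0 g \<Longrightarrow> germ_of f * germ_of g = germ_of (\<lambda>z. f z * g z)"
  unfolding germ_of_def by (intro times_germ.abs_eq) (auto simp: germ_eq_def)

lemma germ_of_1: "1 = germ_of (\<lambda>z. 1)"
  unfolding germ_of_def by (rule one_germ.abs_eq)

lemma germ_of_0: "0 = germ_of (\<lambda>z. 0)"
  unfolding germ_of_def by (rule zero_germ.abs_eq)

lemma holomorphic2_near_0_prod:
  "(\<And>i. i \<in> I \<Longrightarrow> holomorphic2_near_0 (f i)) \<Longrightarrow> holomorphic2_near_0 (\<lambda>z. \<Prod>i\<in>I. f i z)"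
  by (induction I rule: infinite_finite_induct)
     (auto intro: holomorphic2_near_0_const holomorphic2_near_0_mult)

lemma germ_of_prod:
  "(\<And>i. i \<in> I \<Longrightarrow> holomorphic2_near_0 (f i)) \<Longrightarrow> (\<Prod>i\<in>I. germ_of (f i)) = germ_of (\<lambda>z. \<Prod>i\<in>I. f i z)"
  by (induction I rule: infinite_finite_induct)
     (auto simp: germ_of_1 germ_of_mult holomorphic2_near_0_prod)

lemma germ_cases:
  obtains f where "holomorphic2_near_0 f" "a = germ_of f"
proof
  show "holomorphic2_near_0 (rep_germ a)"
    using Quotient3_rep_reflp[OF Quotient3_germ, of a] by (simp add: germ_eq_def)
  show "a = germ_of (rep_germ a)"
    unfolding germ_of_def by (rule Quotient3_abs_rep[OF Quotient3_germ, symmetric])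
qed

text \<open>Cauchy's inequality bounds the terms of the series by those of a geometric series of
  ratio \<open>norm y / \<rho>\<close>; this ratio is at most 1/2, whence the factor 2.\<close>

lemma taylor_remainder_bound:
  fixes f :: "complex \<Rightarrow> complex"
  assumes f: "continuous_on (cball 0 \<rho>) f" "f holomorphic_on ball 0 \<rho>" and \<rho>: "\<rho> > 0"
    and M: "\<And>w. norm w = \<rho> \<Longrightarrow> norm (f w) \<le> M" and y: "norm y \<le> \<rho> / 2"
  shows "norm (f y - (\<Sum>l<N. (deriv ^^ l) f 0 / fact l * y ^ l)) \<le> 2 * M * (norm y / \<rho>) ^ N"
proof -
  define q where "q = norm y / \<rho>"
  have q: "0 \<le> q" "q \<le> 1 / 2" using y \<rho> by (auto simp: q_def field_simps)
  have M0: "0 \<le> M" using order_trans[OF norm_ge_zero M[of "of_real \<rho>"]] \<rho> by simp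
  define a where "a = (\<lambda>l. (deriv ^^ l) f 0 / fact l * y ^ l)"
  have "y \<in> ball 0 \<rho>" using y \<rho> by auto
  from holomorphic_power_series[OF f(2) this] have "a sums f y" by (simp add: a_def)
  then have tail: "(\<lambda>n. a (n + N)) sums (f y - (\<Sum>l<N. a l))" by (simp add: sums_iff_shift)
  have bound: "norm (a n) \<le> M * q ^ n" for n
  proof -
    have "norm ((deriv ^^ n) f 0) \<le> fact n * M / \<rho> ^ n"
      by (rule Cauchy_inequality) (use f \<rho> M in auto)
    then have "norm ((deriv ^^ n) f 0) / fact n * norm y ^ n \<le> M / \<rho> ^ n * norm y ^ n"
      by (intro mult_right_mono) (auto simp: field_simps)
    then show ?thesis by (simp add: a_def q_def norm_mult norm_divide norm_power power_divide)
  qed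
  have g: "(\<lambda>n. M * q ^ (n + N)) sums (M * q ^ N * (1 / (1 - q)))"
    using sums_mult[OF geometric_sums[of q], of "M * q ^ N"] q by (simp add: power_add mult_ac)
  have "norm (f y - (\<Sum>l<N. a l)) \<le> (\<Sum>n. M * q ^ (n + N))"
    unfolding sums_unique[OF tail] by (intro norm_suminf_le bound sums_summable[OF g]) 
  also have "\<dots> = M * q ^ N * (1 / (1 - q))" using sums_unique[OF g] by simp
  also have "\<dots> \<le> M * q ^ N * 2"
    using q M0 by (intro mult_left_mono) (auto simp: field_simps)
  finally show ?thesis by (simp add: a_def q_def mult_ac)
qed

lemma partial_deriv_2_funpow:
  "(partial_deriv 2 ^^ l) f (vec2 x y) = (deriv ^^ l) (\<lambda>y. f (vec2 x y)) y"
proof (induction l arbitrary: y)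
  case (Suc l)
  have "(partial_deriv 2 ^^ Suc l) f (vec2 x y) = deriv (\<lambda>t. (partial_deriv 2 ^^ l) f (vec2 x (y + t))) 0"
    by (simp add: partial_deriv_def) (rule arg_cong[of _ _ "\<lambda>g. deriv g 0"], rule ext,
        rule arg_cong[of _ _ "(partial_deriv 2 ^^ l) f"], simp add: vec_eq_iff forall_2 axis_def)
  also have "\<dots> = deriv ((deriv ^^ l) (\<lambda>y. f (vec2 x y))) y"
    unfolding Suc.IH by (subst (2) deriv_shift_0) (simp add: comp_def)
  finally show ?case by simp
qed auto

lemma partial_deriv_1_funpow:
  "(partial_deriv 1 ^^ k) f (vec2 x y) = (deriv ^^ k) (\<lambda>x. f (vec2 x y)) x"
proof (induction k arbitrary: x)
  case (Suc k)
  have "(partial_deriv 1 ^^ Suc k) f (vec2 x y) = deriv (\<lambda>t. (partial_deriv 1 ^^ k) f (vec2 (x + t) y)) 0"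
    by (simp add: partial_deriv_def) (rule arg_cong[of _ _ "\<lambda>g. deriv g 0"], rule ext,
        rule arg_cong[of _ _ "(partial_deriv 1 ^^ k) f"], simp add: vec_eq_iff forall_2 axis_def)
  also have "\<dots> = deriv ((deriv ^^ k) (\<lambda>x. f (vec2 x y))) x"
    unfolding Suc.IH by (subst (2) deriv_shift_0) (simp add: comp_def)
  finally show ?case by simp
qed auto

lemma taylor_coeff_vec2:
  "taylor_coeff f k l = (deriv ^^ k) (\<lambda>x. (deriv ^^ l) (\<lambda>y. f (vec2 x y)) 0) 0 / (fact k * fact l)"
  using partial_deriv_1_funpow[of k "(partial_deriv 2 ^^ l) f" 0 0]
  by (simp add: taylor_coeff_def partial_deriv_2_funpow)

text \<open>Expand in y up to order N; the coefficients are holomorphic in x, and the l-th one need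
  only be expanded up to order N - l because it is multiplied by \<open>y ^ l\<close>. Both errors
  are then of total order N.\<close>

lemma taylor2_remainder_bound:
  assumes G: "hol2 (ball 0 R) (ball 0 R) (\<lambda>x y. f (vec2 x y))" and R: "R > 0"
  shows "\<exists>C r. C > 0 \<and> r > 0 \<and> (\<forall>x y. norm x < r \<longrightarrow> norm y < r \<longrightarrow>
      norm (f (vec2 x y) - (\<Sum>l<N. \<Sum>k<N-l. taylor_coeff f k l * x ^ k * y ^ l)) \<le> C * max (norm x) (norm y) ^ N)"
proof -
  define \<rho> where "\<rho> = R / 2"
  have \<rho>: "\<rho> > 0" "\<rho> < R" using R by (auto simp: \<rho>_def)
  define b where "b = (\<lambda>l x. (deriv ^^ l) (\<lambda>y. f (vec2 x y)) 0 / fact l)"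
  have hb: "b l holomorphic_on ball 0 R" for l
    unfolding b_def using hol2_holomorphic1[OF hol2_higher_deriv[OF _ G, of l]] R
    by (intro holomorphic_intros) auto
  have cb: "(deriv ^^ k) (b l) 0 / fact k = taylor_coeff f k l" for k l
  proof -
    have "(\<lambda>x. (deriv ^^ l) (\<lambda>y. f (vec2 x y)) 0) analytic_on {0}"
      using hol2_holomorphic1[OF hol2_higher_deriv[OF _ G, of l], of 0] R
      by (auto simp: analytic_at intro: exI[of _ "ball 0 R"])
    from higher_deriv_cmult'[OF this, of k "1 / fact l"]
    show ?thesis by (simp add: b_def taylor_coeff_vec2 mult.commute)
  qed
  have "compact (cball (0::complex) \<rho> \<times> cball (0::complex) \<rho>)" by (intro compact_Times) auto
  moreover have "continuous_on (cball 0 \<rho> \<times> cball 0 \<rho>) (\<lambda>(x, y). f (vec2 x y))"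
    by (rule continuous_on_subset[OF hol2_continuous[OF G]]) (use \<rho> in auto)
  ultimately have "bounded ((\<lambda>(x, y). f (vec2 x y)) ` (cball 0 \<rho> \<times> cball 0 \<rho>))"
    by (intro compact_imp_bounded compact_continuous_image)
  then obtain M where M: "\<And>x y. norm x \<le> \<rho> \<Longrightarrow> norm y \<le> \<rho> \<Longrightarrow> norm (f (vec2 x y)) \<le> M"
    unfolding bounded_iff by fastforce
  have M0: "0 \<le> M" using order_trans[OF norm_ge_zero M[of 0 0]] \<rho> by simp
  have 1: "norm (f (vec2 x y) - (\<Sum>l<N. b l x * y ^ l)) \<le> 2 * M * (norm y / \<rho>) ^ N"
    if "norm x \<le> \<rho>" "norm y \<le> \<rho> / 2" for x y
    unfolding b_def
    by (rule taylor_remainder_bound[where f = "\<lambda>y. f (vec2 x y)"])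
       (use hol2_on_cylinder(3,4)[OF G \<rho>(2), of x] \<rho> that M in auto)
  have "\<exists>B\<ge>0. \<forall>x. norm x \<le> \<rho> \<longrightarrow> norm (b l x) \<le> B" for l
  proof -
    have "continuous_on (cball 0 \<rho>) (b l)"
      by (rule continuous_on_subset[OF holomorphic_on_imp_continuous_on[OF hb]]) (use \<rho> in auto)
    then have "bounded (b l ` cball 0 \<rho>)" by (intro compact_imp_bounded compact_continuous_image) auto
    then obtain B where "\<And>x. norm x \<le> \<rho> \<Longrightarrow> norm (b l x) \<le> B" unfolding bounded_iff by fastforce
    moreover from this[of 0] have "0 \<le> B" using \<rho> order_trans[OF norm_ge_zero] by auto
    ultimately show ?thesis by blast
  qed
  then obtain B where B: "\<And>l. B l \<ge> 0" "\<And>l x. norm x \<le> \<rho> \<Longrightarrow> norm (b l x) \<le> B l" by metis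
  have 2: "norm (b l x - (\<Sum>k<n. taylor_coeff f k l * x ^ k)) \<le> 2 * B l * (norm x / \<rho>) ^ n"
    if "norm x \<le> \<rho> / 2" for x l n
    unfolding cb[symmetric]
    by (rule taylor_remainder_bound)
       (use \<rho> B that in \<open>auto intro!: holomorphic_on_imp_continuous_on holomorphic_on_subset[OF hb]\<close>)
  \<comment> \<open>The first term is the error of the expansion in y, the l-th summand that of
    expanding \<open>b l\<close> in x; adding 1 keeps C positive even when M and all
    \<open>B l\<close> are 0.\<close>
  define C where "C = 2 * M / \<rho> ^ N + (\<Sum>l<N. 2 * B l / \<rho> ^ (N - l)) + 1"
  show ?thesis
  proof (intro exI conjI allI impI)
    show "C > 0" unfolding C_def using M0 B \<rho> by (intro add_nonneg_pos add_nonneg_nonneg sum_nonneg) auto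
    show "\<rho> / 2 > 0" using \<rho> by auto
    fix x y :: complex assume xy: "norm x < \<rho> / 2" "norm y < \<rho> / 2"
    define m where "m = max (norm x) (norm y)"
    have m: "norm x \<le> m" "norm y \<le> m" "0 \<le> m" by (auto simp: m_def le_max_iff_disj)
    have "norm (f (vec2 x y) - (\<Sum>l<N. \<Sum>k<N-l. taylor_coeff f k l * x ^ k * y ^ l)) =
        norm ((f (vec2 x y) - (\<Sum>l<N. b l x * y ^ l)) + (\<Sum>l<N. (b l x - (\<Sum>k<N-l. taylor_coeff f k l * x ^ k)) * y ^ l))"
      by (simp add: algebra_simps sum_subtractf sum_distrib_left)
    also have "\<dots> \<le> norm (f (vec2 x y) - (\<Sum>l<N. b l x * y ^ l)) +
        (\<Sum>l<N. norm (b l x - (\<Sum>k<N-l. taylor_coeff f k l * x ^ k)) * norm y ^ l)"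
      by (rule norm_triangle_le[OF add_left_mono]) (rule sum_norm_le, simp add: norm_mult norm_power)
    also have "\<dots> \<le> 2 * M * (m / \<rho>) ^ N + (\<Sum>l<N. 2 * B l * (m / \<rho>) ^ (N - l) * m ^ l)"
    proof (intro add_mono sum_mono mult_mono)
      have "2 * M * (norm y / \<rho>) ^ N \<le> 2 * M * (m / \<rho>) ^ N"
        using M0 \<rho> m by (intro mult_left_mono power_mono divide_right_mono) auto
      with 1[of x y] xy \<rho> show "norm (f (vec2 x y) - (\<Sum>l<N. b l x * y ^ l)) \<le> 2 * M * (m / \<rho>) ^ N" by auto
      fix l
      have "2 * B l * (norm x / \<rho>) ^ (N - l) \<le> 2 * B l * (m / \<rho>) ^ (N - l)"
        using B \<rho> m by (intro mult_left_mono power_mono divide_right_mono) auto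
      with 2[of x l "N - l"] xy
      show "norm (b l x - (\<Sum>k<N-l. taylor_coeff f k l * x ^ k)) \<le> 2 * B l * (m / \<rho>) ^ (N - l)" by auto
    qed (use m B \<rho> in \<open>auto intro: power_mono\<close>)
    also have "(\<Sum>l<N. 2 * B l * (m / \<rho>) ^ (N - l) * m ^ l) = (\<Sum>l<N. 2 * B l / \<rho> ^ (N - l)) * m ^ N"
      unfolding sum_distrib_right
    proof (rule sum.cong[OF refl])
      fix l assume "l \<in> {..<N}"
      then have "m ^ N = m ^ (N - l) * m ^ l" by (simp flip: power_add)
      then show "2 * B l * (m / \<rho>) ^ (N - l) * m ^ l = 2 * B l / \<rho> ^ (N - l) * m ^ N"
        by (simp add: power_divide)
    qed
    also have "2 * M * (m / \<rho>) ^ N + (\<Sum>l<N. 2 * B l / \<rho> ^ (N - l)) * m ^ N \<le> C * m ^ N"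
      using m by (simp add: C_def power_divide algebra_simps)
    finally show "norm (f (vec2 x y) - (\<Sum>l<N. \<Sum>k<N-l. taylor_coeff f k l * x ^ k * y ^ l)) \<le> C * max (norm x) (norm y) ^ N"
      by (simp add: m_def)
  qed
qed

text \<open>At (x + a y, y) the initial form of degree n equals
  \<open>y ^ n * P (a + x / y)\<close>, and \<open>P a\<close> is nonzero by the choice of a. On a
  narrow cone about x = 0 the function therefore has the exact size \<open>norm y ^ n\<close>; in
  particular the cone contains no zeros except its vertex.\<close>

lemma initial_form_bounds:
  assumes f: "holomorphic2_near_0 f" and low: "\<And>k l. k + l < n \<Longrightarrow> taylor_coeff f k l = 0"
    and a: "(\<Sum>k\<le>n. taylor_coeff f k (n - k) * a ^ k) \<noteq> 0"
  obtains c C \<eta> r where "c > 0" "C > 0" "\<eta> > 0" "r > 0"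
    "\<And>x y. norm y < r \<Longrightarrow> y \<noteq> 0 \<Longrightarrow> norm x \<le> \<eta> * norm y \<Longrightarrow>
      c * norm y ^ n \<le> norm (f (vec2 (x + a * y) y)) \<and> norm (f (vec2 (x + a * y) y)) \<le> C * norm y ^ n"
proof -
  obtain R where R: "R > 0" "hol2 (ball 0 R) (ball 0 R) (\<lambda>x y. f (vec2 x y))"
    using hol2_if_holomorphic2_near_0[OF f] .
  obtain C0 r0 where C0: "C0 > 0" "r0 > 0" and bd:
    "\<And>x y. norm x < r0 \<Longrightarrow> norm y < r0 \<Longrightarrow>
      norm (f (vec2 x y) - (\<Sum>l<Suc n. \<Sum>k<Suc n-l. taylor_coeff f k l * x ^ k * y ^ l)) \<le> C0 * max (norm x) (norm y) ^ Suc n"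
    using taylor2_remainder_bound[OF R(2,1), of "Suc n"] by blast
  define P where "P = (\<lambda>\<xi>. \<Sum>k\<le>n. taylor_coeff f k (n - k) * \<xi> ^ k)"
  define d where "d = norm (P a)"
  have d: "d > 0" using a by (simp add: d_def P_def)
  have form: "(\<Sum>l<Suc n. \<Sum>k<Suc n-l. taylor_coeff f k l * x ^ k * y ^ l) = y ^ n * P (x / y)" if "y \<noteq> 0" for x y
  proof -
    have "(\<Sum>l<Suc n. \<Sum>k<Suc n-l. taylor_coeff f k l * x ^ k * y ^ l) =
        (\<Sum>l<Suc n. taylor_coeff f (n - l) l * x ^ (n - l) * y ^ l)"
    proof (rule sum.cong[OF refl])
      fix l assume l: "l \<in> {..<Suc n}"
      have "(\<Sum>k<Suc n-l. taylor_coeff f k l * x ^ k * y ^ l) = (\<Sum>k\<in>{n-l}. taylor_coeff f k l * x ^ k * y ^ l)"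
        using l by (intro sum.mono_neutral_right) (auto intro!: low)
      then show "(\<Sum>k<Suc n-l. taylor_coeff f k l * x ^ k * y ^ l) = taylor_coeff f (n - l) l * x ^ (n - l) * y ^ l"
        by simp
    qed
    also have "\<dots> = (\<Sum>k<Suc n. taylor_coeff f k (n - k) * x ^ k * y ^ (n - k))"
      by (subst sum.nat_diff_reindex[symmetric]) (auto intro!: sum.cong)
    also have "\<dots> = y ^ n * P (x / y)"
      unfolding P_def sum_distrib_left lessThan_Suc_atMost
      using that by (intro sum.cong) (auto simp: power_divide power_diff field_simps)
    finally show ?thesis .
  qed
  have "isCont P a" unfolding P_def by (intro continuous_intros)
  then obtain \<delta> where \<delta>: "\<delta> > 0" "\<And>\<xi>. norm (\<xi> - a) < \<delta> \<Longrightarrow> norm (P \<xi> - P a) < d / 2"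
    using d unfolding continuous_at_eps_delta dist_norm by (metis half_gt_zero)
  define \<eta> where "\<eta> = min 1 (\<delta> / 2)"
  have \<eta>: "\<eta> > 0" "\<eta> \<le> 1" "\<eta> < \<delta>" using \<delta> by (auto simp: \<eta>_def)
  define K where "K = 2 + norm a"
  have K: "K \<ge> 1" by (simp add: K_def add_increasing2)
  define Q where "Q = C0 * K ^ Suc n"
  have Q: "Q > 0" using C0 K by (simp add: Q_def)
  \<comment> \<open>The first bound keeps the sheared point within reach of the Taylor estimate, the
    second makes the remainder of order n + 1 at most \<open>d / 4 * norm y ^ n\<close>. With d / 2
    for the variation of P this leaves d / 4 from below and less than 2 d from above.\<close>
  define r where "r = min (r0 / K) (d / (4 * Q))"
  have r: "r > 0" "r \<le> r0 / K" "r \<le> d / (4 * Q)" using C0 K d Q by (auto simp: r_def)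
  show ?thesis
  proof
    show "d / 4 > 0" "2 * d > 0" "\<eta> > 0" "r > 0" using d \<eta> r by auto
    fix x y :: complex assume y: "norm y < r" "y \<noteq> 0" and x: "norm x \<le> \<eta> * norm y"
    have x': "norm (x + a * y) \<le> K * norm y"
    proof -
      have "norm (x + a * y) \<le> \<eta> * norm y + norm a * norm y"
        using x norm_triangle_ineq[of x "a * y"] by (simp add: norm_mult)
      also have "\<dots> \<le> K * norm y" using \<eta> by (simp add: K_def mult_right_mono flip: distrib_right)
      finally show ?thesis .
    qed
    have Ky: "norm y \<le> K * norm y" using K by (simp add: mult_le_cancel_right1)
    have "K * norm y < r0"
    proof -
      have "K * norm y < K * (r0 / K)" using y r K by (intro mult_strict_left_mono) auto
      then show ?thesis using K by simp
    qed
    then have 0: "norm (f (vec2 (x + a * y) y) - y ^ n * P ((x + a * y) / y)) \<le> C0 * max (norm (x + a * y)) (norm y) ^ Suc n"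
      using bd[of "x + a * y" y] x' Ky y form by simp
    have "max (norm (x + a * y)) (norm y) ^ Suc n \<le> (K * norm y) ^ Suc n"
      using x' Ky by (intro power_mono) (auto simp: le_max_iff_disj)
    then have "C0 * max (norm (x + a * y)) (norm y) ^ Suc n \<le> C0 * (K * norm y) ^ Suc n"
      using C0(1) by (rule mult_left_mono[OF _ less_imp_le])
    also have "C0 * (K * norm y) ^ Suc n = (Q * norm y) * norm y ^ n"
      by (simp add: Q_def power_mult_distrib)
    also have "Q * norm y \<le> Q * (d / (4 * Q))"
      using Q y(1) r(3) by (intro mult_left_mono) auto
    then have "Q * norm y \<le> d / 4" using Q by simp
    then have "(Q * norm y) * norm y ^ n \<le> d / 4 * norm y ^ n" by (rule mult_right_mono) simp
    finally have 1: "norm (f (vec2 (x + a * y) y) - y ^ n * P ((x + a * y) / y)) \<le> d / 4 * norm y ^ n"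
      using 0 by (rule order_trans[rotated])
    have "(x + a * y) / y - a = x / y" using y(2) by (simp add: add_divide_distrib)
    then have "norm ((x + a * y) / y - a) = norm x / norm y" by (simp only: norm_divide)
    also have "\<dots> \<le> \<eta>" using x y(2) by (simp add: pos_divide_le_eq)
    finally have "norm (P ((x + a * y) / y) - P a) < d / 2" using \<delta> \<eta> by auto
    then have "norm (P ((x + a * y) / y) - P a) * norm y ^ n \<le> d / 2 * norm y ^ n"
      by (intro mult_right_mono) auto
    then have "norm (y ^ n * (P ((x + a * y) / y) - P a)) \<le> d / 2 * norm y ^ n"
      by (simp add: norm_mult norm_power mult.commute)
    then have 2: "norm (y ^ n * P ((x + a * y) / y) - y ^ n * P a) \<le> d / 2 * norm y ^ n"
      by (simp add: algebra_simps)
    have 3: "norm (y ^ n * P a) = d * norm y ^ n" by (simp add: d_def norm_mult norm_power)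
    have 4: "norm (f (vec2 (x + a * y) y) - y ^ n * P a) \<le> d / 4 * norm y ^ n + d / 2 * norm y ^ n"
      using norm_triangle_ineq[of "f (vec2 (x + a * y) y) - y ^ n * P ((x + a * y) / y)" "y ^ n * P ((x + a * y) / y) - y ^ n * P a"] 1 2
      by simp
    have "d * norm y ^ n \<le> norm (f (vec2 (x + a * y) y)) + (d / 4 * norm y ^ n + d / 2 * norm y ^ n)"
      using norm_triangle_ineq2[of "y ^ n * P a" "f (vec2 (x + a * y) y)"] 3 4 by (simp add: norm_minus_commute)
    moreover have "norm (f (vec2 (x + a * y) y)) \<le> d * norm y ^ n + (d / 4 * norm y ^ n + d / 2 * norm y ^ n)"
      using norm_triangle_ineq2[of "f (vec2 (x + a * y) y)" "y ^ n * P a"] 3 4 by simp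
    moreover have "0 \<le> d * norm y ^ n" using d by simp
    ultimately show "d / 4 * norm y ^ n \<le> norm (f (vec2 (x + a * y) y)) \<and> norm (f (vec2 (x + a * y) y)) \<le> 2 * d * norm y ^ n"
      by linarith
  qed
qed

text \<open>The identity theorem twice: for each l the l-th y-derivative at y = 0 is holomorphic in
  x with vanishing Taylor series, hence zero; then every slice in y has vanishing Taylor
  series.\<close>

lemma germ_eq_0_if_taylor_coeff_0:
  assumes f: "holomorphic2_near_0 f" and 0: "\<And>k l. taylor_coeff f k l = 0"
  shows "germ_of f = 0"
proof -
  obtain R where R: "R > 0" "hol2 (ball 0 R) (ball 0 R) (\<lambda>x y. f (vec2 x y))"
    using hol2_if_holomorphic2_near_0[OF f] .
  have b: "(deriv ^^ l) (\<lambda>y. f (vec2 x y)) 0 = 0" if "norm x < R" for x l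
    by (rule holomorphic_fun_eq_0_on_connected[of "\<lambda>x. (deriv ^^ l) (\<lambda>y. f (vec2 x y)) 0" "ball 0 R" 0])
       (use hol2_holomorphic1[OF hol2_higher_deriv[OF _ R(2), of l]] R(1) that 0[of _ l] in
        \<open>auto simp: taylor_coeff_vec2\<close>)
  have "f (vec2 x y) = 0" if "norm x < R" "norm y < R" for x y
    by (rule holomorphic_fun_eq_0_on_connected[of "\<lambda>y. f (vec2 x y)" "ball 0 R" 0])
       (use hol2_holomorphic2[OF R(2)] R(1) that b in auto)
  then have "\<forall>\<^sub>F z in nhds 0. f z = 0" unfolding eventually_nhds_0_vec2 using R(1) by blast
  then show ?thesis by (simp add: germ_of_0 germ_of_eq_iff[OF f holomorphic2_near_0_const])
qed

text \<open>The excluded values a are the roots of the dehomogenized initial form, a nonzero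
  polynomial. As only finitely many shears are bad for one germ, a single shear suits finitely many
  germs.\<close>

lemma ord_at_0_finite:
  assumes f: "holomorphic2_near_0 f" and nz: "germ_of f \<noteq> 0"
  shows "\<exists>n. ord_at_0 f = enat n \<and> (\<forall>k l. k + l < n \<longrightarrow> taylor_coeff f k l = 0) \<and>
    finite {a. (\<Sum>k\<le>n. taylor_coeff f k (n - k) * a ^ k) = 0}"
proof -
  define S where "S = {enat (k + l) | k l. taylor_coeff f k l \<noteq> 0}"
  obtain k0 l0 where "taylor_coeff f k0 l0 \<noteq> 0" using germ_eq_0_if_taylor_coeff_0[OF f] nz by blast
  then have "enat (k0 + l0) \<in> S" by (auto simp: S_def)
  then have "Inf S \<in> S" by (rule wellorder_InfI)
  then obtain k l where kl: "Inf S = enat (k + l)" "taylor_coeff f k l \<noteq> 0" by (auto simp: S_def)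
  show ?thesis
  proof (intro exI[of _ "k + l"] conjI allI impI)
    show "ord_at_0 f = enat (k + l)" using kl by (simp add: ord_at_0_def S_def)
    fix k' l' assume *: "k' + l' < k + l"
    show "taylor_coeff f k' l' = 0"
    proof (rule ccontr)
      assume "taylor_coeff f k' l' \<noteq> 0"
      then have "enat (k' + l') \<in> S" by (auto simp: S_def)
      then have "Inf S \<le> enat (k' + l')" by (rule Inf_lower)
      with * kl show False by simp
    qed
  next
    show "finite {a. (\<Sum>i\<le>k+l. taylor_coeff f i (k + l - i) * a ^ i) = 0}"
      using kl(2) unfolding polyfun_finite_roots by (intro exI[of _ k]) simp
  qed
qed

section \<open>Roots of a family of holomorphic functions\<close>

text \<open>The point q, where f is nonzero, rules out that f vanishes identically near p.\<close>

lemma zorder_pos_if_zero: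
  assumes "f holomorphic_on S" "open S" "connected S" "p \<in> S" "f p = 0" "q \<in> S" "f q \<noteq> 0"
  shows "zorder f p > 0"
proof -
  obtain r where r: "0 < r" "\<And>z. z \<in> ball p r - {p} \<Longrightarrow> f z \<noteq> 0"
    using isolated_zeros[OF assms] by metis
  then have "eventually (\<lambda>z. f z \<noteq> 0) (at p)"
    unfolding eventually_at by (auto simp: dist_commute intro!: exI[of _ r])
  then have "frequently (\<lambda>z. f z \<noteq> 0) (at p)" by (simp add: eventually_frequently)
  from zorder_pos_iff[OF assms(1,2,4) this] assms(5) show ?thesis by simp
qed

lemma argument_principle_circle:
  assumes f: "f holomorphic_on ball c r" and g: "g holomorphic_on ball c r" and \<rho>: "0 < \<rho>" "\<rho> < r"
    and nz: "\<And>w. w \<in> sphere c \<rho> \<Longrightarrow> f w \<noteq> 0"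
  shows "contour_integral (circlepath c \<rho>) (\<lambda>w. deriv f w * g w / f w) =
      2 * pi * \<i> * (\<Sum>p\<in>{p\<in>ball c \<rho>. f p = 0}. g p * of_int (zorder f p))"
    and "finite {p\<in>ball c \<rho>. f p = 0}"
    and "\<And>p. p \<in> ball c \<rho> \<Longrightarrow> f p = 0 \<Longrightarrow> zorder f p > 0"
proof -
  \<comment> \<open>In the whole disc of radius r there may be infinitely many zeros; in the compact
    disc of an intermediate radius there are finitely many, and the circle still lies inside
    it.\<close>
  define \<rho>' where "\<rho>' = (\<rho> + r) / 2"
  have \<rho>': "\<rho> < \<rho>'" "\<rho>' < r" using \<rho> by (auto simp: \<rho>'_def)
  have q: "c + of_real \<rho> \<in> sphere c \<rho>" using \<rho> by (simp add: dist_norm)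
  then have q': "c + of_real \<rho> \<in> ball c r" "f (c + of_real \<rho>) \<noteq> 0" using \<rho> nz by (auto simp: dist_norm)
  show pos: "\<And>p. p \<in> ball c \<rho> \<Longrightarrow> f p = 0 \<Longrightarrow> zorder f p > 0"
    using zorder_pos_if_zero[OF f _ _ _ _ q'] \<rho> by auto
  have fin: "finite {w \<in> cball c \<rho>'. f w = 0}"
  proof (cases "\<exists>p\<in>ball c r. f p = 0")
    case True
    then have "\<not> f constant_on ball c r" using q' unfolding constant_on_def by metis
    then show ?thesis using \<rho>' by (intro holomorphic_compact_finite_zeros[OF f]) auto
  next
    case False
    then have "{w \<in> cball c \<rho>'. f w = 0} = {}" using \<rho>' by auto
    then show ?thesis by (metis finite.emptyI)
  qed
  show fin': "finite {p\<in>ball c \<rho>. f p = 0}"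
    by (rule finite_subset[OF _ fin]) (use \<rho>' in auto)
  define pz where "pz = {w\<in>ball c \<rho>'. f w = 0 \<or> w \<in> {}}"
  have finpz: "finite pz" by (rule finite_subset[OF _ fin]) (auto simp: pz_def)
  have "contour_integral (circlepath c \<rho>) (\<lambda>x. deriv f x * g x / f x) = 2 * pi * \<i> *
          (\<Sum>p\<in>pz. winding_number (circlepath c \<rho>) p * g p * zorder f p)"
    unfolding pz_def
  proof (rule argument_principle)
    show "f holomorphic_on ball c \<rho>' - {}" "g holomorphic_on ball c \<rho>'"
      using f g \<rho>' by (auto elim!: holomorphic_on_subset)
    show "path_image (circlepath c \<rho>) \<subseteq> ball c \<rho>' - {w \<in> ball c \<rho>'. f w = 0 \<or> w \<in> {}}"
      using \<rho> \<rho>' nz by auto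
    show "\<forall>z. z \<notin> ball c \<rho>' \<longrightarrow> winding_number (circlepath c \<rho>) z = 0"
      using \<rho> \<rho>' by (auto intro!: winding_number_zero_outside[of _ "cball c \<rho>"])
  qed (use finpz in \<open>auto simp: pz_def\<close>)
  also have "(\<Sum>p\<in>pz. winding_number (circlepath c \<rho>) p * g p * zorder f p) =
      (\<Sum>p\<in>{p\<in>ball c \<rho>. f p = 0}. g p * of_int (zorder f p))"
  proof (rule sum.mono_neutral_cong_right[OF finpz])
    show "\<forall>p\<in>pz - {p \<in> ball c \<rho>. f p = 0}. winding_number (circlepath c \<rho>) p * g p * zorder f p = 0"
    proof
      fix p assume p: "p \<in> pz - {p \<in> ball c \<rho>. f p = 0}"
      then have "p \<notin> cball c \<rho>" using nz by (auto simp: pz_def less_le)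
      then have "winding_number (circlepath c \<rho>) p = 0"
        using \<rho> by (auto intro!: winding_number_zero_outside[of _ "cball c \<rho>"])
      then show "winding_number (circlepath c \<rho>) p * g p * zorder f p = 0" by simp
    qed
    show "winding_number (circlepath c \<rho>) p * g p * zorder f p = g p * zorder f p"
      if "p \<in> {p \<in> ball c \<rho>. f p = 0}" for p
      using that winding_number_circlepath[of p c \<rho>] by (simp add: dist_norm norm_minus_commute)
  qed (use \<rho>' in \<open>auto simp: pz_def\<close>)
  finally show "contour_integral (circlepath c \<rho>) (\<lambda>w. deriv f w * g w / f w) =
      2 * pi * \<i> * (\<Sum>p\<in>{p\<in>ball c \<rho>. f p = 0}. g p * of_int (zorder f p))" .
qed

section \<open>Symmetric functions of the roots\<close>

inductive mpoly_fun :: "nat \<Rightarrow> ((nat \<Rightarrow> complex) \<Rightarrow> complex) \<Rightarrow> bool" for s where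
  monom: "mpoly_fun s (\<lambda>\<kappa>. c * (\<Prod>i<s. \<kappa> i ^ e i))"
| add: "mpoly_fun s f \<Longrightarrow> mpoly_fun s g \<Longrightarrow> mpoly_fun s (\<lambda>\<kappa>. f \<kappa> + g \<kappa>)"

lemma mpoly_fun_mult_monom:
  "mpoly_fun s g \<Longrightarrow> mpoly_fun s (\<lambda>\<kappa>. (c * (\<Prod>i<s. \<kappa> i ^ e i)) * g \<kappa>)"
proof (induction rule: mpoly_fun.induct)
  case (monom c' e')
  have "(\<lambda>\<kappa>. (c * (\<Prod>i<s. \<kappa> i ^ e i)) * (c' * (\<Prod>i<s. \<kappa> i ^ e' i))) =
      (\<lambda>\<kappa>. (c * c') * (\<Prod>i<s. \<kappa> i ^ (e i + e' i)))"
    by (simp add: power_add prod.distrib mult_ac)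
  then show ?case using mpoly_fun.monom by metis
next
  case (add f g)
  then show ?case by (simp add: distrib_left mpoly_fun.add)
qed

lemma mpoly_fun_mult:
  "mpoly_fun s f \<Longrightarrow> mpoly_fun s g \<Longrightarrow> mpoly_fun s (\<lambda>\<kappa>. f \<kappa> * g \<kappa>)"
  by (induction rule: mpoly_fun.induct)
    (simp_all add: mpoly_fun_mult_monom distrib_right mpoly_fun.add)

lemma mpoly_fun_const: "mpoly_fun s (\<lambda>\<kappa>. c)"
  using mpoly_fun.monom[of s c "\<lambda>_. 0"] by simp

lemma mpoly_fun_prod:
  "(\<And>i. i \<in> I \<Longrightarrow> mpoly_fun s (f i)) \<Longrightarrow> mpoly_fun s (\<lambda>\<kappa>. \<Prod>i\<in>I. f i \<kappa>)"
  by (induction I rule: infinite_finite_induct) (auto intro: mpoly_fun_const mpoly_fun_mult)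

lemma mpoly_fun_proj: "i < s \<Longrightarrow> mpoly_fun s (\<lambda>\<kappa>. c * \<kappa> i)"
  using mpoly_fun.monom[of s c "\<lambda>k. if k = i then 1 else 0"]
  by (simp add: if_distrib prod.delta cong: if_cong)

lemma mpoly_fun_diff: "i < s \<Longrightarrow> j < s \<Longrightarrow> mpoly_fun s (\<lambda>\<kappa>. \<kappa> i - \<kappa> j)"
  using mpoly_fun.add[OF mpoly_fun_proj[of i s 1] mpoly_fun_proj[of j s "-1"]] by simp

text \<open>Summed over all s-tuples of roots with the weights multiplied, a monomial factors into a
  product of weighted power sums, one for each variable. This is why \<open>mpoly_fun\<close> is
  generated by monomials and sums.\<close>

lemma holomorphic_on_sum_mpoly_fun:
  assumes \<Phi>: "mpoly_fun s \<Phi>" and fin: "\<And>x. x \<in> A \<Longrightarrow> finite (Z x)"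
    and P: "\<And>k. (\<lambda>x. \<Sum>p\<in>Z x. p ^ k * m x p) holomorphic_on A"
  shows "(\<lambda>x. \<Sum>\<kappa>\<in>PiE {..<s} (\<lambda>_. Z x). (\<Prod>i<s. m x (\<kappa> i)) * \<Phi> \<kappa>) holomorphic_on A"
  using \<Phi>
proof (induction rule: mpoly_fun.induct)
  case (monom c e)
  have "(\<lambda>x. c * (\<Prod>i<s. \<Sum>p\<in>Z x. p ^ e i * m x p)) holomorphic_on A"
    by (intro holomorphic_intros P)
  moreover have "(\<Sum>\<kappa>\<in>PiE {..<s} (\<lambda>_. Z x). (\<Prod>i<s. m x (\<kappa> i)) * (c * (\<Prod>i<s. \<kappa> i ^ e i))) =
      c * (\<Prod>i<s. \<Sum>p\<in>Z x. p ^ e i * m x p)" if "x \<in> A" for x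
    using fin[OF that] by (simp add: prod_sum_PiE sum_distrib_left prod.distrib mult_ac)
  ultimately show ?case by (simp cong: holomorphic_cong)
next
  case (add f g)
  then show ?case
    using holomorphic_on_add by (simp add: distrib_left sum.distrib)
qed

text \<open>By the argument principle the sum is 1 / (2 pi i) times the integral of
  \<open>w ^ k\<close> against the logarithmic derivative, a circle integral whose kernel is
  holomorphic in x. The weights \<open>zorder\<close> come with this formula and accompany all later
  sums over roots.\<close>

lemma holomorphic_on_power_sum:
  assumes A: "open A" and h: "hol2 A (ball 0 R) h" and c: "ball c r \<subseteq> ball 0 R" and \<rho>: "0 < \<rho>" "\<rho> < r"
    and nz: "\<And>x w. x \<in> A \<Longrightarrow> w \<in> sphere c \<rho> \<Longrightarrow> h x w \<noteq> 0"
  shows "(\<lambda>x. \<Sum>p\<in>{p\<in>ball c \<rho>. h x p = 0}. p ^ k * of_int (zorder (h x) p)) holomorphic_on A"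
proof -
  define K where "K = (\<lambda>x w. deriv (h x) w * w ^ k / h x w)"
  have sub: "A \<times> sphere c \<rho> \<subseteq> A \<times> ball 0 R" using c \<rho> by auto
  have d: "hol2 A (ball 0 R) (\<lambda>x. deriv (h x))" using hol2_higher_deriv[OF A h, of 1] by simp
  have "(\<lambda>x. contour_integral (circlepath c \<rho>) (K x)) holomorphic_on A"
  proof (rule holomorphic_on_contour_integral_circlepath)
    show "continuous_on (A \<times> sphere c \<rho>) (\<lambda>(x, w). K x w)"
      unfolding K_def case_prod_unfold using nz
      by (intro continuous_intros continuous_on_subset[OF hol2_continuous[OF h] sub, unfolded case_prod_unfold]
           continuous_on_subset[OF hol2_continuous[OF d] sub, unfolded case_prod_unfold]) auto
    fix w assume w: "w \<in> sphere c \<rho>"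
    then have "w \<in> ball 0 R" using sub c \<rho> by auto
    then show "(\<lambda>x. K x w) holomorphic_on A"
      unfolding K_def using nz w by (intro holomorphic_intros hol2_holomorphic1[OF h] hol2_holomorphic1[OF d]) auto
  qed (use A \<rho> in auto)
  then have "(\<lambda>x. 1 / (2 * pi * \<i>) * contour_integral (circlepath c \<rho>) (K x)) holomorphic_on A"
    by (intro holomorphic_intros)
  moreover have "1 / (2 * pi * \<i>) * contour_integral (circlepath c \<rho>) (K x) =
      (\<Sum>p\<in>{p\<in>ball c \<rho>. h x p = 0}. p ^ k * of_int (zorder (h x) p))" if "x \<in> A" for x
    unfolding K_def
    by (subst argument_principle_circle(1)[where r = r])
       (use holomorphic_on_subset[OF hol2_holomorphic2[OF h that] c] \<rho> nz that in \<open>auto intro!: holomorphic_intros\<close>)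
  ultimately show ?thesis by (simp cong: holomorphic_cong)
qed

text \<open>No root ever lies on the circle of radius \<epsilon>, so roots neither enter nor leave
  the disc as x moves, and integrals over one fixed circle account for all of them.\<close>

locale root_disc =
  fixes h :: "complex \<Rightarrow> complex \<Rightarrow> complex" and \<delta> R \<epsilon> :: real
  assumes hol: "hol2 (ball 0 \<delta>) (ball 0 R) h" and \<delta>: "0 < \<delta>" and \<epsilon>: "0 < \<epsilon>" "\<epsilon> < R"
    and nz: "\<And>x w. norm x < \<delta> \<Longrightarrow> norm w = \<epsilon> \<Longrightarrow> h x w \<noteq> 0"
begin

definition Z :: "complex \<Rightarrow> complex set" where "Z x = {p \<in> ball 0 \<epsilon>. h x p = 0}"

lemma finite_Z: "norm x < \<delta> \<Longrightarrow> finite (Z x)"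
  and zorder_Z: "norm x < \<delta> \<Longrightarrow> p \<in> Z x \<Longrightarrow> zorder (h x) p > 0"
  using argument_principle_circle(2,3)[where r = R and \<rho> = \<epsilon> and c = 0 and f = "h x", OF _ holomorphic_on_const]
    hol2_holomorphic2[OF hol] nz \<epsilon> by (auto simp: Z_def)

lemma power_sum_Z: "(\<lambda>x. \<Sum>p\<in>Z x. p ^ k * of_int (zorder (h x) p)) holomorphic_on ball 0 \<delta>"
  unfolding Z_def using \<epsilon> nz by (intro holomorphic_on_power_sum[OF _ hol, of _ R]) auto

text \<open>For \<open>s\<close> the maximal number of distinct roots, the weighted sum of
  \<open>\<Prod>\<^sub>i\<^sub>\<noteq>\<^sub>j (\<kappa>\<^sub>i - \<kappa>\<^sub>j)\<close> over all \<open>s\<close>-tuples \<open>\<kappa>\<close> of roots is a polynomial in the power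
  sums, and it vanishes exactly where there are fewer than \<open>s\<close> distinct roots.\<close>

lemma card_Z_constant:
  obtains s \<delta>' where "0 < \<delta>'" "\<delta>' \<le> \<delta>" "\<And>x. 0 < norm x \<Longrightarrow> norm x < \<delta>' \<Longrightarrow> card (Z x) = s"
proof -
  define P0 where "P0 = (\<lambda>x. \<Sum>p\<in>Z x. of_int (zorder (h x) p) :: complex)"
  have "continuous_on (cball 0 (\<delta>/2)) P0"
    using holomorphic_on_imp_continuous_on[OF power_sum_Z[of 0]] \<delta>
    by (auto simp: P0_def elim!: continuous_on_subset)
  then have "bounded (P0 ` cball 0 (\<delta>/2))" by (intro compact_imp_bounded compact_continuous_image) auto
  then obtain B where B: "\<And>x. norm x \<le> \<delta>/2 \<Longrightarrow> norm (P0 x) \<le> B" unfolding bounded_iff by fastforce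
  \<comment> \<open>There are at most as many distinct roots as roots counted with multiplicity, and
    the latter number is the 0-th power sum, which is bounded on the compact disc.\<close>
  have cardB: "card (Z x) \<le> nat \<lfloor>B\<rfloor>" if "norm x \<le> \<delta>/2" for x
  proof -
    have x: "norm x < \<delta>" using that \<delta> by auto
    have "of_nat (card (Z x)) = (\<Sum>p\<in>Z x. 1::int)" by simp
    also have "\<dots> \<le> (\<Sum>p\<in>Z x. zorder (h x) p)" using zorder_Z[OF x] by (intro sum_mono) force
    finally have "int (card (Z x)) \<le> (\<Sum>p\<in>Z x. zorder (h x) p)" .
    moreover have "P0 x = of_int (\<Sum>p\<in>Z x. zorder (h x) p)" by (simp add: P0_def)
    then have "norm (P0 x) = \<bar>real_of_int (\<Sum>p\<in>Z x. zorder (h x) p)\<bar>" by (simp only: norm_of_int)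
    ultimately have "real (card (Z x)) \<le> B" using B[OF that] by linarith
    then show ?thesis by (simp add: le_nat_floor)
  qed
  define s where "s = Max ((\<lambda>x. card (Z x)) ` cball 0 (\<delta>/2))"
  have finc: "finite ((\<lambda>x. card (Z x)) ` cball 0 (\<delta>/2))"
    by (rule finite_subset[of _ "{..nat \<lfloor>B\<rfloor>}"]) (use cardB in auto)
  have le_s: "card (Z x) \<le> s" if "norm x \<le> \<delta>/2" for x
    unfolding s_def using that finc by (intro Max_ge) auto
  have "s \<in> (\<lambda>x. card (Z x)) ` cball 0 (\<delta>/2)"
    unfolding s_def using finc \<delta> by (intro Max_in) auto
  then obtain x1 where x1: "norm x1 \<le> \<delta>/2" "card (Z x1) = s" by auto
  define m where "m = (\<lambda>x p. complex_of_int (zorder (h x) p))"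
  \<comment> \<open>Over ordered pairs the product is, up to sign, the square of the Vandermonde
    determinant; so it takes the same value on all orderings of the same roots.\<close>
  define V where "V = (\<lambda>\<kappa>::nat \<Rightarrow> complex. \<Prod>(i, j)\<in>{(i, j). i < s \<and> j < s \<and> i \<noteq> j}. \<kappa> i - \<kappa> j)"
  have finI: "finite {(i, j). i < s \<and> j < s \<and> i \<noteq> j}"
    by (rule finite_subset[of _ "{..<s} \<times> {..<s}"]) auto
  have V: "mpoly_fun s V" unfolding V_def case_prod_unfold by (rule mpoly_fun_prod) (auto intro: mpoly_fun_diff)
  define D where "D = (\<lambda>x. \<Sum>\<kappa>\<in>PiE {..<s} (\<lambda>_. Z x). (\<Prod>i<s. m x (\<kappa> i)) * V \<kappa>)"
  have holD: "D holomorphic_on ball 0 \<delta>"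
    unfolding D_def by (rule holomorphic_on_sum_mpoly_fun[OF V]) (use finite_Z power_sum_Z in \<open>auto simp: m_def\<close>)
  have V0: "inj_on \<kappa> {..<s}" if "V \<kappa> \<noteq> 0" for \<kappa>
  proof (rule inj_onI, rule ccontr)
    fix i j assume ij: "i \<in> {..<s}" "j \<in> {..<s}" "\<kappa> i = \<kappa> j" "i \<noteq> j"
    then have "\<exists>p\<in>{(i, j). i < s \<and> j < s \<and> i \<noteq> j}. (case p of (i, j) \<Rightarrow> \<kappa> i - \<kappa> j) = 0"
      by (intro bexI[of _ "(i, j)"]) auto
    then have "V \<kappa> = 0" unfolding V_def by (rule prod_zero[OF finI])
    with that show False by contradiction
  qed
  have ge_s: "s \<le> card (Z x)" if x: "D x \<noteq> 0" "norm x < \<delta>" for x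
  proof -
    obtain \<kappa> where \<kappa>: "\<kappa> \<in> PiE {..<s} (\<lambda>_. Z x)" "V \<kappa> \<noteq> 0"
      using x(1) unfolding D_def by (auto elim: sum.not_neutral_contains_not_neutral)
    have "card {..<s} \<le> card (Z x)"
      by (rule card_inj_on_le[OF V0[OF \<kappa>(2)]]) (use \<kappa> finite_Z[OF x(2)] in auto)
    then show ?thesis by simp
  qed
  have "D x1 \<noteq> 0"
  proof -
    have x1\<delta>: "norm x1 < \<delta>" using x1 \<delta> by auto
    note fin = finite_Z[OF x1\<delta>]
    \<comment> \<open>At \<open>x1\<close> an injective tuple enumerates all roots, so every nonzero
      summand of \<open>D x1\<close> has the value M: nothing can cancel.\<close>
    define M where "M = (\<Prod>p\<in>Z x1. m x1 p) * (\<Prod>(a, b)\<in>{(a, b). a \<in> Z x1 \<and> b \<in> Z x1 \<and> a \<noteq> b}. a - b)"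
    have "finite {(a, b). a \<in> Z x1 \<and> b \<in> Z x1 \<and> a \<noteq> b}"
      by (rule finite_subset[of _ "Z x1 \<times> Z x1"]) (use fin in auto)
    then have M: "M \<noteq> 0" using fin zorder_Z[OF x1\<delta>] by (fastforce simp: M_def m_def)
    define J where "J = {\<kappa> \<in> PiE {..<s} (\<lambda>_. Z x1). inj_on \<kappa> {..<s}}"
    have finP: "finite (PiE {..<s} (\<lambda>_. Z x1))" using fin by (intro finite_PiE) auto
    have "D x1 = (\<Sum>\<kappa>\<in>J. (\<Prod>i<s. m x1 (\<kappa> i)) * V \<kappa>)"
      unfolding D_def using finP V0 by (intro sum.mono_neutral_right) (auto simp: J_def)
    also have "\<dots> = (\<Sum>\<kappa>\<in>J. M)"
    proof (rule sum.cong[OF refl])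
      fix \<kappa> assume "\<kappa> \<in> J"
      then have inj: "inj_on \<kappa> {..<s}" and im: "\<kappa> ` {..<s} \<subseteq> Z x1" by (auto simp: J_def)
      have "\<kappa> ` {..<s} = Z x1"
        using card_image[OF inj] x1(2) fin im by (intro card_subset_eq) auto
      then have bij: "bij_betw \<kappa> {..<s} (Z x1)" using inj by (simp add: bij_betw_def)
      have "(\<Prod>i<s. m x1 (\<kappa> i)) = (\<Prod>p\<in>Z x1. m x1 p)"
        by (rule prod.reindex_bij_betw[OF bij])
      moreover have "bij_betw (\<lambda>(i, j). (\<kappa> i, \<kappa> j)) {(i, j). i < s \<and> j < s \<and> i \<noteq> j}
          {(a, b). a \<in> Z x1 \<and> b \<in> Z x1 \<and> a \<noteq> b}"
        using bij unfolding bij_betw_def inj_on_def by (auto simp: image_iff) (metis imageE lessThan_iff)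
      from prod.reindex_bij_betw[OF this, of "\<lambda>(a, b). a - b"]
      have "V \<kappa> = (\<Prod>(a, b)\<in>{(a, b). a \<in> Z x1 \<and> b \<in> Z x1 \<and> a \<noteq> b}. a - b)"
        by (simp add: V_def case_prod_unfold)
      ultimately show "(\<Prod>i<s. m x1 (\<kappa> i)) * V \<kappa> = M" by (simp add: M_def)
    qed
    also have "\<dots> = of_nat (card J) * M" by simp
    finally have "D x1 = of_nat (card J) * M" .
    moreover have "J \<noteq> {}"
    proof -
      obtain \<kappa> where "bij_betw \<kappa> {..<s} (Z x1)"
        using ex_bij_betw_nat_finite[OF fin] x1(2) by (auto simp: atLeast0LessThan)
      then have "restrict \<kappa> {..<s} \<in> J" by (auto simp: J_def bij_betw_def inj_on_def)
      then show ?thesis by blast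
    qed
    moreover have "finite J" using finP by (simp add: J_def)
    ultimately show ?thesis using M by simp
  qed
  \<comment> \<open>As D is not identically zero, 0 is at worst an isolated zero.\<close>
  have "\<exists>r>0. \<forall>z. z \<noteq> 0 \<longrightarrow> norm z < r \<longrightarrow> D z \<noteq> 0"
  proof (cases "D 0 = 0")
    case True
    obtain r where "0 < r" "\<And>z. z \<in> ball 0 r - {0} \<Longrightarrow> D z \<noteq> 0"
      by (rule isolated_zeros[OF holD open_ball connected_ball _ True _ \<open>D x1 \<noteq> 0\<close>])
         (use \<delta> x1(1) in auto)
    then show ?thesis by (intro exI[of _ r]) auto
  next
    case False
    have "isCont D 0" using holomorphic_on_imp_continuous_on[OF holD] \<delta> by (simp add: continuous_on_eq_continuous_at)
    from continuous_at_avoid[OF this False] show ?thesis by (auto simp: dist_norm)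
  qed
  then obtain r where r: "r > 0" "\<And>z. z \<noteq> 0 \<Longrightarrow> norm z < r \<Longrightarrow> D z \<noteq> 0" by blast
  show ?thesis
  proof
    show "0 < min r (\<delta>/2)" "min r (\<delta>/2) \<le> \<delta>" using r \<delta> by auto
    fix x :: complex assume x: "0 < norm x" "norm x < min r (\<delta>/2)"
    then have "card (Z x) \<le> s" "D x \<noteq> 0" "norm x < \<delta>" using le_s[of x] r(2)[of x] \<delta> by auto
    then show "card (Z x) = s" using ge_s[of x] by simp
  qed
qed

end

section \<open>Roots over the punctured disc\<close>

lemma tube_lemma_open:
  fixes W :: "(complex \<times> complex) set"
  assumes K: "compact K" and W: "open W" "{x0} \<times> K \<subseteq> W"
  obtains V where "open V" "x0 \<in> V" "V \<times> K \<subseteq> W"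
proof (cases "K = {}")
  case True
  then show ?thesis using that[of UNIV] by auto
next
  case False
  define U where "U = (K \<times> UNIV) \<inter> prod.swap -` W"
  have "openin (top_of_set (K \<times> UNIV)) U"
    unfolding U_def by (intro openin_open_Int open_vimage W continuous_on_swap)
  moreover have "(\<lambda>x. (x, x0)) ` K \<subseteq> U" using W(2) by (auto simp: U_def)
  ultimately obtain V where V: "openin (top_of_set UNIV) V" "x0 \<in> V" "K \<times> V \<subseteq> U"
    using tube_lemma[OF K False] by metis
  have "V \<times> K \<subseteq> W"
  proof
    fix p assume "p \<in> V \<times> K"
    then have "(snd p, fst p) \<in> U" using V(3) by auto
    then show "p \<in> W" by (simp add: U_def)
  qed
  then show ?thesis using that V by (simp add: subtopology_UNIV)
qed

text \<open>With a constant number of distinct roots, the roots over the punctured disc neither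
  merge nor split. The condition at x = 0 covers the closed disc of radius \<epsilon>, since a limit
  of roots is only known to lie there.\<close>

locale regular_roots = root_disc +
  fixes \<delta>' :: real and s :: nat
  assumes \<delta>': "0 < \<delta>'" "\<delta>' \<le> \<delta>" and card_Z: "\<And>x. 0 < norm x \<Longrightarrow> norm x < \<delta>' \<Longrightarrow> card (Z x) = s"
    and h0: "\<And>p. norm p \<le> \<epsilon> \<Longrightarrow> h 0 p = 0 \<longleftrightarrow> p = 0"
begin

definition B :: "complex set" where "B = ball 0 \<delta>' - {0}"

definition E :: "(complex \<times> complex) set" where "E = {(x, p). x \<in> B \<and> p \<in> Z x}"

lemma open_B: "open B" unfolding B_def by auto

lemma B_\<delta>: "x \<in> B \<Longrightarrow> norm x < \<delta>" using \<delta>' by (auto simp: B_def)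

text \<open>The number of roots with multiplicity is continuous in x and positive at x = 0, where
  the origin is a root; so nearby fibres are nonempty.\<close>

lemma s_pos: "s > 0"
proof -
  define P0 where "P0 = (\<lambda>x. \<Sum>p\<in>Z x. of_int (zorder (h x) p) :: complex)"
  have "continuous_on (ball 0 \<delta>) P0"
    using holomorphic_on_imp_continuous_on[OF power_sum_Z[of 0]] by (simp add: P0_def)
  then have "isCont P0 0" using \<delta> by (simp add: continuous_on_eq_continuous_at)
  moreover have "P0 0 \<noteq> 0"
  proof -
    have "0 \<in> Z 0" using h0[of 0] \<epsilon> by (simp add: Z_def)
    then have "0 < (\<Sum>p\<in>Z 0. zorder (h 0) p)"
      using zorder_Z[of 0] finite_Z[of 0] \<delta> by (intro sum_pos) auto
    moreover have "P0 0 = of_int (\<Sum>p\<in>Z 0. zorder (h 0) p)" by (simp add: P0_def)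
    ultimately show ?thesis by (metis of_int_eq_0_iff less_irrefl)
  qed
  ultimately obtain e where e: "e > 0" "\<And>x. norm x < e \<Longrightarrow> P0 x \<noteq> 0"
    using continuous_at_avoid[of 0 P0 0] by (auto simp: dist_norm)
  define x where "x = complex_of_real (min e \<delta>' / 2)"
  have x: "0 < norm x" "norm x < e" "norm x < \<delta>'" using e(1) \<delta>' by (auto simp: x_def)
  then have "Z x \<noteq> {}" using e(2)[of x] by (auto simp: P0_def)
  moreover have "finite (Z x)" using x \<delta>' by (intro finite_Z) auto
  ultimately have "card (Z x) > 0" by (simp add: card_gt_0_iff)
  then show ?thesis using card_Z[OF x(1,3)] by simp
qed

text \<open>Put disjoint small discs around the s roots over x0. For x near x0 the number of roots
  with multiplicity in each disc stays nonzero by continuity; s discs then share exactly s distinct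
  roots, one each. That root, alone in its disc, is the first power sum divided by the zeroth, hence
  holomorphic in x.\<close>

lemma local_sections:
  assumes x0: "x0 \<in> B"
  obtains \<rho> \<eta> r where "\<rho> > 0" "ball x0 \<rho> \<subseteq> B"
    "\<And>y y'. y \<in> Z x0 \<Longrightarrow> y' \<in> Z x0 \<Longrightarrow> y \<noteq> y' \<Longrightarrow> ball y \<eta> \<inter> ball y' \<eta> = {}"
    "\<And>y. y \<in> Z x0 \<Longrightarrow> r y holomorphic_on ball x0 \<rho>"
    "\<And>x y. x \<in> ball x0 \<rho> \<Longrightarrow> y \<in> Z x0 \<Longrightarrow> Z x \<inter> ball y \<eta> = {r y x}"
    "\<And>x. x \<in> ball x0 \<rho> \<Longrightarrow> Z x \<subseteq> (\<Union>y\<in>Z x0. ball y \<eta>)"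
proof -
  have x0\<delta>: "norm x0 < \<delta>" using B_\<delta>[OF x0] .
  note fin = finite_Z[OF x0\<delta>]
  have "\<exists>\<eta>>0. \<forall>y\<in>Z x0. \<forall>y'\<in>Z x0. y \<noteq> y' \<longrightarrow> 2 * \<eta> < dist y y'"
  proof -
    define D where "D = insert 1 ((\<lambda>(y, y'). dist y y') ` {(y, y'). y \<in> Z x0 \<and> y' \<in> Z x0 \<and> y \<noteq> y'})"
    have "finite {(y, y'). y \<in> Z x0 \<and> y' \<in> Z x0 \<and> y \<noteq> y'}"
      by (rule finite_subset[of _ "Z x0 \<times> Z x0"]) (use fin in auto)
    then have finD: "finite D" by (simp add: D_def)
    then have "Min D > 0" by (subst Min_gr_iff) (auto simp: D_def)
    moreover have "Min D \<le> dist y y'" if "y \<in> Z x0" "y' \<in> Z x0" "y \<noteq> y'" for y y'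
      using that finD by (intro Min_le) (auto simp: D_def)
    ultimately show ?thesis by (intro exI[of _ "Min D / 3"]) fastforce
  qed
  then obtain \<eta>1 where \<eta>1: "\<eta>1 > 0" "\<And>y y'. y \<in> Z x0 \<Longrightarrow> y' \<in> Z x0 \<Longrightarrow> y \<noteq> y' \<Longrightarrow> 2 * \<eta>1 < dist y y'"
    by blast
  have "\<exists>\<eta>>0. \<forall>y\<in>Z x0. norm y + 2 * \<eta> < \<epsilon>"
  proof -
    define D where "D = insert \<epsilon> ((\<lambda>y. \<epsilon> - norm y) ` Z x0)"
    have finD: "finite D" using fin by (simp add: D_def)
    then have "Min D > 0" by (subst Min_gr_iff) (auto simp: D_def Z_def \<epsilon>)
    moreover have "Min D \<le> \<epsilon> - norm y" if "y \<in> Z x0" for y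
      using that finD by (intro Min_le) (auto simp: D_def)
    ultimately show ?thesis by (intro exI[of _ "Min D / 3"]) fastforce
  qed
  then obtain \<eta>2 where \<eta>2: "\<eta>2 > 0" "\<And>y. y \<in> Z x0 \<Longrightarrow> norm y + 2 * \<eta>2 < \<epsilon>" by blast
  \<comment> \<open>Less than half the distance of any two roots, and so small that the doubled
    discs stay inside the disc of radius \<epsilon>; the argument principle needs this room around
    the circles.\<close>
  define \<eta> where "\<eta> = min \<eta>1 \<eta>2"
  have \<eta>: "\<eta> > 0" "\<eta> \<le> \<eta>1" "\<eta> \<le> \<eta>2" using \<eta>1 \<eta>2 by (auto simp: \<eta>_def)
  have disj: "ball y \<eta> \<inter> ball y' \<eta> = {}" if "y \<in> Z x0" "y' \<in> Z x0" "y \<noteq> y'" for y y'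
  proof -
    have "dist y y' \<ge> \<eta> + \<eta>" using \<eta>1(2)[OF that] \<eta> by linarith
    then show ?thesis by (intro disjoint_ballI) auto
  qed
  have sub: "ball y (2 * \<eta>) \<subseteq> ball 0 \<epsilon>" if "y \<in> Z x0" for y
    using \<eta>2(2)[OF that] \<eta> by (auto simp: dist_norm) (smt (verit) norm_minus_commute norm_triangle_sub)
  define K where "K = (\<Union>y\<in>Z x0. sphere y \<eta>)"
  have K: "compact K" unfolding K_def using fin by (intro compact_UN) auto
  have KR: "K \<subseteq> ball 0 \<epsilon>" using sub \<eta> unfolding K_def by fastforce
  have hK: "h x0 w \<noteq> 0" if wK: "w \<in> K" for w
  proof
    assume "h x0 w = 0"
    then have w: "w \<in> Z x0" using that KR by (auto simp: Z_def)
    obtain y where y: "y \<in> Z x0" "dist y w = \<eta>" using wK by (auto simp: K_def)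
    then show False using \<eta>1(2)[OF y(1) w] \<eta> by (cases "y = w") auto
  qed
  define W where "W = {q \<in> ball 0 \<delta> \<times> ball 0 R. (\<lambda>(x, y). h x y) q \<noteq> 0}"
  have "open W"
  proof -
    have "W = (ball 0 \<delta> \<times> ball 0 R) \<inter> (\<lambda>(x, y). h x y) -` (- {0})" by (auto simp: W_def)
    then show ?thesis
      using hol2_continuous[OF hol] by (auto intro!: continuous_open_preimage open_Times)
  qed
  moreover have "{x0} \<times> K \<subseteq> W" using x0\<delta> KR \<epsilon> hK by (auto simp: W_def)
  ultimately obtain X0 where X0: "open X0" "x0 \<in> X0" "X0 \<times> K \<subseteq> W" by (rule tube_lemma_open[OF K])
  then have "open (X0 \<inter> B)" "x0 \<in> X0 \<inter> B" using open_B x0 by auto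
  then obtain \<rho>1 where \<rho>1: "\<rho>1 > 0" "ball x0 \<rho>1 \<subseteq> X0 \<inter> B" by (meson open_contains_ball_eq)
  have nzK: "h x w \<noteq> 0" if "x \<in> ball x0 \<rho>1" "w \<in> K" for x w
  proof -
    have "(x, w) \<in> W" using that \<rho>1 X0(3) by blast
    then show ?thesis by (auto simp: W_def)
  qed
  define M where "M = (\<lambda>k y x. \<Sum>p\<in>{p\<in>ball y \<eta>. h x p = 0}. p ^ k * complex_of_int (zorder (h x) p))"
  have h1: "hol2 (ball x0 \<rho>1) (ball 0 R) h"
    by (rule hol2_subset[OF hol]) (use \<rho>1 B_\<delta> in auto)
  have holM: "M k y holomorphic_on ball x0 \<rho>1" if y: "y \<in> Z x0" for k y
    unfolding M_def
    by (rule holomorphic_on_power_sum[OF _ h1, of _ "2 * \<eta>"]) (use sub[OF y] \<epsilon> \<eta> nzK y in \<open>auto simp: K_def\<close>)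
  have Mzeros: "finite {p\<in>ball y \<eta>. h x p = 0}" "p \<in> ball y \<eta> \<Longrightarrow> h x p = 0 \<Longrightarrow> zorder (h x) p > 0"
    if y: "y \<in> Z x0" and x: "x \<in> ball x0 \<rho>1" for x y p
  proof -
    have "ball y (2 * \<eta>) \<subseteq> ball 0 R" using sub[OF y] \<epsilon> by (meson less_imp_le order_trans subset_ball)
    then have hy: "h x holomorphic_on ball y (2 * \<eta>)"
      by (rule holomorphic_on_subset[OF hol2_holomorphic2[OF h1 x]])
    have "h x w \<noteq> 0" if "w \<in> sphere y \<eta>" for w using nzK[OF x, of w] that y by (auto simp: K_def)
    note * = argument_principle_circle(2,3)[OF hy holomorphic_on_const _ _ this]
    show "finite {p\<in>ball y \<eta>. h x p = 0}" by (rule *(1)) (use \<eta> in auto)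
    show "zorder (h x) p > 0" if "p \<in> ball y \<eta>" "h x p = 0" by (rule *(2)) (use \<eta> that in auto)
  qed
  have M0: "M 0 y x0 \<noteq> 0" if y: "y \<in> Z x0" for y
  proof -
    have "x0 \<in> ball x0 \<rho>1" using \<rho>1 by simp
    note zs = Mzeros[OF y this]
    have ne: "{p\<in>ball y \<eta>. h x0 p = 0} \<noteq> {}" using y \<eta>(1) centre_in_ball[of y \<eta>] unfolding Z_def by blast
    have "0 < (\<Sum>p\<in>{p\<in>ball y \<eta>. h x0 p = 0}. zorder (h x0) p)"
      by (rule sum_pos[OF zs(1) ne]) (use zs(2) in auto)
    moreover have "M 0 y x0 = of_int (\<Sum>p\<in>{p\<in>ball y \<eta>. h x0 p = 0}. zorder (h x0) p)" by (simp add: M_def)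
    ultimately show ?thesis by (metis of_int_eq_0_iff less_irrefl)
  qed
  have "eventually (\<lambda>x. \<forall>y\<in>Z x0. M 0 y x \<noteq> 0) (nhds x0)"
    unfolding eventually_ball_finite_distrib[OF fin]
  proof
    fix y assume y: "y \<in> Z x0"
    have "isCont (M 0 y) x0"
      using holomorphic_on_imp_continuous_on[OF holM[OF y, of 0]] \<rho>1 by (simp add: continuous_on_eq_continuous_at)
    from continuous_at_avoid[OF this M0[OF y]] show "eventually (\<lambda>x. M 0 y x \<noteq> 0) (nhds x0)"
      by (auto simp: eventually_nhds_metric dist_commute)
  qed
  then obtain \<rho>2 where \<rho>2: "\<rho>2 > 0" "\<And>x y. dist x x0 < \<rho>2 \<Longrightarrow> y \<in> Z x0 \<Longrightarrow> M 0 y x \<noteq> 0"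
    by (auto simp: eventually_nhds_metric)
  define \<rho> where "\<rho> = min \<rho>1 \<rho>2"
  have \<rho>: "\<rho> > 0" "\<rho> \<le> \<rho>1" "\<rho> \<le> \<rho>2" using \<rho>1 \<rho>2 by (auto simp: \<rho>_def)
  define r where "r = (\<lambda>y x. M 1 y x / M 0 y x)"
  have key: "Z x \<inter> ball y \<eta> = {r y x} \<and> Z x \<subseteq> (\<Union>y\<in>Z x0. ball y \<eta>)" if x: "x \<in> ball x0 \<rho>" and y: "y \<in> Z x0" for x y
  proof -
    have x1: "x \<in> ball x0 \<rho>1" and x2: "dist x x0 < \<rho>2" using x \<rho> by (auto simp: dist_commute)
    have xB: "x \<in> B" using x1 \<rho>1 by auto
    have Zeq: "{p\<in>ball y \<eta>. h x p = 0} = Z x \<inter> ball y \<eta>" if "y \<in> Z x0" for y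
    proof -
      have "ball y \<eta> \<subseteq> ball y (2 * \<eta>)" using \<eta> by (intro subset_ball) auto
      then have "ball y \<eta> \<subseteq> ball 0 \<epsilon>" using sub[OF that] by (rule order_trans)
      then show ?thesis unfolding Z_def by blast
    qed
    have "\<exists>p. p \<in> Z x \<inter> ball y \<eta>" if y: "y \<in> Z x0" for y
    proof (rule ccontr)
      assume "\<nexists>p. p \<in> Z x \<inter> ball y \<eta>"
      then have "{p\<in>ball y \<eta>. h x p = 0} = {}" using Zeq[OF y] by auto
      then have "M 0 y x = 0" unfolding M_def by (simp only: sum.empty)
      with \<rho>2(2)[OF x2 y] show False by simp
    qed
    then obtain g where g: "\<And>y. y \<in> Z x0 \<Longrightarrow> g y \<in> Z x \<inter> ball y \<eta>" by metis
    have inj: "inj_on g (Z x0)"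
    proof (rule inj_onI, rule ccontr)
      fix a b assume ab: "a \<in> Z x0" "b \<in> Z x0" "g a = g b" "a \<noteq> b"
      then show False using disj[OF ab(1,2,4)] g[OF ab(1)] g[OF ab(2)] by auto
    qed
    have "card (g ` Z x0) = card (Z x)"
      using card_image[OF inj] card_Z[of x0] card_Z[of x] x0 xB by (auto simp: B_def)
    then have surj: "g ` Z x0 = Z x"
      using g finite_Z[OF B_\<delta>[OF xB]] by (intro card_subset_eq) auto
    have sing: "Z x \<inter> ball y \<eta> = {g y}"
    proof (intro equalityI subsetI)
      fix p assume p: "p \<in> Z x \<inter> ball y \<eta>"
      then obtain y' where y': "y' \<in> Z x0" "p = g y'" using surj by auto
      then have "p \<in> ball y' \<eta>" using g by blast
      have "y = y'"
      proof (rule ccontr)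
        assume "y \<noteq> y'"
        then show False using disj[OF y y'(1)] p \<open>p \<in> ball y' \<eta>\<close> by blast
      qed
      then show "p \<in> {g y}" using y' by simp
    qed (use g[OF y] in auto)
    have "r y x = g y"
    proof -
      have Mk: "M k y x = g y ^ k * of_int (zorder (h x) (g y))" for k
        unfolding M_def Zeq[OF y] sing by simp
      have "M 0 y x \<noteq> 0" using \<rho>2(2)[OF x2 y] .
      then show ?thesis unfolding r_def Mk by simp
    qed
    moreover have "Z x \<subseteq> (\<Union>y\<in>Z x0. ball y \<eta>)"
    proof
      fix p assume "p \<in> Z x"
      then obtain y' where "y' \<in> Z x0" "p = g y'" using surj by blast
      then show "p \<in> (\<Union>y\<in>Z x0. ball y \<eta>)" using g by blast
    qed
    ultimately show ?thesis using sing by metis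
  qed
  show ?thesis
  proof
    show "\<rho> > 0" by fact
    have \<rho>\<rho>1: "ball x0 \<rho> \<subseteq> ball x0 \<rho>1" using \<rho> by (intro subset_ball)
    then show "ball x0 \<rho> \<subseteq> B" using \<rho>1 by blast
    show "r y holomorphic_on ball x0 \<rho>" if y: "y \<in> Z x0" for y
      unfolding r_def
    proof (intro holomorphic_intros holomorphic_on_subset[OF holM[OF y] \<rho>\<rho>1])
      fix x assume "x \<in> ball x0 \<rho>"
      then show "M 0 y x \<noteq> 0" using \<rho> by (intro \<rho>2(2)[OF _ y]) (simp add: dist_commute)
    qed
    show "Z x \<inter> ball y \<eta> = {r y x}" if "x \<in> ball x0 \<rho>" "y \<in> Z x0" for x y
      using key[OF that] by blast
    have "Z x0 \<noteq> {}" using card_Z[of x0] x0 s_pos by (auto simp: B_def)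
    then show "Z x \<subseteq> (\<Union>y\<in>Z x0. ball y \<eta>)" if "x \<in> ball x0 \<rho>" for x
      using key[OF that] by blast
  qed (use disj in auto)
qed

text \<open>The sheets over a small disc are the graphs of the local sections.\<close>

lemma covering_space_E: "covering_space E fst B"
  unfolding covering_space_def
proof (intro conjI ballI)
  show "continuous_on E fst" by (intro continuous_intros)
  have "Z x \<noteq> {}" if "x \<in> B" for x using card_Z[of x] that s_pos by (auto simp: B_def)
  then show "fst ` E = B" by (force simp: E_def)
  fix x0 assume x0: "x0 \<in> B"
  obtain \<rho> \<eta> r where \<rho>: "\<rho> > 0" "ball x0 \<rho> \<subseteq> B"
    and disj: "\<And>y y'. y \<in> Z x0 \<Longrightarrow> y' \<in> Z x0 \<Longrightarrow> y \<noteq> y' \<Longrightarrow> ball y \<eta> \<inter> ball y' \<eta> = {}"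
    and r: "\<And>y. y \<in> Z x0 \<Longrightarrow> r y holomorphic_on ball x0 \<rho>"
      "\<And>x y. x \<in> ball x0 \<rho> \<Longrightarrow> y \<in> Z x0 \<Longrightarrow> Z x \<inter> ball y \<eta> = {r y x}"
      "\<And>x. x \<in> ball x0 \<rho> \<Longrightarrow> Z x \<subseteq> (\<Union>y\<in>Z x0. ball y \<eta>)"
    using local_sections[OF x0] by blast
  define u where "u = (\<lambda>y. E \<inter> (ball x0 \<rho> \<times> ball y \<eta>))"
  show "\<exists>T. x0 \<in> T \<and> openin (top_of_set B) T \<and>
      (\<exists>v. \<Union>v = E \<inter> fst -` T \<and> (\<forall>u\<in>v. openin (top_of_set E) u) \<and> disjoint v \<and>
        (\<forall>u\<in>v. \<exists>q. homeomorphism u T fst q))"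
  proof (intro exI[of _ "ball x0 \<rho>"] exI[of _ "u ` Z x0"] conjI ballI)
    show "openin (top_of_set B) (ball x0 \<rho>)" using \<rho> by (simp add: open_subset)
    show "\<Union> (u ` Z x0) = E \<inter> fst -` ball x0 \<rho>"
      using r(3) by (fastforce simp: u_def E_def)
    show "openin (top_of_set E) w" if "w \<in> u ` Z x0" for w
      using that unfolding u_def by (auto intro!: openin_open_Int open_Times)
    show "disjoint (u ` Z x0)"
      using disj unfolding disjoint_def u_def by fast
    fix w assume "w \<in> u ` Z x0"
    then obtain y where y: "y \<in> Z x0" "w = u y" by blast
    have ry: "r y x \<in> Z x" "r y x \<in> ball y \<eta>" if "x \<in> ball x0 \<rho>" for x
      using r(2)[OF that y(1)] by auto
    show "\<exists>q. homeomorphism w (ball x0 \<rho>) fst q"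
    proof (intro exI[of _ "\<lambda>x. (x, r y x)"] homeomorphismI)
      show "continuous_on (ball x0 \<rho>) (\<lambda>x. (x, r y x))"
        by (intro continuous_intros holomorphic_on_imp_continuous_on r(1) y(1))
      show "(\<lambda>x. (x, r y x)) ` ball x0 \<rho> \<subseteq> w"
        using ry \<rho> by (auto simp: y u_def E_def)
      show "(fst z, r y (fst z)) = z" if "z \<in> w" for z
      proof -
        have "fst z \<in> ball x0 \<rho>" "snd z \<in> Z (fst z) \<inter> ball y \<eta>"
          using that by (auto simp: y u_def E_def)
        then show ?thesis using r(2)[OF _ y(1)] by (cases z) auto
      qed
    qed (auto simp: y u_def intro!: continuous_intros)
  qed (use \<rho> in auto)
qed

end

section \<open>Puiseux parametrization\<close>

context regular_roots
begin

definition H :: "complex set" where "H = {w. Re w < ln \<delta>'}"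

lemma H: "open H" "convex H" "connected H" "simply_connected H" "locally path_connected H"
proof -
  show "open H" unfolding H_def by (rule open_halfspace_Re_lt)
  show H: "convex H" unfolding H_def by (rule convex_halfspace_Re_lt)
  show "connected H" by (rule convex_connected[OF H])
  show "simply_connected H" by (rule convex_imp_simply_connected[OF H])
  show "locally path_connected H" by (rule convex_imp_locally_path_connected[OF H])
qed

lemma exp_H: "w \<in> H \<Longrightarrow> exp w \<in> B"
proof -
  assume "w \<in> H"
  then have "exp (Re w) < exp (ln \<delta>')" by (simp add: H_def)
  then show "exp w \<in> B" using \<delta>' by (simp add: B_def norm_exp_eq_Re)
qed

lemma shift_H: "w \<in> H \<Longrightarrow> w + 2 * pi * \<i> * of_int n \<in> H"
  by (simp add: H_def)

text \<open>\<open>S\<close> is the second component of a lift of \<open>exp\<close> on H through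
  the covering \<open>fst\<close> of B by E.\<close>

definition lift :: "(complex \<Rightarrow> complex) \<Rightarrow> bool" where
  "lift S \<longleftrightarrow> continuous_on H S \<and> (\<forall>w\<in>H. S w \<in> Z (exp w))"

lemma lift_unique:
  assumes "lift S1" "lift S2" "a \<in> H" "S1 a = S2 a" "w \<in> H"
  shows "S1 w = S2 w"
proof -
  have c: "continuous_on H (\<lambda>w. (exp w, S w))" "(\<lambda>w. (exp w, S w)) \<in> H \<rightarrow> E" if "lift S" for S
  proof -
    show "continuous_on H (\<lambda>w. (exp w, S w))"
      using that unfolding lift_def by (intro continuous_on_Pair continuous_on_exp continuous_on_id) simp
    show "(\<lambda>w. (exp w, S w)) \<in> H \<rightarrow> E"
      using that exp_H unfolding lift_def E_def by simp
  qed
  have ex: "continuous_on H exp" "exp \<in> H \<rightarrow> B"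
    using exp_H by (auto intro: continuous_on_exp continuous_on_id)
  have "(\<lambda>w. (exp w, S1 w)) w = (\<lambda>w. (exp w, S2 w)) w"
    by (rule covering_space_lift_unique[OF covering_space_E _ ex c[OF assms(1)] _ c[OF assms(2)] _ H(3) assms(3,5)])
       (simp_all add: assms(4))
  then show ?thesis by simp
qed

lemma lift_exists: obtains S where "lift S"
proof -
  define w0 where "w0 = complex_of_real (ln \<delta>' - 1)"
  have w0: "w0 \<in> H" by (simp add: H_def w0_def)
  then have "exp w0 \<in> B" by (rule exp_H)
  then have "Z (exp w0) \<noteq> {}" using card_Z[of "exp w0"] s_pos by (auto simp: B_def)
  then obtain y0 where "y0 \<in> Z (exp w0)" by blast
  then have E: "(exp w0, y0) \<in> E" using \<open>exp w0 \<in> B\<close> by (simp add: E_def)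
  obtain g where g: "continuous_on H g" "g \<in> H \<rightarrow> E" "\<And>w. w \<in> H \<Longrightarrow> fst (g w) = exp w"
    by (rule covering_space_lift_strong[OF covering_space_E E w0 H(4,5) continuous_on_exp[OF continuous_on_id]])
       (simp_all add: exp_H)
  have "lift (\<lambda>w. snd (g w))"
    unfolding lift_def
  proof (intro conjI ballI)
    show "continuous_on H (\<lambda>w. snd (g w))" using g(1) by (intro continuous_intros)
    fix w assume w: "w \<in> H"
    then have "g w \<in> E" using g(2) by auto
    then show "snd (g w) \<in> Z (exp w)" using g(3)[OF w] by (auto simp: E_def)
  qed
  then show ?thesis using that by blast
qed

lemma lift_shift:
  assumes S: "lift S"
  shows "lift (\<lambda>w. S (w + 2 * pi * \<i> * of_int n))"
proof -
  have c: "continuous_on H S" and z: "\<And>w. w \<in> H \<Longrightarrow> S w \<in> Z (exp w)" using S by (auto simp: lift_def)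
  have "continuous_on H (\<lambda>w. S (w + 2 * pi * \<i> * of_int n))"
    by (rule continuous_on_compose2[OF c]) (use shift_H[of _ n] in \<open>auto intro!: continuous_intros\<close>)
  moreover have "S (w + 2 * pi * \<i> * of_int n) \<in> Z (exp w)" if w: "w \<in> H" for w
  proof -
    have "exp (2 * pi * \<i> * of_int n) = 1" by (subst exp_eq_1) auto
    then have "exp (w + 2 * pi * \<i> * of_int n) = exp w" by (simp only: exp_add mult_1_right)
    then show ?thesis using z[OF shift_H[OF w, of n]] by simp
  qed
  ultimately show ?thesis by (simp add: lift_def)
qed

text \<open>Near a point the continuous lift stays in the disc around one root, so there it is
  \<open>exp\<close> followed by the holomorphic section through that root.\<close>

lemma lift_holomorphic:
  assumes S: "lift S" shows "S holomorphic_on H"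
  unfolding holomorphic_on_def
proof
  fix w0 assume w0: "w0 \<in> H"
  define x0 where "x0 = exp w0"
  have x0: "x0 \<in> B" using exp_H[OF w0] by (simp add: x0_def)
  obtain \<rho> \<eta> r where \<rho>: "\<rho> > 0" "ball x0 \<rho> \<subseteq> B"
    and "\<And>y y'. y \<in> Z x0 \<Longrightarrow> y' \<in> Z x0 \<Longrightarrow> y \<noteq> y' \<Longrightarrow> ball y \<eta> \<inter> ball y' \<eta> = {}"
    and r: "\<And>y. y \<in> Z x0 \<Longrightarrow> r y holomorphic_on ball x0 \<rho>"
      "\<And>x y. x \<in> ball x0 \<rho> \<Longrightarrow> y \<in> Z x0 \<Longrightarrow> Z x \<inter> ball y \<eta> = {r y x}"
    and "\<And>x. x \<in> ball x0 \<rho> \<Longrightarrow> Z x \<subseteq> (\<Union>y\<in>Z x0. ball y \<eta>)"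
    using local_sections[OF x0] by blast
  have y: "S w0 \<in> Z x0" using S w0 by (simp add: lift_def x0_def)
  have "Z x0 \<inter> ball (S w0) \<eta> = {r (S w0) x0}" using \<rho>(1) by (intro r(2) y) simp
  then have "ball (S w0) \<eta> \<noteq> {}" by blast
  then have \<eta>: "\<eta> > 0" by (simp only: ball_eq_empty not_le)
  define V where "V = H \<inter> S -` ball (S w0) \<eta> \<inter> exp -` ball x0 \<rho>"
  have "open (H \<inter> S -` ball (S w0) \<eta>)"
    using S H(1) by (intro continuous_open_preimage) (auto simp: lift_def)
  moreover have "open (exp -` ball x0 \<rho>)" by (intro open_vimage continuous_intros) auto
  ultimately have V: "open V" unfolding V_def by (rule open_Int)
  have "w0 \<in> V" using w0 \<eta> \<rho> by (simp add: V_def x0_def)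
  have "S w = r (S w0) (exp w)" if w: "w \<in> V" for w
  proof -
    have S': "S w \<in> Z (exp w) \<inter> ball (S w0) \<eta>" using w S unfolding V_def lift_def by blast
    have "exp w \<in> ball x0 \<rho>" using w unfolding V_def by blast
    from S'[unfolded r(2)[OF this y]] show ?thesis by simp
  qed
  moreover have "(\<lambda>w. r (S w0) (exp w)) holomorphic_on V"
  proof (rule holomorphic_on_compose_gen[of exp V _ "ball x0 \<rho>", unfolded comp_def])
    show "exp ` V \<subseteq> ball x0 \<rho>" unfolding V_def by blast
  qed (auto intro: r(1)[OF y] holomorphic_on_exp)
  ultimately have "S holomorphic_on V" by (simp cong: holomorphic_cong)
  then have "S field_differentiable (at w0)"
    using V \<open>w0 \<in> V\<close> holomorphic_on_imp_differentiable_at by blast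
  then show "S field_differentiable (at w0 within H)" by (rule field_differentiable_at_within)
qed

text \<open>Two shifts that agree at one point agree everywhere by uniqueness of lifts, and the
  fibres are finite, so some shift is a period. For the least period, shifts by less than a period
  differ at every point.\<close>

lemma lift_period:
  assumes S: "lift S"
  obtains p :: nat where "p > 0" "\<And>w. w \<in> H \<Longrightarrow> S (w + 2 * pi * \<i> * p) = S w"
    "\<And>w k l. w \<in> H \<Longrightarrow> k < l \<Longrightarrow> l < p \<Longrightarrow> S (w + 2 * pi * \<i> * of_nat k) \<noteq> S (w + 2 * pi * \<i> * of_nat l)"
proof -
  define per where "per = (\<lambda>p::nat. p > 0 \<and> (\<forall>w\<in>H. S (w + 2 * pi * \<i> * p) = S w))"
  have per: "per (l - k)" if w: "w \<in> H" and "k < l" and eq: "S (w + 2 * pi * \<i> * of_nat k) = S (w + 2 * pi * \<i> * of_nat l)" for w and k l :: nat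
    unfolding per_def
  proof (intro conjI ballI)
    fix v assume v: "v \<in> H"
    have "S ((v - 2 * pi * \<i> * of_nat k) + 2 * pi * \<i> * of_int (int k)) = S ((v - 2 * pi * \<i> * of_nat k) + 2 * pi * \<i> * of_int (int l))"
      by (rule lift_unique[OF lift_shift[OF S] lift_shift[OF S] w]) (use eq v in \<open>auto simp: H_def\<close>)
    then show "S (v + 2 * pi * \<i> * of_nat (l - k)) = S v"
      using \<open>k < l\<close> by (simp add: of_nat_diff algebra_simps)
  qed (use \<open>k < l\<close> in auto)
  obtain w0 where w0: "w0 \<in> H" unfolding H_def by (metis Re_complex_of_real lt_ex mem_Collect_eq)
  have "finite (Z (exp w0))" using exp_H[OF w0] finite_Z B_\<delta> by auto
  moreover have "range (\<lambda>k::nat. S (w0 + 2 * pi * \<i> * of_nat k)) \<subseteq> Z (exp w0)"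
  proof safe
    fix k :: nat
    show "S (w0 + 2 * pi * \<i> * of_nat k) \<in> Z (exp w0)"
      using lift_shift[OF S, of "int k"] w0 by (simp add: lift_def)
  qed
  ultimately have "\<not> inj (\<lambda>k::nat. S (w0 + 2 * pi * \<i> * of_nat k))"
    by (meson finite_subset infinite_UNIV_nat range_inj_infinite)
  then obtain k l :: nat where "k \<noteq> l" "S (w0 + 2 * pi * \<i> * of_nat k) = S (w0 + 2 * pi * \<i> * of_nat l)"
    by (auto simp: inj_on_def)
  then have "\<exists>p. per p" using per[OF w0, of k l] per[OF w0, of l k] by (metis linorder_neqE_nat)
  then have p: "per (LEAST p. per p)" by (rule LeastI_ex)
  show ?thesis
  proof
    show "(LEAST p. per p) > 0" "\<And>w. w \<in> H \<Longrightarrow> S (w + 2 * pi * \<i> * (LEAST p. per p)) = S w"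
      using p by (auto simp: per_def)
    fix w :: complex and k l :: nat assume *: "w \<in> H" "k < l" "l < (LEAST p. per p)"
    show "S (w + 2 * pi * \<i> * of_nat k) \<noteq> S (w + 2 * pi * \<i> * of_nat l)"
    proof
      assume "S (w + 2 * pi * \<i> * of_nat k) = S (w + 2 * pi * \<i> * of_nat l)"
      then have "per (l - k)" using per * by blast
      then have "(LEAST p. per p) \<le> l - k" by (rule Least_le)
      with * show False by simp
    qed
  qed
qed

text \<open>Another logarithm of t changes \<open>p * Ln t\<close> by a multiple of 2 pi i p, a
  multiple of the period of the lift; so \<open>S (p * Ln t)\<close> is single valued and
  holomorphic on the punctured disc. It is bounded, so the singularity at 0 is removable, and the
  value there is the only root over 0.\<close>

lemma puiseux_root:
  obtains p :: nat and \<rho> \<phi> where "p > 0" "\<rho> > 0" "\<rho> ^ p \<le> \<delta>'" "\<phi> holomorphic_on ball 0 \<rho>" "\<phi> 0 = 0"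
    "\<And>t. t \<noteq> 0 \<Longrightarrow> norm t < \<rho> \<Longrightarrow> \<phi> t \<in> Z (t ^ p)"
    "\<And>t k l. t \<noteq> 0 \<Longrightarrow> norm t < \<rho> \<Longrightarrow> k < p \<Longrightarrow> l < p \<Longrightarrow> k \<noteq> l \<Longrightarrow>
      \<phi> (exp (2 * pi * \<i> / p) ^ k * t) \<noteq> \<phi> (exp (2 * pi * \<i> / p) ^ l * t)"
proof -
  obtain S where S: "lift S" using lift_exists .
  obtain p :: nat where p: "p > 0" "\<And>w. w \<in> H \<Longrightarrow> S (w + 2 * pi * \<i> * p) = S w"
    "\<And>w k l. w \<in> H \<Longrightarrow> k < l \<Longrightarrow> l < p \<Longrightarrow> S (w + 2 * pi * \<i> * of_nat k) \<noteq> S (w + 2 * pi * \<i> * of_nat l)"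
    using lift_period[OF S] by blast
  have pern: "S (w + 2 * pi * \<i> * p * of_nat n) = S w" if w: "w \<in> H" for w and n :: nat
  proof (induction n)
    case (Suc n)
    have "w + 2 * pi * \<i> * p * of_nat n \<in> H" using w by (simp add: H_def)
    from p(2)[OF this] Suc show ?case by (simp add: algebra_simps)
  qed simp
  have per: "S (w + 2 * pi * \<i> * p * of_int n) = S w" if w: "w \<in> H" for w n
  proof (cases n)
    case (nonneg m)
    then show ?thesis using pern[OF w, of m] by simp
  next
    case (neg m)
    have "w + 2 * pi * \<i> * p * of_int n \<in> H" using w by (simp add: H_def)
    from pern[OF this, of "Suc m"] show ?thesis by (simp add: neg algebra_simps)
  qed
  define \<rho> where "\<rho> = exp (ln \<delta>' / p)"
  have \<rho>: "\<rho> > 0" "\<rho> ^ p = \<delta>'" using p(1) \<delta>' by (auto simp: \<rho>_def simp flip: exp_of_nat_mult)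
  have pH: "of_nat p * w \<in> H" if "norm (exp w) < \<rho>" for w
  proof -
    have "Re w < ln \<delta>' / p" using that by (simp add: \<rho>_def norm_exp_eq_Re)
    then show ?thesis using p(1) by (simp add: H_def field_simps)
  qed
  define f where "f = (\<lambda>t. S (of_nat p * Ln t))"
  have f_exp: "f (exp w) = S (of_nat p * w)" if w: "norm (exp w) < \<rho>" for w
  proof -
    have "exp (Ln (exp w)) = exp w" by simp
    then obtain n :: int where n: "Ln (exp w) = w + of_int (2 * n) * pi * \<i>" unfolding exp_eq by blast
    show ?thesis using per[OF pH[OF w], of n] unfolding f_def n by (simp add: algebra_simps)
  qed
  have holf: "f holomorphic_on ball 0 \<rho> - {0}"
    unfolding holomorphic_on_def
  proof
    fix t0 :: complex assume t0: "t0 \<in> ball 0 \<rho> - {0}"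
    define w0 where "w0 = Ln t0"
    have w0: "exp w0 = t0" using t0 by (simp add: w0_def)
    \<comment> \<open>\<open>Ln\<close> may jump at t0. In the disc about t0 of radius
      \<open>norm t0\<close> the quotient t / t0 has positive real part, so
      \<open>Ln (t / t0) + w0\<close> is a holomorphic logarithm of t there.\<close>
    define V where "V = ball 0 \<rho> \<inter> ball t0 (norm t0)"
    have V: "open V" "t0 \<in> V" using t0 by (auto simp: V_def)
    have re: "t / t0 \<notin> \<real>\<^sub>\<le>\<^sub>0" "t \<noteq> 0" if "t \<in> V" for t
    proof -
      have "t / t0 - 1 = (t - t0) / t0" using t0 by (simp add: diff_divide_distrib)
      moreover have "norm (t - t0) < norm t0" using that by (simp add: V_def dist_norm norm_minus_commute)
      ultimately have "norm (t / t0 - 1) < 1" using t0 by (simp add: norm_divide)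
      then have "Re (t / t0) > 0" using abs_Re_le_cmod[of "t / t0 - 1"] by simp
      then show "t / t0 \<notin> \<real>\<^sub>\<le>\<^sub>0" by (auto simp: complex_nonpos_Reals_iff)
      then show "t \<noteq> 0" by auto
    qed
    have eq: "exp (Ln (t / t0) + w0) = t" if "t \<in> V" for t
      using re[OF that] t0 by (simp add: exp_add w0)
    have small: "norm (exp (Ln (t / t0) + w0)) < \<rho>" if "t \<in> V" for t
      unfolding eq[OF that] using that by (simp add: V_def)
    have inH: "of_nat p * (Ln (t / t0) + w0) \<in> H" if "t \<in> V" for t
      by (rule pH[OF small[OF that]])
    have "(\<lambda>t. S (of_nat p * (Ln (t / t0) + w0))) holomorphic_on V"
      using inH re t0
      by (intro holomorphic_on_compose_gen[of "\<lambda>t. of_nat p * (Ln (t / t0) + w0)" V S H, unfolded comp_def] lift_holomorphic[OF S])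
        (auto intro!: holomorphic_intros)
    moreover have "S (of_nat p * (Ln (t / t0) + w0)) = f t" if "t \<in> V" for t
      using f_exp[OF small[OF that]] unfolding eq[OF that] by simp
    ultimately have "f holomorphic_on V" by (simp cong: holomorphic_cong)
    then have "f field_differentiable (at t0)"
      using V holomorphic_on_imp_differentiable_at by blast
    then show "f field_differentiable (at t0 within ball 0 \<rho> - {0})" by (rule field_differentiable_at_within)
  qed
  have fZ: "f t \<in> Z (t ^ p)" if "t \<noteq> 0" "norm t < \<rho>" for t
  proof -
    have "of_nat p * Ln t \<in> H" using that by (intro pH) simp
    moreover have "exp (of_nat p * Ln t) = t ^ p" using that by (simp add: exp_of_nat_mult)
    ultimately show ?thesis using S unfolding f_def lift_def by metis
  qed
  have "eventually (\<lambda>t. norm (f t) \<le> \<epsilon>) (at 0)"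
    unfolding eventually_at using \<rho>(1) fZ by (intro exI[of _ \<rho>]) (auto simp: Z_def intro: less_imp_le)
  then have "\<exists>g. g holomorphic_on ball 0 \<rho> \<and> (\<forall>z\<in>ball 0 \<rho> - {0}. g z = f z)"
    using holomorphic_on_extend_bounded[OF holf] \<rho>(1) by auto
  then obtain \<phi> where \<phi>: "\<phi> holomorphic_on ball 0 \<rho>" "\<And>t. t \<noteq> 0 \<Longrightarrow> norm t < \<rho> \<Longrightarrow> \<phi> t = f t" by auto
  have cont: "(\<phi> \<longlongrightarrow> \<phi> 0) (at 0)"
    using holomorphic_on_imp_continuous_on[OF \<phi>(1)] \<rho>(1)
    by (simp add: continuous_on_eq_continuous_at isCont_def)
  have ev: "eventually (\<lambda>t. t \<noteq> 0 \<and> norm t < \<rho>) (at (0::complex))"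
    unfolding eventually_at using \<rho>(1) by (intro exI[of _ \<rho>]) auto
  have "norm (\<phi> 0) \<le> \<epsilon>"
  proof (rule tendsto_upperbound[OF tendsto_norm[OF cont]])
    show "eventually (\<lambda>t. norm (\<phi> t) \<le> \<epsilon>) (at 0)"
      using ev fZ \<phi>(2) by (auto simp: Z_def elim!: eventually_mono intro: less_imp_le)
  qed simp
  have "((\<lambda>t. h (t ^ p) (\<phi> t)) \<longlongrightarrow> h (0 ^ p) (\<phi> 0)) (at 0)"
  proof -
    have "isCont (\<lambda>(x, y). h x y) (0 ^ p, \<phi> 0)"
      using hol2_continuous[OF hol] p(1) \<delta> \<epsilon> \<open>norm (\<phi> 0) \<le> \<epsilon>\<close>
      by (subst (asm) continuous_on_eq_continuous_at) (auto intro!: open_Times simp: power_0_left)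
    moreover have "((\<lambda>t. (t ^ p, \<phi> t)) \<longlongrightarrow> (0 ^ p, \<phi> 0)) (at 0)"
      by (intro tendsto_intros cont)
    ultimately have "((\<lambda>t. (\<lambda>(x, y). h x y) (t ^ p, \<phi> t)) \<longlongrightarrow> (\<lambda>(x, y). h x y) (0 ^ p, \<phi> 0)) (at 0)"
      by (rule isCont_tendsto_compose)
    then show ?thesis by simp
  qed
  moreover have "((\<lambda>t. h (t ^ p) (\<phi> t)) \<longlongrightarrow> 0) (at 0)"
    by (rule tendsto_eventually) (use ev fZ \<phi>(2) in \<open>auto simp: Z_def elim!: eventually_mono\<close>)
  ultimately have "h (0 ^ p) (\<phi> 0) = 0" using tendsto_unique[of "at (0::complex)"] by fastforce
  then have "\<phi> 0 = 0" using h0[OF \<open>norm (\<phi> 0) \<le> \<epsilon>\<close>] p(1) by (simp add: power_0_left)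
  define \<zeta> where "\<zeta> = exp (2 * pi * \<i> / p)"
  have dist: "\<phi> (\<zeta> ^ k * t) \<noteq> \<phi> (\<zeta> ^ l * t)"
    if t: "t \<noteq> 0" "norm t < \<rho>" and kl: "k < l" "l < p" for t k l
  proof -
    \<comment> \<open>Multiplying t by the k-th power of the primitive root of unity moves the
      argument of the lift by 2 pi i k.\<close>
    have eq: "\<phi> (\<zeta> ^ k * t) = S (of_nat p * Ln t + 2 * pi * \<i> * of_nat k)" for k
    proof -
      have 1: "exp (Ln t + 2 * pi * \<i> / p * of_nat k) = \<zeta> ^ k * t"
        using t by (simp add: \<zeta>_def exp_add mult_ac flip: exp_of_nat_mult)
      have n: "norm (\<zeta> ^ k * t) < \<rho>" "\<zeta> ^ k * t \<noteq> 0"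
        using t by (auto simp: \<zeta>_def norm_mult norm_power norm_exp_eq_Re)
      have "\<phi> (\<zeta> ^ k * t) = f (exp (Ln t + 2 * pi * \<i> / p * of_nat k))" using \<phi>(2) n 1 by simp
      also have "\<dots> = S (of_nat p * (Ln t + 2 * pi * \<i> / p * of_nat k))" by (rule f_exp) (use n 1 in simp)
      also have "of_nat p * (Ln t + 2 * pi * \<i> / p * of_nat k) = of_nat p * Ln t + 2 * pi * \<i> * of_nat k"
        using p(1) by (simp add: distrib_left)
      finally show ?thesis .
    qed
    have "of_nat p * Ln t \<in> H" using t by (intro pH) simp
    from p(3)[OF this kl] show ?thesis unfolding eq .
  qed
  show ?thesis
  proof (rule that[OF p(1) \<rho>(1) _ \<phi>(1) \<open>\<phi> 0 = 0\<close>])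
    show "\<rho> ^ p \<le> \<delta>'" using \<rho>(2) by simp
    show "\<phi> t \<in> Z (t ^ p)" if "t \<noteq> 0" "norm t < \<rho>" for t using fZ \<phi>(2) that by simp
    show "\<phi> (exp (2 * pi * \<i> / p) ^ k * t) \<noteq> \<phi> (exp (2 * pi * \<i> / p) ^ l * t)"
      if "t \<noteq> 0" "norm t < \<rho>" "k < p" "l < p" "k \<noteq> l" for t k l
      using dist[OF that(1,2), of k l] dist[OF that(1,2), of l k] that(3-5)
      by (cases "k < l") (auto simp: \<zeta>_def)
  qed
qed

end

section \<open>Division along a branch\<close>

lemma exists_root_in_ball:
  fixes x :: complex
  assumes "p > 0" "\<rho> > 0" "norm x < \<rho> ^ p"
  obtains t where "t ^ p = x" "norm t < \<rho>"
proof (cases "x = 0")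
  case True
  then show ?thesis using that[of 0] assms by (simp add: power_0_left)
next
  case False
  define t where "t = exp (Ln x / p)"
  have t: "t ^ p = x" using assms(1) False by (simp add: t_def flip: exp_of_nat_mult)
  then have "norm t ^ p < \<rho> ^ p" using assms(3) by (simp flip: norm_power)
  then have "norm t < \<rho>" by (rule power_less_imp_less_base) (use assms(2) in simp)
  then show ?thesis using t that by blast
qed

lemma equal_power_imp_unity_multiple:
  fixes t u :: complex
  assumes "t ^ p = u ^ p" "p > 0"
  obtains \<omega> where "\<omega> ^ p = 1" "t = \<omega> * u"
proof (cases "u = 0")
  case True
  then show ?thesis using that[of 1] assms by (simp add: power_0_left)
next
  case False
  then show ?thesis using that[of "t / u"] assms by (simp add: power_divide)
qed

text \<open>It is enough to test the primitive root exp (2 pi i / p).\<close>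

lemma dvd_if_unity_power_eq_1:
  assumes "p > 0" "\<And>\<omega>::complex. \<omega> ^ p = 1 \<Longrightarrow> \<omega> ^ m = 1"
  shows "p dvd m"
proof -
  define \<omega> where "\<omega> = exp (2 * of_real pi * \<i> * of_nat 1 / of_nat p)"
  have "\<omega> ^ p = exp (of_nat p * (2 * of_real pi * \<i> * of_nat 1 / of_nat p))"
    unfolding \<omega>_def by (rule exp_of_nat_mult[symmetric])
  also have "\<dots> = 1" using assms(1) by simp
  finally have "\<omega> ^ m = 1" by (rule assms(2))
  moreover have "\<omega> ^ m = exp (2 * of_real pi * \<i> * of_nat m / of_nat p)"
    unfolding \<omega>_def by (subst exp_of_nat_mult[symmetric]) (simp add: mult_ac)
  ultimately have "exp (2 * of_real pi * \<i> * of_nat m / of_nat p) = exp (2 * of_real pi * \<i> * of_nat 0 / of_nat p)"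
    by simp
  then have "m mod p = 0 mod p" using assms(1) by (subst (asm) complex_root_unity_eq) auto
  then show ?thesis by (simp add: dvd_eq_mod_eq_0)
qed

lemma norm_unity: "\<omega> ^ p = 1 \<Longrightarrow> p > 0 \<Longrightarrow> norm (\<omega>::complex) = 1"
  by (metis norm_ge_zero norm_one norm_power power_eq_1_iff less_not_refl)

text \<open>Substituting \<omega> t for t multiplies the n-th Taylor coefficient by
  \<open>\<omega> ^ n\<close>; invariance kills all coefficients whose index is not a multiple of p,
  and what remains is a series in \<open>t ^ p\<close>.\<close>

lemma holomorphic_invariant_descends:
  assumes f: "f holomorphic_on ball 0 \<rho>" and p: "p > 0" and \<rho>: "\<rho> > 0"
    and inv: "\<And>\<omega> t. \<omega> ^ p = 1 \<Longrightarrow> norm t < \<rho> \<Longrightarrow> f (\<omega> * t) = f t"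
  shows "\<exists>g. g holomorphic_on ball 0 (\<rho> ^ p) \<and> (\<forall>t. norm t < \<rho> \<longrightarrow> g (t ^ p) = f t)"
proof -
  define a where "a = (\<lambda>n. (deriv ^^ n) f 0 / fact n)"
  have sums: "(\<lambda>n. a n * t ^ n) sums f t" if "norm t < \<rho>" for t
    using holomorphic_power_series[OF f, of t] that by (simp add: a_def)
  have "a n = 0" if "n \<notin> range ((*) p)" for n
  proof (rule ccontr)
    assume "a n \<noteq> 0"
    have "\<omega> ^ n = 1" if \<omega>: "\<omega> ^ p = 1" for \<omega> :: complex
    proof -
      have sub: "\<omega> * t \<in> ball 0 \<rho>" if "t \<in> ball 0 \<rho>" for t
        using that norm_unity[OF \<omega> p] by (simp add: norm_mult)
      have "(deriv ^^ n) (\<lambda>t. f (\<omega> * t)) 0 = \<omega> ^ n * (deriv ^^ n) f (\<omega> * 0)"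
        by (rule higher_deriv_compose_linear[OF f, of "ball 0 \<rho>"]) (use sub \<rho> in auto)
      moreover have "(deriv ^^ n) (\<lambda>t. f (\<omega> * t)) 0 = (deriv ^^ n) f 0"
      proof (rule higher_deriv_transform_within_open[of _ "ball 0 \<rho>"])
        show "(\<lambda>t. f (\<omega> * t)) holomorphic_on ball 0 \<rho>"
          using sub by (intro holomorphic_on_compose_gen[of "(*) \<omega>" _ f, unfolded comp_def, OF _ f])
            (auto intro!: holomorphic_intros)
      qed (use f \<rho> inv[OF \<omega>] in auto)
      ultimately show ?thesis using \<open>a n \<noteq> 0\<close> by (simp add: a_def)
    qed
    then have "p dvd n" by (rule dvd_if_unity_power_eq_1[OF p])
    with that show False by auto
  qed
  then have sums': "(\<lambda>n. a (p * n) * (t ^ p) ^ n) sums f t" if "norm t < \<rho>" for t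
    using sums_mono_reindex[of "(*) p" "\<lambda>n. a n * t ^ n" "f t"] sums[OF that] p
    by (simp add: strict_mono_def power_mult)
  define g where "g = (\<lambda>x. \<Sum>n. a (p * n) * x ^ n)"
  have g: "g (t ^ p) = f t" if "norm t < \<rho>" for t
    using sums_unique[OF sums'[OF that]] by (simp add: g_def)
  moreover have "g holomorphic_on ball 0 (\<rho> ^ p)"
  proof (rule power_series_holomorphic)
    fix x :: complex assume "x \<in> ball 0 (\<rho> ^ p)"
    then obtain t where t: "t ^ p = x" "norm t < \<rho>" using exists_root_in_ball[OF p \<rho>, of x] by auto
    show "(\<lambda>n. a (p * n) * (x - 0) ^ n) sums g x" using sums'[OF t(2)] g[OF t(2)] t(1) by simp
  qed
  ultimately show ?thesis by blast
qed

section \<open>Descent of polynomials with holomorphic coefficients\<close>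

definition poly_hol :: "complex set \<Rightarrow> (complex \<Rightarrow> complex poly) \<Rightarrow> bool" where
  "poly_hol A Q \<longleftrightarrow> (\<forall>j. (\<lambda>t. Polynomial.coeff (Q t) j) holomorphic_on A)"

lemma poly_hol_mult: "poly_hol A P \<Longrightarrow> poly_hol A Q \<Longrightarrow> poly_hol A (\<lambda>t. P t * Q t)"
  unfolding poly_hol_def coeff_mult by (intro allI holomorphic_intros) auto

lemma poly_hol_sum: "(\<And>i. i \<in> I \<Longrightarrow> poly_hol A (P i)) \<Longrightarrow> poly_hol A (\<lambda>t. \<Sum>i\<in>I. P i t)"
  unfolding poly_hol_def coeff_sum by (intro allI holomorphic_intros) auto

lemma poly_hol_const:
  assumes "f holomorphic_on A"
  shows "poly_hol A (\<lambda>t. [:f t:])"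
  unfolding poly_hol_def
proof
  show "(\<lambda>t. Polynomial.coeff [:f t:] j) holomorphic_on A" for j
    using assms by (cases j) auto
qed

lemma poly_hol_linear:
  assumes "f holomorphic_on A"
  shows "poly_hol A (\<lambda>t. [:- f t, 1:])"
  unfolding poly_hol_def
proof
  show "(\<lambda>t. Polynomial.coeff [:- f t, 1:] j) holomorphic_on A" for j
    using assms by (cases j; cases "j - 1") (auto intro!: holomorphic_intros)
qed

lemma poly_hol_prod: "(\<And>i. i \<in> I \<Longrightarrow> poly_hol A (P i)) \<Longrightarrow> poly_hol A (\<lambda>t. \<Prod>i\<in>I. P i t)"
  by (induction I rule: infinite_finite_induct)
     (auto intro: poly_hol_mult poly_hol_const[of "\<lambda>_. 1", unfolded one_pCons[symmetric]])

text \<open>The coefficients descend one by one to functions of \<open>t ^ p\<close>; the uniform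
  degree bound N provides a single finite sum valid for all x.\<close>

lemma hol2_invariant_poly:
  assumes Q: "poly_hol (ball 0 \<rho>) Q" and deg: "\<And>t. Polynomial.degree (Q t) \<le> N" and p: "p > 0" and \<rho>: "\<rho> > 0"
    and inv: "\<And>\<omega> t. \<omega> ^ p = 1 \<Longrightarrow> norm t < \<rho> \<Longrightarrow> Q (\<omega> * t) = Q t"
  obtains W where "hol2 (ball 0 (\<rho> ^ p)) UNIV W" "\<And>t y. norm t < \<rho> \<Longrightarrow> W (t ^ p) y = poly (Q t) y"
proof -
  have "\<exists>g. g holomorphic_on ball 0 (\<rho> ^ p) \<and> (\<forall>t. norm t < \<rho> \<longrightarrow> g (t ^ p) = Polynomial.coeff (Q t) j)" for j
    using Q inv unfolding poly_hol_def by (intro holomorphic_invariant_descends[OF _ p \<rho>]) auto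
  then obtain g where g: "\<And>j. g j holomorphic_on ball 0 (\<rho> ^ p)"
    "\<And>j t. norm t < \<rho> \<Longrightarrow> g j (t ^ p) = Polynomial.coeff (Q t) j" by metis
  show ?thesis
  proof
    show "hol2 (ball 0 (\<rho> ^ p)) UNIV (\<lambda>x y. \<Sum>j\<le>N. g j x * y ^ j)"
      by (intro hol2_sum hol2_mult hol2_fst hol2_snd g holomorphic_intros)
    fix t y :: complex assume "norm t < \<rho>"
    then have "(\<Sum>j\<le>N. g j (t ^ p) * y ^ j) = (\<Sum>j\<le>N. Polynomial.coeff (Q t) j * y ^ j)" by (simp add: g)
    also have "\<dots> = (\<Sum>j\<le>Polynomial.degree (Q t). Polynomial.coeff (Q t) j * y ^ j)"
      using deg[of t] by (intro sum.mono_neutral_right) (auto simp: coeff_eq_0)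
    finally show "(\<Sum>j\<le>N. g j (t ^ p) * y ^ j) = poly (Q t) y" by (simp add: poly_altdef)
  qed
qed

text \<open>Zeros are split off one at a time by the removable singularity theorem. As the points
  are distinct, the factors already removed do not vanish at the next one, so the remaining function
  does.\<close>

lemma holomorphic_split_zeros:
  assumes f: "f holomorphic_on S" and S: "open S" and I: "finite I" and a: "inj_on a I" "\<And>i. i \<in> I \<Longrightarrow> f (a i) = 0"
  shows "\<exists>g. g holomorphic_on S \<and> (\<forall>y. f y = g y * (\<Prod>i\<in>I. y - a i))"
  using I a
proof (induction I)
  case empty
  then show ?case using f by auto
next
  case (insert i I)
  then obtain g where g: "g holomorphic_on S" "\<And>y. f y = g y * (\<Prod>i\<in>I. y - a i)" by auto
  have "(\<Prod>j\<in>I. a i - a j) \<noteq> 0" using insert by (auto simp: prod_zero_iff)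
  then have "g (a i) = 0" using g(2)[of "a i"] insert.prems(2)[of i] by simp
  define k where "k = (\<lambda>z. if z = a i then deriv g (a i) else (g z - g (a i)) / (z - a i))"
  have "k holomorphic_on S" unfolding k_def by (rule pole_lemma_open[OF g(1) S])
  moreover have "g y = k y * (y - a i)" for y using \<open>g (a i) = 0\<close> by (simp add: k_def)
  then have "f y = k y * (\<Prod>j\<in>insert i I. y - a j)" for y
    using g(2)[of y] insert.hyps by simp
  ultimately show ?case by blast
qed

text \<open>The condition \<open>inj_\<phi>\<close> makes the parametrization primitive: the p
  conjugates \<phi> (\<omega> t) over one nonzero x are distinct, so none of them is counted twice
  in the polynomial \<open>W\<close>.\<close>

locale branch =
  fixes p :: nat and \<rho> :: real and \<phi> :: "complex \<Rightarrow> complex"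
  assumes p: "p > 0" and \<rho>: "\<rho> > 0" and hol_\<phi>: "\<phi> holomorphic_on ball 0 \<rho>" and \<phi>0: "\<phi> 0 = 0"
    and inj_\<phi>: "\<And>t \<omega> \<nu>. t \<noteq> 0 \<Longrightarrow> norm t < \<rho> \<Longrightarrow> \<omega> ^ p = 1 \<Longrightarrow> \<nu> ^ p = 1 \<Longrightarrow> \<omega> \<noteq> \<nu> \<Longrightarrow> \<phi> (\<omega> * t) \<noteq> \<phi> (\<nu> * t)"
begin

definition \<Omega> :: "complex set" where "\<Omega> = {\<omega>. \<omega> ^ p = 1}"

lemma \<Omega>: "finite \<Omega>" "card \<Omega> = p" "1 \<in> \<Omega>"
  using finite_roots_unity[of p] card_roots_unity_eq[of p] p by (auto simp: \<Omega>_def)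

lemma norm_\<Omega>: "\<omega> \<in> \<Omega> \<Longrightarrow> norm (\<omega> * t) = norm t"
  using norm_unity[of \<omega> p] p by (simp add: \<Omega>_def norm_mult)

lemma bij_\<Omega>: "\<omega> \<in> \<Omega> \<Longrightarrow> bij_betw (\<lambda>\<nu>. \<nu> * \<omega>) \<Omega> \<Omega>"
proof (rule bij_betwI[where g = "\<lambda>\<nu>. \<nu> / \<omega>"])
  assume "\<omega> \<in> \<Omega>"
  then have "\<omega> \<noteq> 0" "\<omega> ^ p = 1" using p by (auto simp: \<Omega>_def power_0_left)
  then show "(\<lambda>\<nu>. \<nu> * \<omega>) \<in> \<Omega> \<rightarrow> \<Omega>" "(\<lambda>\<nu>. \<nu> / \<omega>) \<in> \<Omega> \<rightarrow> \<Omega>" "\<nu> * \<omega> / \<omega> = \<nu>" "\<nu> / \<omega> * \<omega> = \<nu>" for \<nu>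
    by (auto simp: \<Omega>_def power_mult_distrib power_divide)
qed

lemma hol_\<phi>_\<omega>: "\<omega> \<in> \<Omega> \<Longrightarrow> (\<lambda>t. \<phi> (\<omega> * t)) holomorphic_on ball 0 \<rho>"
  using norm_\<Omega> by (intro holomorphic_on_compose_gen[of "(*) \<omega>" _ \<phi>, unfolded comp_def, OF _ hol_\<phi>])
    (auto intro!: holomorphic_intros)

text \<open>The Weierstrass polynomial of the branch. Any p-th root of x may be chosen because the
  product runs over all conjugates, see \<open>W_power\<close>; for
  \<open>norm x \<ge> \<rho> ^ p\<close> there is no admissible root and the value is
  arbitrary.\<close>

definition W :: "complex \<Rightarrow> complex \<Rightarrow> complex" where
  "W x y = (let t = SOME t. t ^ p = x \<and> norm t < \<rho> in \<Prod>\<omega>\<in>\<Omega>. y - \<phi> (\<omega> * t))"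

lemma W_power:
  assumes t: "norm t < \<rho>"
  shows "W (t ^ p) y = (\<Prod>\<omega>\<in>\<Omega>. y - \<phi> (\<omega> * t))"
proof -
  define u where "u = (SOME u. u ^ p = t ^ p \<and> norm u < \<rho>)"
  have u: "u ^ p = t ^ p \<and> norm u < \<rho>" unfolding u_def by (rule someI[of _ t]) (use t in simp)
  obtain \<omega> where \<omega>: "\<omega> ^ p = 1" "u = \<omega> * t" using equal_power_imp_unity_multiple[OF _ p] u by blast
  have "W (t ^ p) y = (\<Prod>\<nu>\<in>\<Omega>. y - \<phi> ((\<nu> * \<omega>) * t))" by (simp add: W_def u_def[symmetric] \<omega>(2) mult.assoc)
  also have "\<dots> = (\<Prod>\<nu>\<in>\<Omega>. y - \<phi> (\<nu> * t))"
    using \<omega>(1) by (intro prod.reindex_bij_betw[OF bij_\<Omega>]) (simp add: \<Omega>_def)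
  finally show ?thesis .
qed

lemma hol2_W: "hol2 (ball 0 (\<rho> ^ p)) UNIV W"
proof -
  define Q where "Q = (\<lambda>t. \<Prod>\<omega>\<in>\<Omega>. [:- \<phi> (\<omega> * t), 1:])"
  obtain V where V: "hol2 (ball 0 (\<rho> ^ p)) UNIV V" "\<And>t y. norm t < \<rho> \<Longrightarrow> V (t ^ p) y = poly (Q t) y"
  proof (rule hol2_invariant_poly[OF _ _ p \<rho>])
    show "poly_hol (ball 0 \<rho>) Q" unfolding Q_def by (intro poly_hol_prod poly_hol_linear hol_\<phi>_\<omega>)
    show "Polynomial.degree (Q t) \<le> p" for t
      unfolding Q_def using degree_prod_sum_le[OF \<Omega>(1), of "\<lambda>\<omega>. [:- \<phi> (\<omega> * t), 1:]"] \<Omega>(2) by simp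
    show "Q (\<omega> * t) = Q t" if "\<omega> ^ p = 1" for \<omega> t
      using prod.reindex_bij_betw[OF bij_\<Omega>, of \<omega> "\<lambda>\<omega>. [:- \<phi> (\<omega> * t), 1:]"] that
      by (simp add: Q_def mult.assoc \<Omega>_def)
  qed blast
  have "V x y = W x y" if "x \<in> ball 0 (\<rho> ^ p)" for x y
  proof -
    obtain t where t: "t ^ p = x" "norm t < \<rho>" using exists_root_in_ball[OF p \<rho>, of x] \<open>x \<in> _\<close> by auto
    show ?thesis using V(2)[OF t(2), of y] W_power[OF t(2), of y] by (simp add: t(1) Q_def poly_prod)
  qed
  then show ?thesis using V(1) by (subst (asm) hol2_cong) auto
qed

lemma \<phi>_small:
  assumes "e > 0"
  shows "\<exists>r>0. r \<le> \<rho> \<and> (\<forall>t. norm t < r \<longrightarrow> norm (\<phi> t) < e)"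
proof -
  have "isCont \<phi> 0" using holomorphic_on_imp_continuous_on[OF hol_\<phi>] \<rho> by (simp add: continuous_on_eq_continuous_at)
  then obtain d where d: "d > 0" "\<And>t. norm t < d \<Longrightarrow> norm (\<phi> t) < e"
    using assms \<phi>0 unfolding continuous_at_eps_delta by (auto simp: dist_norm)
  then show ?thesis using \<rho> by (intro exI[of _ "min d \<rho>"]) auto
qed

text \<open>The quotient is the Cauchy integral of \<open>g / W\<close> over a circle in \<open>y\<close>; this takes care of \<open>x = 0\<close>, where the
  roots of \<open>W\<close> collide.\<close>

lemma quotient_by_W:
  assumes g: "hol2 (ball 0 d) (ball 0 d) g" and d: "d > 0"
    and d': "d' > 0" "\<And>t. norm t < d' \<Longrightarrow> g (t ^ p) (\<phi> t) = 0"
  obtains e q where "e > 0" "hol2 (ball 0 e) (ball 0 e) q"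
    "\<And>x y. norm x < e \<Longrightarrow> norm y < e \<Longrightarrow> g x y = q x y * W x y"
proof -
  define \<epsilon> where "\<epsilon> = d / 2"
  have \<epsilon>: "\<epsilon> > 0" "\<epsilon> < d" using d by (auto simp: \<epsilon>_def)
  obtain r0 where r0: "r0 > 0" "r0 \<le> \<rho>" "\<And>t. norm t < r0 \<Longrightarrow> norm (\<phi> t) < \<epsilon>" using \<phi>_small[OF \<epsilon>(1)] by blast
  define r where "r = min r0 d'"
  have r: "r > 0" "r \<le> \<rho>" "r \<le> d'" "\<And>t. norm t < r \<Longrightarrow> norm (\<phi> t) < \<epsilon>" using r0 d' by (auto simp: r_def)
  \<comment> \<open>Each x with \<open>norm x < a\<close> has a p-th root of norm less than r, so
    all conjugate roots over it lie strictly inside the circle of radius \<epsilon>, where the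
    Cauchy integral is taken.\<close>
  define a where "a = min (r ^ p) d"
  have a: "a > 0" "a \<le> r ^ p" "a \<le> d" using r d by (auto simp: a_def)
  have ar: "a \<le> \<rho> ^ p" using a r power_mono[of r \<rho> p] by linarith
  have root: "\<exists>t. t ^ p = x \<and> norm t < r" if "norm x < a" for x :: complex
    using exists_root_in_ball[OF p r(1), of x] that a by auto
  have hW: "hol2 (ball 0 a) UNIV W" by (rule hol2_subset[OF hol2_W]) (use ar in auto)
  have hg: "hol2 (ball 0 a) (ball 0 d) g" by (rule hol2_subset[OF g]) (use a in auto)
  have Wnz: "W x w \<noteq> 0" if x: "norm x < a" and w: "norm w = \<epsilon>" for x w
  proof -
    obtain t where t: "t ^ p = x" "norm t < r" using root[OF x] by blast
    have "norm (\<phi> (\<omega> * t)) < \<epsilon>" if "\<omega> \<in> \<Omega>" for \<omega> using r(4) t norm_\<Omega>[OF that] by simp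
    then have "w - \<phi> (\<omega> * t) \<noteq> 0" if "\<omega> \<in> \<Omega>" for \<omega> using that w by force
    then show ?thesis using W_power[of t w] t r \<Omega>(1) by (simp add: prod_zero_iff)
  qed
  define q where "q = (\<lambda>x y. 1 / (2 * pi * \<i>) * contour_integral (circlepath 0 \<epsilon>) (\<lambda>w. g x w / W x w / (w - y) ^ 1))"
  have sub: "ball 0 a \<times> sphere 0 \<epsilon> \<subseteq> ball 0 a \<times> ball (0::complex) d" using \<epsilon> by auto
  have hq: "hol2 (ball 0 a) (ball 0 \<epsilon>) q"
    unfolding q_def
  proof (intro hol2_mult hol2_fst holomorphic_on_const hol2_Cauchy_kernel)
    show "continuous_on (ball 0 a \<times> sphere 0 \<epsilon>) (\<lambda>(x, w). g x w / W x w)"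
      unfolding case_prod_unfold
      by (intro continuous_intros continuous_on_subset[OF hol2_continuous[OF hg] sub, unfolded case_prod_unfold]
         continuous_on_subset[OF hol2_continuous[OF hW], unfolded case_prod_unfold]) (use Wnz in auto)
    show "(\<lambda>x. g x w / W x w) holomorphic_on ball 0 a" if "w \<in> sphere 0 \<epsilon>" for w
      using that \<epsilon> Wnz by (intro holomorphic_intros hol2_holomorphic1[OF hg] hol2_holomorphic1[OF hW]) auto
  qed (use \<epsilon> in auto)
  have eq: "g x y = q x y * W x y" if x: "norm x < a" "x \<noteq> 0" and y: "norm y < \<epsilon>" for x y
  proof -
    obtain t where t: "t ^ p = x" "norm t < r" using root[OF x(1)] by blast
    have t0: "t \<noteq> 0" using t x p by (auto simp: power_0_left)
    have hgx: "g x holomorphic_on ball 0 d" by (rule hol2_holomorphic2[OF hg]) (use x in simp)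
    \<comment> \<open>For nonzero x the p conjugate roots are distinct zeros of \<open>g x\<close>,
      so \<open>W x\<close> divides \<open>g x\<close> and the Cauchy integral merely reproduces the
      quotient.\<close>
    have "\<exists>F. F holomorphic_on ball 0 d \<and> (\<forall>y. g x y = F y * (\<Prod>\<omega>\<in>\<Omega>. y - \<phi> (\<omega> * t)))"
    proof (rule holomorphic_split_zeros[OF hgx open_ball \<Omega>(1)])
      show "inj_on (\<lambda>\<omega>. \<phi> (\<omega> * t)) \<Omega>"
        using inj_\<phi>[OF t0] t r unfolding inj_on_def \<Omega>_def by fastforce
      show "g x (\<phi> (\<omega> * t)) = 0" if "\<omega> \<in> \<Omega>" for \<omega>
        using d'(2)[of "\<omega> * t"] that t r norm_\<Omega>[OF that, of t] by (simp add: power_mult_distrib \<Omega>_def)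
    qed
    then obtain F where F: "F holomorphic_on ball 0 d" "\<And>y. g x y = F y * W x y"
      using W_power[of t] t r by auto
    have "contour_integral (circlepath 0 \<epsilon>) (\<lambda>w. g x w / W x w / (w - y) ^ 1) =
        contour_integral (circlepath 0 \<epsilon>) (\<lambda>w. F w / (w - y))"
      by (rule contour_integral_eq) (use Wnz[OF x(1)] F(2) \<epsilon> in auto)
    also have "\<dots> = 2 * pi * \<i> * F y"
    proof -
      have "F holomorphic_on cball 0 \<epsilon>" by (rule holomorphic_on_subset[OF F(1)]) (use \<epsilon> in auto)
      from contour_integral_unique[OF Cauchy_integral_circlepath_simple[OF this, of y]] y
      show ?thesis by simp
    qed
    finally have "q x y = F y" by (simp add: q_def)
    then show ?thesis using F(2) by simp
  qed
  have eq': "g x y = q x y * W x y" if x: "norm x < a" and y: "norm y < \<epsilon>" for x y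
  proof (cases "x = 0")
    case True
    \<comment> \<open>The defect is continuous in x and vanishes for x \<noteq> 0, hence also at
      0.\<close>
    define k where "k = (\<lambda>x. g x y - q x y * W x y)"
    have "k holomorphic_on ball 0 a" unfolding k_def
      by (intro holomorphic_intros hol2_holomorphic1[OF hg] hol2_holomorphic1[OF hq] hol2_holomorphic1[OF hW]) (use y \<epsilon> in auto)
    from holomorphic_on_imp_continuous_on[OF this] have "isCont k 0"
      using a(1) by (simp add: continuous_on_eq_continuous_at)
    then have "(k \<longlongrightarrow> k 0) (at 0)" by (simp add: isCont_def)
    moreover have "(k \<longlongrightarrow> 0) (at 0)"
    proof (rule tendsto_eventually)
      show "eventually (\<lambda>x. k x = 0) (at 0)"
        unfolding eventually_at using a(1) eq[OF _ _ y] by (intro exI[of _ a]) (auto simp: k_def)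
    qed
    ultimately have "k 0 = 0" using tendsto_unique[of "at (0::complex)"] by fastforce
    then show ?thesis by (simp add: True k_def)
  qed (use eq[OF x _ y] in simp)
  show ?thesis
  proof (rule that[of "min a \<epsilon>" q])
    show "hol2 (ball 0 (min a \<epsilon>)) (ball 0 (min a \<epsilon>)) q" by (rule hol2_subset[OF hq]) auto
  qed (use a \<epsilon> eq' in auto)
qed

text \<open>Lagrange interpolation at the conjugate roots \<open>\<phi> (\<omega> t)\<close>.\<close>

lemma conductor:
  assumes b: "b holomorphic_on ball 0 r" and r: "0 < r" "r \<le> \<rho>"
  obtains G where "hol2 (ball 0 (r ^ p)) UNIV G"
    "\<And>t. norm t < r \<Longrightarrow> G (t ^ p) (\<phi> t) = b t * (\<Prod>\<omega>\<in>\<Omega>-{1}. \<phi> t - \<phi> (\<omega> * t))"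
proof -
  have hb: "(\<lambda>t. b (\<omega> * t)) holomorphic_on ball 0 r" if "\<omega> \<in> \<Omega>" for \<omega>
    using norm_\<Omega>[OF that] by (intro holomorphic_on_compose_gen[of "(*) \<omega>" _ b, unfolded comp_def, OF _ b])
      (auto intro!: holomorphic_intros)
  have h\<phi>: "(\<lambda>t. \<phi> (\<omega> * t)) holomorphic_on ball 0 r" if "\<omega> \<in> \<Omega>" for \<omega>
    by (rule holomorphic_on_subset[OF hol_\<phi>_\<omega>[OF that]]) (use r in auto)
  \<comment> \<open>The Lagrange basis polynomials are not divided by their values at the nodes, so
    the coefficients stay holomorphic at t = 0, where the nodes collide; the price is the product of
    differences in the conclusion.\<close>
  define Q where "Q = (\<lambda>t. \<Sum>\<omega>\<in>\<Omega>. [:b (\<omega> * t):] * (\<Prod>\<nu>\<in>\<Omega>-{\<omega>}. [:- \<phi> (\<nu> * t), 1:]))"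
  obtain G where G: "hol2 (ball 0 (r ^ p)) UNIV G" "\<And>t y. norm t < r \<Longrightarrow> G (t ^ p) y = poly (Q t) y"
  proof (rule hol2_invariant_poly[OF _ _ p r(1)])
    show "poly_hol (ball 0 r) Q" unfolding Q_def
      by (intro poly_hol_sum poly_hol_mult poly_hol_const poly_hol_prod poly_hol_linear hb h\<phi>) auto
    show "Polynomial.degree (Q t) \<le> p" for t
      unfolding Q_def
    proof (rule degree_sum_le[OF \<Omega>(1)])
      fix \<omega> assume "\<omega> \<in> \<Omega>"
      have "Polynomial.degree (\<Prod>\<nu>\<in>\<Omega>-{\<omega>}. [:- \<phi> (\<nu> * t), 1:]) \<le> card (\<Omega> - {\<omega>})"
        using degree_prod_sum_le[of "\<Omega> - {\<omega>}" "\<lambda>\<nu>. [:- \<phi> (\<nu> * t), 1:]"] \<Omega>(1) by simp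
      also have "\<dots> \<le> p" using \<Omega> by (metis card_Diff1_le)
      finally show "Polynomial.degree ([:b (\<omega> * t):] * (\<Prod>\<nu>\<in>\<Omega>-{\<omega>}. [:- \<phi> (\<nu> * t), 1:])) \<le> p"
        using degree_mult_le[of "[:b (\<omega> * t):]" "\<Prod>\<nu>\<in>\<Omega>-{\<omega>}. [:- \<phi> (\<nu> * t), 1:]"] by simp
    qed
    \<comment> \<open>Rotating t permutes the nodes and, with them, the summands.\<close>
    show "Q (\<omega> * t) = Q t" if "\<omega> ^ p = 1" for \<omega> t
    proof -
      have \<omega>: "\<omega> \<in> \<Omega>" using that by (simp add: \<Omega>_def)
      have nz: "\<omega> \<noteq> 0" using that p by (auto simp: power_0_left)
      have "Q (\<omega> * t) = (\<Sum>\<nu>\<in>\<Omega>. [:b ((\<nu> * \<omega>) * t):] * (\<Prod>\<kappa>\<in>\<Omega>-{\<nu> * \<omega>}. [:- \<phi> (\<kappa> * t), 1:]))"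
        unfolding Q_def
      proof (rule sum.cong[OF refl])
        fix \<nu> assume \<nu>: "\<nu> \<in> \<Omega>"
        have "bij_betw (\<lambda>\<nu>. \<nu> * \<omega>) (\<Omega> - {\<nu>}) (\<Omega> - {\<nu> * \<omega>})"
          using bij_\<Omega>[OF \<omega>] \<nu> by (intro bij_betw_DiffI) (auto simp: bij_betw_def)
        from prod.reindex_bij_betw[OF this, of "\<lambda>\<kappa>. [:- \<phi> (\<kappa> * t), 1:]"]
        show "[:b (\<nu> * (\<omega> * t)):] * (\<Prod>\<kappa>\<in>\<Omega>-{\<nu>}. [:- \<phi> (\<kappa> * (\<omega> * t)), 1:]) =
            [:b ((\<nu> * \<omega>) * t):] * (\<Prod>\<kappa>\<in>\<Omega>-{\<nu> * \<omega>}. [:- \<phi> (\<kappa> * t), 1:])"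
          by (simp add: mult.assoc)
      qed
      also have "\<dots> = Q t"
        unfolding Q_def by (rule sum.reindex_bij_betw[OF bij_\<Omega>[OF \<omega>]])
      finally show ?thesis .
    qed
  qed blast
  have "G (t ^ p) (\<phi> t) = b t * (\<Prod>\<omega>\<in>\<Omega>-{1}. \<phi> t - \<phi> (\<omega> * t))" if "norm t < r" for t
  proof -
    have "G (t ^ p) (\<phi> t) = (\<Sum>\<omega>\<in>\<Omega>. b (\<omega> * t) * (\<Prod>\<nu>\<in>\<Omega>-{\<omega>}. \<phi> t - \<phi> (\<nu> * t)))"
      by (simp add: G(2)[OF that] Q_def poly_sum poly_prod)
    also have "\<dots> = (\<Sum>\<omega>\<in>{1}. b (\<omega> * t) * (\<Prod>\<nu>\<in>\<Omega>-{\<omega>}. \<phi> t - \<phi> (\<nu> * t)))"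
    proof (rule sum.mono_neutral_right)
      \<comment> \<open>For \<omega> \<noteq> 1 the product contains the factor \<nu> = 1, which
        vanishes at \<phi> t.\<close>
      show "\<forall>\<omega>\<in>\<Omega> - {1}. b (\<omega> * t) * (\<Prod>\<nu>\<in>\<Omega> - {\<omega>}. \<phi> t - \<phi> (\<nu> * t)) = 0"
        using \<Omega> by (auto intro!: prod_zero bexI[of _ 1])
    qed (use \<Omega> in auto)
    finally show ?thesis by simp
  qed
  then show ?thesis using that G(1) by blast
qed

end

section \<open>Dimension of a quotient by counting orders\<close>

lemma ring_of_type_algebra_simps [simp]:
  "carrier (ring_of_type_algebra :: 'a::comm_ring_1 ring) = UNIV"
  "x \<otimes>\<^bsub>ring_of_type_algebra\<^esub> y = x * (y :: 'a)"
  "x \<oplus>\<^bsub>ring_of_type_algebra\<^esub> y = x + (y :: 'a)"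
  "\<one>\<^bsub>ring_of_type_algebra\<^esub> = (1 :: 'a)"
  "\<zero>\<^bsub>ring_of_type_algebra\<^esub> = (0 :: 'a)"
  by (simp_all add: ring_of_type_algebra_def)

lemma ring_of_type_algebra_a_inv [simp]:
  "\<ominus>\<^bsub>ring_of_type_algebra\<^esub> x = - (x :: 'a::comm_ring_1)"
proof -
  interpret ring "ring_of_type_algebra :: 'a ring" by (rule ring_from_type_algebra)
  show ?thesis by (rule minus_equality) auto
qed

lemma ring_of_type_algebra_minus [simp]:
  "x \<ominus>\<^bsub>ring_of_type_algebra\<^esub> y = x - (y :: 'a::comm_ring_1)"
  by (simp add: a_minus_def)

lemma genideal_pair:
  "Idl\<^bsub>(ring_of_type_algebra :: 'a::comm_ring_1 ring)\<^esub> {h, g} = {u * h + v * g | u v. True}" (is "Idl\<^bsub>?R\<^esub> _ = ?J")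
proof -
  interpret cring ?R by (rule cring_from_type_algebra)
  have "ideal ?J ?R"
  proof (rule idealI)
    show "ring ?R" by (rule ring_from_type_algebra)
    show "subgroup ?J (add_monoid ?R)"
    proof (rule add.subgroupI)
      show "?J \<noteq> {}" by blast
      show "\<ominus>\<^bsub>?R\<^esub> a \<in> ?J" if a: "a \<in> ?J" for a
      proof -
        obtain u v where "a = u * h + v * g" using a by blast
        then have "- a = (- u) * h + (- v) * g" by simp
        then show ?thesis unfolding ring_of_type_algebra_a_inv by blast
      qed
      show "a \<oplus>\<^bsub>?R\<^esub> b \<in> ?J" if a: "a \<in> ?J" "b \<in> ?J" for a b
      proof -
        obtain u v u' v' where "a = u * h + v * g" "b = u' * h + v' * g" using a by blast
        then have "a + b = (u + u') * h + (v + v') * g" by (simp add: algebra_simps)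
        then show ?thesis unfolding ring_of_type_algebra_simps by blast
      qed
    qed auto
    show l: "x \<otimes>\<^bsub>?R\<^esub> a \<in> ?J" if a: "a \<in> ?J" for a x
    proof -
      obtain u v where "a = u * h + v * g" using a by blast
      then have "x * a = (x * u) * h + (x * v) * g" by (simp add: algebra_simps)
      then show ?thesis unfolding ring_of_type_algebra_simps by blast
    qed
    show "a \<otimes>\<^bsub>?R\<^esub> x \<in> ?J" if "a \<in> ?J" for a x
      using l[OF that, of x] unfolding ring_of_type_algebra_simps by (simp only: mult.commute)
  qed
  moreover have "h = 1 * h + 0 * g" "g = 0 * h + 1 * g" by simp_all
  then have "{h, g} \<subseteq> ?J" by blast
  ultimately have "Idl\<^bsub>?R\<^esub> {h, g} \<subseteq> ?J" by (rule genideal_minimal)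
  moreover have "?J \<subseteq> Idl\<^bsub>?R\<^esub> {h, g}"
  proof -
    have I: "ideal (Idl\<^bsub>?R\<^esub> {h, g}) ?R" by (rule genideal_ideal) simp
    have "{h, g} \<subseteq> Idl\<^bsub>?R\<^esub> {h, g}" by (rule genideal_self) simp
    then have "u * h \<in> Idl\<^bsub>?R\<^esub> {h, g}" "v * g \<in> Idl\<^bsub>?R\<^esub> {h, g}" for u v
      using ideal.I_l_closed[OF I, of h u] ideal.I_l_closed[OF I, of g v] by auto
    then show ?thesis
      using additive_subgroup.a_closed[OF ideal.axioms(1)[OF I]] by auto
  qed
  ultimately show ?thesis by blast
qed

text \<open>The algebra of pulling germs back to a branch: \<theta> is the pullback, \<iota> embeds
  the constants, and every order from c on occurs in the image. In \<open>divide\<close>, an order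
  exceeding that of b by at least c forces divisibility by b within the image.\<close>

locale fps_valuation =
  fixes \<theta> :: "'a::comm_ring_1 \<Rightarrow> complex fps" and \<iota> :: "complex \<Rightarrow> 'a" and h :: 'a and c :: nat
  assumes \<theta>_add: "\<And>a b. \<theta> (a + b) = \<theta> a + \<theta> b" and \<theta>_mult: "\<And>a b. \<theta> (a * b) = \<theta> a * \<theta> b"
    and \<theta>_\<iota>: "\<And>k. \<theta> (\<iota> k) = fps_const k"
    and \<iota>_add: "\<And>k l. \<iota> (k + l) = \<iota> k + \<iota> l" and \<iota>_mult: "\<And>k l. \<iota> (k * l) = \<iota> k * \<iota> l" and \<iota>_1: "\<iota> 1 = 1"
    and ker: "\<And>a. \<theta> a = 0 \<longleftrightarrow> h dvd a"
    and divide: "\<And>a b. \<theta> b \<noteq> 0 \<Longrightarrow> \<theta> a \<noteq> 0 \<Longrightarrow> subdegree (\<theta> b) + c \<le> subdegree (\<theta> a) \<Longrightarrow> \<exists>d. \<theta> a = \<theta> b * \<theta> d"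
    and cofinite: "\<And>k. c \<le> k \<Longrightarrow> \<exists>a. \<theta> a \<noteq> 0 \<and> subdegree (\<theta> a) = k"
begin

lemma \<theta>_uminus: "\<theta> (- a) = - \<theta> a"
proof -
  have "\<theta> (0 + 0) = \<theta> 0 + \<theta> 0" by (rule \<theta>_add)
  then have "\<theta> 0 = 0" by simp
  then have "\<theta> a + \<theta> (- a) = 0" using \<theta>_add[of a "- a"] by simp
  then show ?thesis by (simp add: add_eq_0_iff)
qed

lemma \<theta>_diff: "\<theta> (a - b) = \<theta> a - \<theta> b"
  using \<theta>_add[of a "- b"] by (simp add: \<theta>_uminus)

text \<open>The zero series has \<open>subdegree\<close> 0, so orders are expressed by vanishing
  coefficients: an element of the kernel satisfies every \<open>ge k\<close> and no
  \<open>exact k\<close>.\<close>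

definition ge :: "nat \<Rightarrow> 'a \<Rightarrow> bool" where "ge k a \<longleftrightarrow> (\<forall>i<k. fps_nth (\<theta> a) i = 0)"

definition exact :: "nat \<Rightarrow> 'a \<Rightarrow> bool" where "exact k a \<longleftrightarrow> ge k a \<and> fps_nth (\<theta> a) k \<noteq> 0"

lemma ge_0: "ge 0 a" by (simp add: ge_def)

lemma ge_Suc: "ge (Suc k) a \<longleftrightarrow> ge k a \<and> \<not> exact k a"
  by (auto simp: ge_def exact_def less_Suc_eq)

lemma ge_add: "ge k a \<Longrightarrow> ge k b \<Longrightarrow> ge k (a + b)" by (simp add: ge_def \<theta>_add)

lemma ge_\<iota>: "ge k a \<Longrightarrow> ge k (\<iota> x * a)" by (simp add: ge_def \<theta>_mult \<theta>_\<iota>)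

lemma exact_iff: "exact k a \<longleftrightarrow> \<theta> a \<noteq> 0 \<and> subdegree (\<theta> a) = k"
  unfolding exact_def ge_def
proof
  assume A: "(\<forall>i<k. fps_nth (\<theta> a) i = 0) \<and> fps_nth (\<theta> a) k \<noteq> 0"
  then have "subdegree (\<theta> a) = k" by (intro subdegreeI) blast+
  moreover have "\<theta> a \<noteq> 0"
  proof
    assume "\<theta> a = 0"
    with A show False by (simp only: fps_zero_nth) simp
  qed
  ultimately show "\<theta> a \<noteq> 0 \<and> subdegree (\<theta> a) = k" by blast
next
  assume A: "\<theta> a \<noteq> 0 \<and> subdegree (\<theta> a) = k"
  then have "fps_nth (\<theta> a) k \<noteq> 0" using nth_subdegree_nonzero by blast
  moreover have "fps_nth (\<theta> a) i = 0" if "i < k" for i using A that nth_less_subdegree_zero by blast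
  ultimately show "(\<forall>i<k. fps_nth (\<theta> a) i = 0) \<and> fps_nth (\<theta> a) k \<noteq> 0" by blast
qed

lemma exact_mult: "exact k a \<Longrightarrow> exact l b \<Longrightarrow> exact (k + l) (a * b)"
  by (simp add: exact_iff \<theta>_mult)

text \<open>The coefficient of order k is one complex number, so a constant multiple of b cancels
  that of a; hence each step of the filtration by orders has dimension at most one.\<close>

lemma reduce:
  assumes "exact k b" "ge k a"
  obtains x where "ge (Suc k) (a - \<iota> x * b)"
proof
  show "ge (Suc k) (a - \<iota> (fps_nth (\<theta> a) k / fps_nth (\<theta> b) k) * b)"
    using assms by (auto simp: ge_def exact_def \<theta>_diff \<theta>_mult \<theta>_\<iota> less_Suc_eq)
qed

section \<open>The quotient by h and g, filtered by orders\<close>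

abbreviation R :: "'a ring" where "R \<equiv> ring_of_type_algebra"

context
  fixes g :: 'a
  assumes g0: "fps_nth (\<theta> g) 0 = 0"
begin

definition I :: "'a set" where "I = Idl\<^bsub>R\<^esub> {h, g}"

definition Q :: "'a set ring" where "Q = R Quot I"

definition \<pi> :: "'a \<Rightarrow> 'a set" where "\<pi> a = I +>\<^bsub>R\<^esub> a"

definition K :: "'a set set" where "K = range (\<lambda>k. \<pi> (\<iota> k))"

lemma I_eq: "I = {u * h + v * g | u v. True}"
  unfolding I_def by (rule genideal_pair)

lemma ideal_I: "ideal I R"
proof -
  interpret cring R by (rule cring_from_type_algebra)
  show ?thesis unfolding I_def by (rule genideal_ideal) simp
qed

lemma \<theta>_I: "a \<in> I \<Longrightarrow> \<exists>v. \<theta> a = \<theta> v * \<theta> g"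
proof -
  assume "a \<in> I"
  then obtain u v where a: "a = u * h + v * g" by (auto simp: I_eq)
  have "\<theta> (u * h) = 0" using ker[of "u * h"] by simp
  then show ?thesis using a by (auto simp: \<theta>_add \<theta>_mult)
qed

text \<open>The kernel of \<theta> consists of the multiples of h and lies in \<open>I\<close>, so
  membership in \<open>I\<close> is decided by the pulled back series alone.\<close>

lemma I_if_\<theta>: "\<theta> a = \<theta> v * \<theta> g \<Longrightarrow> a \<in> I"
proof -
  assume "\<theta> a = \<theta> v * \<theta> g"
  then have "\<theta> (a - v * g) = 0" by (simp add: \<theta>_diff \<theta>_mult)
  then obtain u where "a - v * g = h * u" using ker by (auto simp: dvd_def)
  then have "a = u * h + v * g" by (simp add: algebra_simps)
  then show ?thesis by (auto simp: I_eq)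
qed

lemma ring_hom_\<pi>: "ring_hom_ring R Q \<pi>"
  unfolding Q_def \<pi>_def by (rule ideal.rcos_ring_hom_ring[OF ideal_I])

lemma ring_Q: "ring Q" by (rule ring_hom_ring.axioms(2)[OF ring_hom_\<pi>])

lemma \<pi>_hom [simp]: "\<pi> a \<oplus>\<^bsub>Q\<^esub> \<pi> b = \<pi> (a + b)" "\<pi> a \<otimes>\<^bsub>Q\<^esub> \<pi> b = \<pi> (a * b)" "\<one>\<^bsub>Q\<^esub> = \<pi> 1" "\<zero>\<^bsub>Q\<^esub> = \<pi> 0"
proof -
  interpret \<pi>: ring_hom_ring R Q \<pi> by (rule ring_hom_\<pi>)
  have "\<pi> (a \<oplus>\<^bsub>R\<^esub> b) = \<pi> a \<oplus>\<^bsub>Q\<^esub> \<pi> b" by (rule \<pi>.hom_add) simp_all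
  then show "\<pi> a \<oplus>\<^bsub>Q\<^esub> \<pi> b = \<pi> (a + b)" by (simp only: ring_of_type_algebra_simps)
  have "\<pi> (a \<otimes>\<^bsub>R\<^esub> b) = \<pi> a \<otimes>\<^bsub>Q\<^esub> \<pi> b" by (rule \<pi>.hom_mult) simp_all
  then show "\<pi> a \<otimes>\<^bsub>Q\<^esub> \<pi> b = \<pi> (a * b)" by (simp only: ring_of_type_algebra_simps)
  show "\<one>\<^bsub>Q\<^esub> = \<pi> 1" using \<pi>.hom_one by (simp only: ring_of_type_algebra_simps)
  show "\<zero>\<^bsub>Q\<^esub> = \<pi> 0" using \<pi>.hom_zero by (simp only: ring_of_type_algebra_simps)
qed

lemma carrier_Q: "carrier Q = range \<pi>"
  by (auto simp: Q_def FactRing_def A_RCOSETS_def' \<pi>_def)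

lemma \<pi>_eq_iff: "\<pi> a = \<pi> b \<longleftrightarrow> a - b \<in> I"
proof -
  interpret ring R by (rule ring_from_type_algebra)
  show ?thesis using quotient_eq_iff_same_a_r_cos[OF ideal_I, of a b] by (simp add: \<pi>_def)
qed

text \<open>The image of a field is a field unless the quotient is zero. Since \<theta> g has no
  constant term, neither has the pullback of any element of \<open>I\<close>, so 1 is not in
  \<open>I\<close>.\<close>

lemma subfield_K: "subfield K Q"
proof -
  have hom: "ring_hom_ring (ring_of_type_algebra :: complex ring) Q (\<lambda>k. \<pi> (\<iota> k))"
  proof (intro ring_hom_ringI2 ring_from_type_algebra ring_Q ring_hom_memI)
    show "\<pi> (\<iota> \<one>\<^bsub>ring_of_type_algebra\<^esub>) = \<one>\<^bsub>Q\<^esub>" by (simp add: \<iota>_1)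
  qed (auto simp: carrier_Q \<iota>_add \<iota>_mult)
  have "subfield (carrier (ring_of_type_algebra :: complex ring)) (ring_of_type_algebra :: complex ring)"
    by (rule field.carrier_is_subfield) (rule field_from_type_algebra)
  moreover have "\<one>\<^bsub>Q\<^esub> \<noteq> \<zero>\<^bsub>Q\<^esub>"
  proof
    assume "\<one>\<^bsub>Q\<^esub> = \<zero>\<^bsub>Q\<^esub>"
    then have "1 \<in> I" by (simp add: \<pi>_eq_iff)
    then obtain v where "\<theta> 1 = \<theta> v * \<theta> g" using \<theta>_I by blast
    moreover have "\<theta> 1 = 1" using \<theta>_\<iota>[of 1] by (simp add: \<iota>_1)
    ultimately have "fps_nth (\<theta> v * \<theta> g) 0 = 1" by simp
    then show False using g0 by simp
  qed
  ultimately show ?thesis using ring_hom_ring.img_is_subfield(2)[OF hom] by (simp add: K_def)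
qed

text \<open>A descending filtration of the quotient, equal to all of it at k = 0 and, when \<theta>
  g is nonzero, to zero for large k.\<close>

definition V :: "nat \<Rightarrow> 'a set set" where "V k = \<pi> ` {a. ge k a}"

lemma V_0: "V 0 = carrier Q" by (simp add: V_def ge_0 carrier_Q)

lemma V_mono: "V (Suc k) \<subseteq> V k" by (auto simp: V_def ge_Suc)

text \<open>By \<open>reduce\<close>, subtracting a constant multiple of \<open>a\<close> pushes any
  class of \<open>V k\<close> into the next step.\<close>

lemma line_extension_V:
  assumes a: "exact k a"
  shows "ring.line_extension Q K (\<pi> a) (V (Suc k)) = V k"
proof -
  interpret Q: ring Q by (rule ring_Q)
  show ?thesis
  proof (intro equalityI subsetI)
    fix u assume "u \<in> Q.line_extension K (\<pi> a) (V (Suc k))"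
    then obtain x b where "ge (Suc k) b" "u = \<pi> (\<iota> x * a + b)"
      by (auto simp: Q.line_extension_mem_iff K_def V_def)
    then show "u \<in> V k" using a by (auto simp: V_def ge_Suc exact_def intro!: ge_add ge_\<iota>)
  next
    fix u assume "u \<in> V k"
    then obtain b where b: "ge k b" "u = \<pi> b" by (auto simp: V_def)
    obtain x where x: "ge (Suc k) (b - \<iota> x * a)" using reduce[OF a b(1)] .
    have "u = \<pi> (\<iota> x) \<otimes>\<^bsub>Q\<^esub> \<pi> a \<oplus>\<^bsub>Q\<^esub> \<pi> (b - \<iota> x * a)" by (simp add: b(2))
    then show "u \<in> Q.line_extension K (\<pi> a) (V (Suc k))"
      using x unfolding Q.line_extension_mem_iff K_def V_def by blast
  qed
qed

text \<open>Changing \<open>a\<close> by an element of higher order preserves the order k, so if the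
  class of \<open>a\<close> lay in the next step, \<open>I\<close> would contain an element of order
  k.\<close>

lemma notin_V_Suc:
  assumes a: "exact k a" and k: "\<And>i. i \<in> I \<Longrightarrow> \<not> exact k i"
  shows "\<pi> a \<notin> V (Suc k)"
proof
  assume "\<pi> a \<in> V (Suc k)"
  then obtain b where b: "ge (Suc k) b" "a - b \<in> I" by (auto simp: V_def \<pi>_eq_iff)
  have "exact k (a - b)" using a b(1) by (auto simp: exact_def ge_def \<theta>_diff)
  with k[OF b(2)] show False by blast
qed

text \<open>All of \<open>I\<close> lies in the kernel and has no orders. Elements of different
  orders, which exist from c on, then give arbitrarily many independent classes; the list is built
  from high orders downwards, so that each new element lies outside the span of those chosen
  before.\<close>

lemma no_dimension:
  assumes "\<theta> g = 0"
  shows "\<not> ring.dimension Q n K (carrier Q)"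
proof
  interpret Q: ring Q by (rule ring_Q)
  assume dim: "Q.dimension n K (carrier Q)"
  have I: "\<not> exact k i" if "i \<in> I" for k i
    using \<theta>_I[OF that] assms by (auto simp: exact_iff)
  have "\<exists>Us. length Us = m \<and> Q.independent K Us \<and> Q.Span K Us \<subseteq> V k" if "c \<le> k" for m k
    using that
  proof (induction m arbitrary: k)
    case 0
    have "\<pi> 0 \<in> V k" unfolding V_def using ker[of 0] by (intro imageI) (simp add: ge_def)
    then show ?case by (intro exI[of _ "[]"]) auto
  next
    case (Suc m)
    then obtain Us where Us: "length Us = m" "Q.independent K Us" "Q.Span K Us \<subseteq> V (Suc k)"
      using le_SucI by blast
    obtain a where a: "exact k a" using cofinite[OF Suc.prems] by (auto simp: exact_iff)
    have "\<pi> a \<notin> Q.Span K Us" using notin_V_Suc[OF a I] Us(3) by blast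
    then have "Q.independent K (\<pi> a # Us)" using Us(2) by (intro Q.li_Cons) (auto simp: carrier_Q)
    moreover have "Q.Span K (\<pi> a # Us) \<subseteq> V k"
    proof -
      have "Q.Span K (\<pi> a # Us) = Q.line_extension K (\<pi> a) (Q.Span K Us)" by simp
      also have "\<dots> \<subseteq> Q.line_extension K (\<pi> a) (V (Suc k))"
        using Us(3) unfolding Q.line_extension_mem_iff subset_iff by blast
      finally show ?thesis using line_extension_V[OF a] by simp
    qed
    ultimately show ?case using Us(1) by (intro exI[of _ "\<pi> a # Us"]) auto
  qed
  from this[OF order_refl, of "Suc n"]
  obtain Us where Us: "length Us = Suc n" "Q.independent K Us" by blast
  have "length Us \<le> n"
    using Q.independent_length_le_dimension[OF subfield_K dim Us(2) Q.independent_in_carrier[OF Us(2)]] .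
  with Us(1) show False by simp
qed

text \<open>Let \<open>S\<close> be the set of orders of elements; since \<open>S\<close> is cofinite and the orders in the ideal \<open>I\<close> form
  \<open>S + M\<close> with \<open>M = ord g\<close>, exactly \<open>M\<close> orders are missing from \<open>I\<close>, and each contributes one dimension.\<close>

lemma dimension_subdegree:
  assumes g: "\<theta> g \<noteq> 0"
  shows "ring.dimension Q (subdegree (\<theta> g)) K (carrier Q)"
proof -
  interpret Q: ring Q by (rule ring_Q)
  define M where "M = subdegree (\<theta> g)"
  define S where "S = {k. \<exists>a. exact k a}"
  define S' where "S' = {k. \<exists>i\<in>I. exact k i}"
  \<comment> \<open>From this order on, \<open>divide\<close> makes every element a multiple of g
    modulo the kernel, so the filtration ends here.\<close>
  define N where "N = c + M"
  have gM: "exact M g" using g by (simp add: exact_iff M_def)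
  have S': "S' = (\<lambda>k. k + M) ` S"
  proof (intro equalityI subsetI)
    fix k assume "k \<in> S'"
    then obtain i where i: "i \<in> I" "exact k i" by (auto simp: S'_def)
    then obtain v where v: "\<theta> i = \<theta> v * \<theta> g" using \<theta>_I by blast
    then have "\<theta> v \<noteq> 0" "k = subdegree (\<theta> v) + M" using i(2) g by (auto simp: exact_iff M_def)
    then show "k \<in> (\<lambda>k. k + M) ` S" by (auto simp: S_def exact_iff)
  next
    fix k assume "k \<in> (\<lambda>k. k + M) ` S"
    then obtain l a where a: "exact l a" "k = l + M" by (auto simp: S_def)
    have "a * g \<in> I" by (rule I_if_\<theta>[of _ a]) (simp add: \<theta>_mult)
    then show "k \<in> S'" using exact_mult[OF a(1) gM] a(2) by (auto simp: S'_def)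
  qed
  have S'S: "S' \<subseteq> S" by (auto simp: S'_def S_def)
  have cS: "{c..} \<subseteq> S" using cofinite by (auto simp: S_def exact_iff)
  have VN: "V N = {\<zero>\<^bsub>Q\<^esub>}"
  proof -
    have "a \<in> I" if a: "ge N a" for a
    proof (cases "\<theta> a = 0")
      case True
      then show ?thesis using I_if_\<theta>[of a 0] ker[of 0] by simp
    next
      case False
      then have "N \<le> subdegree (\<theta> a)" using a by (intro subdegree_geI) (auto simp: ge_def)
      then obtain d where "\<theta> a = \<theta> g * \<theta> d" using divide[OF g False] by (auto simp: N_def M_def add.commute)
      then show ?thesis using I_if_\<theta>[of a d] by (simp add: mult.commute)
    qed
    then have "\<pi> a = \<pi> 0" if "ge N a" for a using that by (simp add: \<pi>_eq_iff)
    moreover have "ge N 0" using ker[of 0] by (simp add: ge_def)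
    ultimately have "\<pi> ` {a. ge N a} = {\<pi> 0}" by blast
    then show ?thesis by (simp only: V_def \<pi>_hom(4))
  qed
  \<comment> \<open>Going down from N, the dimension grows by one at each order that occurs in the
    ring but not in the ideal.\<close>
  have dim: "Q.dimension (card ((S - S') \<inter> {k..<N})) K (V k)" if "k \<le> N" for k
    using that
  proof (induction k rule: inc_induct)
    case base
    have "(S - S') \<inter> {N..<N} = {}" by simp
    then show ?case unfolding VN by (simp only: card.empty Q.zero_dim)
  next
    case (step k)
    have ivl: "{k..<N} = insert k {Suc k..<N}" using step.hyps by auto
    show ?case
    proof (cases "k \<in> S - S'")
      case True
      then obtain a where a: "exact k a" by (auto simp: S_def)
      have "\<pi> a \<notin> V (Suc k)" using True by (intro notin_V_Suc[OF a]) (auto simp: S'_def)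
      from Q.Suc_dim[OF _ this step.IH]
      have "Q.dimension (Suc (card ((S - S') \<inter> {Suc k..<N}))) K (V k)"
        by (simp add: line_extension_V[OF a] carrier_Q)
      moreover have "card ((S - S') \<inter> {k..<N}) = Suc (card ((S - S') \<inter> {Suc k..<N}))"
        using True by (simp add: ivl)
      ultimately show ?thesis by simp
    next
      case False
      \<comment> \<open>Either order k does not occur at all, or it occurs in \<open>I\<close>; then
        subtracting a multiple of that element of \<open>I\<close> raises the order without changing
        the class.\<close>
      have "V k \<subseteq> V (Suc k)"
      proof
        fix u assume "u \<in> V k"
        then obtain b where b: "ge k b" "u = \<pi> b" by (auto simp: V_def)
        show "u \<in> V (Suc k)"
        proof (cases "exact k b")
          case True
          then obtain i where i: "i \<in> I" "exact k i" using False by (auto simp: S_def S'_def)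
          obtain x where x: "ge (Suc k) (b - \<iota> x * i)" using reduce[OF i(2) b(1)] .
          have "\<iota> x * i \<in> I" using ideal.I_l_closed[OF ideal_I i(1), of "\<iota> x"] by simp
          then have "u = \<pi> (b - \<iota> x * i)" by (simp add: b(2) \<pi>_eq_iff)
          then show ?thesis using x by (auto simp: V_def)
        next
          case False
          then show ?thesis using b by (auto simp: V_def ge_Suc)
        qed
      qed
      then have "V k = V (Suc k)" using V_mono[of k] by blast
      moreover have "(S - S') \<inter> {k..<N} = (S - S') \<inter> {Suc k..<N}" using False by (auto simp: ivl)
      ultimately show ?thesis using step.IH by simp
    qed
  qed
  \<comment> \<open>S contains all orders from c on, so it has M more of them below N than below c.
    S' is S shifted by M, so below N it has as many as S has below c. The difference is M.\<close>
  have "card ((S - S') \<inter> {0..<N}) = M"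
  proof -
    have S'N: "S' \<inter> {0..<N} = (\<lambda>k. k + M) ` (S \<inter> {0..<c})" by (auto simp: S' N_def)
    have SN: "S \<inter> {0..<N} = (S \<inter> {0..<c}) \<union> {c..<N}" using cS by (auto simp: N_def)
    have "card (S \<inter> {0..<N}) = card (S \<inter> {0..<c}) + M"
      unfolding SN by (subst card_Un_disjoint) (auto simp: N_def)
    moreover have "card (S' \<inter> {0..<N}) = card (S \<inter> {0..<c})"
      unfolding S'N by (intro card_image) (auto simp: inj_on_def)
    moreover have "(S - S') \<inter> {0..<N} = (S \<inter> {0..<N}) - (S' \<inter> {0..<N})" by auto
    moreover have "card ((S \<inter> {0..<N}) - (S' \<inter> {0..<N})) = card (S \<inter> {0..<N}) - card (S' \<inter> {0..<N})"
      using S'S by (intro card_Diff_subset) auto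
    ultimately show ?thesis by simp
  qed
  with dim[of 0] show ?thesis by (simp add: V_0 M_def)
qed

lemma Inf_dimension:
  "Inf {enat n | n. ring.dimension Q n K (carrier Q)} = (if \<theta> g = 0 then \<infinity> else enat (subdegree (\<theta> g)))"
proof (cases "\<theta> g = 0")
  case True
  then have "{enat n | n. ring.dimension Q n K (carrier Q)} = {}" using no_dimension by auto
  then show ?thesis using True by (simp add: Inf_enat_def)
next
  case False
  interpret Q: ring Q by (rule ring_Q)
  have "{enat n | n. Q.dimension n K (carrier Q)} = {enat (subdegree (\<theta> g))}"
    using dimension_subdegree[OF False] Q.dimension_is_inj[OF subfield_K] by auto
  then show ?thesis using False by simp
qed

end

end

section \<open>Shears and divisibility of germs\<close>

lemma complex_differentiable_at_if_near_0:
  assumes "holomorphic2_near_0 f"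
  obtains e where "e > 0" "\<And>z. norm z < e \<Longrightarrow> complex_differentiable_at f z"
proof -
  obtain V where V: "open V" "0 \<in> V" "holomorphic2_on f V" using assms unfolding holomorphic2_near_0_def by blast
  then obtain e where "e > 0" "ball 0 e \<subseteq> V" by (meson openE)
  then have "complex_differentiable_at f z" if "norm z < e" for z
    using V(3) that unfolding holomorphic2_on_def by (metis dist_0_norm mem_ball subsetD)
  then show ?thesis using that[of e] \<open>e > 0\<close> by blast
qed

lemma holomorphic_on_curve:
  assumes f: "holomorphic2_near_0 f" and ab: "a holomorphic_on ball 0 r" "b holomorphic_on ball 0 r" "r > 0" "a 0 = 0" "b 0 = 0"
  shows "\<exists>s>0. s \<le> r \<and> (\<lambda>t. f (vec2 (a t) (b t))) holomorphic_on ball 0 s"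
proof -
  obtain e where e: "e > 0" "\<And>z. norm z < e \<Longrightarrow> complex_differentiable_at f z"
    using complex_differentiable_at_if_near_0[OF f] by blast
  have "isCont a 0" "isCont b 0"
    using ab holomorphic_on_imp_continuous_on[OF ab(1)] holomorphic_on_imp_continuous_on[OF ab(2)]
    by (auto simp: continuous_on_eq_continuous_at)
  then have "((\<lambda>t. vec2 (a t) (b t)) \<longlongrightarrow> vec2 (a 0) (b 0)) (nhds 0)"
    by (intro tendsto_vec2) (auto simp: continuous_at tendsto_at_iff_tendsto_nhds)
  then have "eventually (\<lambda>t. norm (vec2 (a t) (b t)) < e) (nhds 0)"
    using e(1) ab(4,5) by (intro order_tendstoD(2)[OF tendsto_norm]) auto
  then obtain s where s: "s > 0" "\<And>t. norm t < s \<Longrightarrow> norm (vec2 (a t) (b t)) < e"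
    by (auto simp: eventually_nhds_metric)
  have "(\<lambda>t. f (vec2 (a t) (b t))) holomorphic_on ball 0 (min s r)"
    unfolding holomorphic_on_def
  proof
    fix t :: complex assume t: "t \<in> ball 0 (min s r)"
    have "t \<in> ball 0 r" using t by simp
    then have "(a has_field_derivative deriv a t) (at t)" "(b has_field_derivative deriv b t) (at t)"
      using ab by (auto intro: holomorphic_derivI)
    from complex_differentiable_at_compose_curve[OF e(2)[OF s(2)] this] t
    show "(\<lambda>t. f (vec2 (a t) (b t))) field_differentiable (at t within ball 0 (min s r))"
      by (auto intro: field_differentiable_at_within)
  qed
  then show ?thesis using s(1) ab(3) by (intro exI[of _ "min s r"]) auto
qed

text \<open>f in coordinates whose line x = 0 points in the direction (a, 1) of the original ones;
  \<open>shear (- a)\<close> undoes the change.\<close>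

definition shear :: "complex \<Rightarrow> (complex^2 \<Rightarrow> complex) \<Rightarrow> complex^2 \<Rightarrow> complex" where
  "shear a f = (\<lambda>z. f (vec2 (z $ 1 + a * z $ 2) (z $ 2)))"

lemma shear_vec2: "shear a f (vec2 x y) = f (vec2 (x + a * y) y)"
  by (simp add: shear_def)

lemma shear_0 [simp]: "shear a f 0 = f 0"
  by (simp add: shear_def)

lemma continuous_on_shear_map: "continuous_on S (\<lambda>z::complex^2. vec2 (z $ 1 + a * z $ 2) (z $ 2))"
  by (intro continuous_intros)

lemma eventually_shear:
  assumes "eventually P (nhds 0)"
  shows "eventually (\<lambda>z::complex^2. P (vec2 (z $ 1 + a * z $ 2) (z $ 2))) (nhds 0)"
proof -
  have "isCont (\<lambda>z::complex^2. vec2 (z $ 1 + a * z $ 2) (z $ 2)) 0"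
    using continuous_on_shear_map[of UNIV a] by (simp add: continuous_on_eq_continuous_at)
  then have "filterlim (\<lambda>z::complex^2. vec2 (z $ 1 + a * z $ 2) (z $ 2)) (nhds 0) (nhds 0)"
    using tendsto_at_iff_tendsto_nhds[of "\<lambda>z::complex^2. vec2 (z $ 1 + a * z $ 2) (z $ 2)" 0]
    by (simp add: isCont_def)
  then show ?thesis using assms by (simp add: filterlim_iff)
qed

lemma holomorphic2_near_0_shear:
  assumes "holomorphic2_near_0 f"
  shows "holomorphic2_near_0 (shear a f)"
proof -
  obtain e where e: "e > 0" "\<And>z. norm z < e \<Longrightarrow> complex_differentiable_at f z"
    using complex_differentiable_at_if_near_0[OF assms] by blast
  define R where "R = e / (2 + norm a)"
  have "2 + norm a > 0" by (simp add: add_pos_nonneg)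
  then have R: "R > 0" "R * (2 + norm a) = e" using e by (auto simp: R_def)
  have d: "complex_differentiable_at f (vec2 (x + a * y) y)" if "x \<in> ball 0 R" "y \<in> ball 0 R" for x y
  proof (rule e(2))
    have "norm (vec2 (x + a * y) y) \<le> norm x + norm a * norm y + norm y"
      using norm_vec2_le[of "x + a * y" y] norm_triangle_ineq[of x "a * y"] by (simp add: norm_mult)
    also have "\<dots> < R + norm a * R + R"
      using that by (intro add_less_le_mono add_strict_mono add_less_le_mono mult_left_mono) auto
    also have "\<dots> = e" using R(2) by (simp add: algebra_simps)
    finally show "norm (vec2 (x + a * y) y) < e" .
  qed
  have "hol2 (ball 0 R) (ball 0 R) (\<lambda>x y. f (vec2 (x + a * y) y))"
    unfolding hol2_def
  proof (intro conjI ballI)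
    have "continuous_on (ball 0 e) f"
      using e(2) by (intro continuous_at_imp_continuous_on ballI complex_differentiable_at_imp_continuous) auto
    have "isCont (\<lambda>p. f (vec2 (fst p + a * snd p) (snd p))) p" if "p \<in> ball 0 R \<times> ball 0 R" for p
    proof (rule isCont_o2[of _ "\<lambda>p. vec2 (fst p + a * snd p) (snd p)"])
      have "continuous_on UNIV (\<lambda>p. vec2 (fst p + a * snd p) (snd p))" by (intro continuous_intros)
      then show "isCont (\<lambda>p. vec2 (fst p + a * snd p) (snd p)) p" by (cases p) (simp add: continuous_on_eq_continuous_at)
      show "isCont f (vec2 (fst p + a * snd p) (snd p))"
        using that by (intro complex_differentiable_at_imp_continuous d) auto
    qed
    then show "continuous_on (ball 0 R \<times> ball 0 R) (\<lambda>(x, y). f (vec2 (x + a * y) y))"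
      unfolding case_prod_unfold by (intro continuous_at_imp_continuous_on ballI)
  next
    fix y :: complex assume y: "y \<in> ball 0 R"
    show "(\<lambda>x. f (vec2 (x + a * y) y)) holomorphic_on ball 0 R"
      unfolding holomorphic_on_def
    proof
      fix x :: complex assume "x \<in> ball 0 R"
      have "((\<lambda>x. x + a * y) has_field_derivative 1) (at x)" "((\<lambda>x. y) has_field_derivative 0) (at x)"
        by (auto intro!: derivative_eq_intros)
      from complex_differentiable_at_compose_curve[OF d[OF \<open>x \<in> _\<close> y] this]
      show "(\<lambda>x. f (vec2 (x + a * y) y)) field_differentiable (at x within ball 0 R)"
        by (rule field_differentiable_at_within)
    qed
  next
    fix x :: complex assume x: "x \<in> ball 0 R"
    show "(\<lambda>y. f (vec2 (x + a * y) y)) holomorphic_on ball 0 R"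
      unfolding holomorphic_on_def
    proof
      fix y :: complex assume "y \<in> ball 0 R"
      have "((\<lambda>y. x + a * y) has_field_derivative a) (at y)" "((\<lambda>y. y) has_field_derivative 1) (at y)"
        by (auto intro!: derivative_eq_intros)
      from complex_differentiable_at_compose_curve[OF d[OF x \<open>y \<in> _\<close>] this]
      show "(\<lambda>y. f (vec2 (x + a * y) y)) field_differentiable (at y within ball 0 R)"
        by (rule field_differentiable_at_within)
    qed
  qed
  from holomorphic2_near_0_if_hol2[OF open_ball _ R(1) this] R(1) show ?thesis
    by (simp add: shear_def)
qed

section \<open>Divisibility and units of germs\<close>

lemma germ_dvd_iff:
  assumes h: "holomorphic2_near_0 h" and g: "holomorphic2_near_0 g"
  shows "germ_of h dvd germ_of g \<longleftrightarrow> (\<exists>k. holomorphic2_near_0 k \<and> (\<forall>\<^sub>F z in nhds 0. g z = h z * k z))"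
proof
  assume "germ_of h dvd germ_of g"
  then obtain K where K: "germ_of g = germ_of h * K" by (rule dvdE)
  obtain k where k: "holomorphic2_near_0 k" "K = germ_of k" by (rule germ_cases)
  then have "germ_of g = germ_of (\<lambda>z. h z * k z)" using K h by (simp add: germ_of_mult)
  then have "\<forall>\<^sub>F z in nhds 0. g z = h z * k z"
    by (subst (asm) germ_of_eq_iff) (use g h k holomorphic2_near_0_mult in auto)
  then show "\<exists>k. holomorphic2_near_0 k \<and> (\<forall>\<^sub>F z in nhds 0. g z = h z * k z)" using k by blast
next
  assume "\<exists>k. holomorphic2_near_0 k \<and> (\<forall>\<^sub>F z in nhds 0. g z = h z * k z)"
  then obtain k where k: "holomorphic2_near_0 k" "\<forall>\<^sub>F z in nhds 0. g z = h z * k z" by blast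
  then have "germ_of g = germ_of (\<lambda>z. h z * k z)"
    by (subst germ_of_eq_iff) (use g h holomorphic2_near_0_mult in auto)
  also have "\<dots> = germ_of h * germ_of k" using h k by (simp add: germ_of_mult)
  finally show "germ_of h dvd germ_of g" by simp
qed

lemma isCont_if_holomorphic2_near_0: "holomorphic2_near_0 f \<Longrightarrow> isCont f 0"
  using complex_differentiable_at_if_near_0[of f] complex_differentiable_at_imp_continuous[of f 0]
  by (metis norm_zero)

lemma holomorphic2_near_0_inverse:
  assumes f: "holomorphic2_near_0 f" and f0: "f 0 \<noteq> 0"
  shows "holomorphic2_near_0 (\<lambda>z. inverse (f z))"
proof -
  obtain R where R: "R > 0" "hol2 (ball 0 R) (ball 0 R) (\<lambda>x y. f (vec2 x y))"
    using hol2_if_holomorphic2_near_0[OF f] by blast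
  have "eventually (\<lambda>z. f z \<noteq> 0) (nhds 0)"
    using continuous_at_avoid[OF isCont_if_holomorphic2_near_0[OF f] f0]
    by (auto simp: eventually_nhds_metric dist_commute)
  then obtain r where r: "r > 0" "\<And>x y. norm x < r \<Longrightarrow> norm y < r \<Longrightarrow> f (vec2 x y) \<noteq> 0"
    unfolding eventually_nhds_0_vec2 by blast
  define s where "s = min r R"
  have s: "s > 0" using r R by (simp add: s_def)
  have "hol2 (ball 0 s) (ball 0 s) (\<lambda>x y. f (vec2 x y))"
    by (rule hol2_subset[OF R(2)]) (auto simp: s_def)
  moreover have "f (vec2 x y) \<noteq> 0" if "x \<in> ball 0 s" "y \<in> ball 0 s" for x y
    using r(2) that by (auto simp: s_def)
  ultimately have "hol2 (ball 0 s) (ball 0 s) (\<lambda>x y. inverse (f (vec2 x y)))"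
    unfolding hol2_def by (auto simp: case_prod_unfold intro!: continuous_intros holomorphic_on_inverse)
  from holomorphic2_near_0_if_hol2[OF open_ball _ s this] s show ?thesis by simp
qed

lemma germ_unit_iff:
  assumes g: "holomorphic2_near_0 g"
  shows "germ_of g dvd 1 \<longleftrightarrow> g 0 \<noteq> 0"
proof
  assume "germ_of g dvd 1"
  then obtain k where "\<forall>\<^sub>F z in nhds 0. 1 = g z * k z"
    using germ_dvd_iff[OF g holomorphic2_near_0_const[of 1]] by (auto simp: germ_of_1)
  from eventually_nhds_x_imp_x[OF this] show "g 0 \<noteq> 0" by auto
next
  assume g0: "g 0 \<noteq> 0"
  have "\<forall>\<^sub>F z in nhds 0. 1 = g z * inverse (g z)"
    using continuous_at_avoid[OF isCont_if_holomorphic2_near_0[OF g] g0]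
    by (auto simp: eventually_nhds_metric dist_commute)
  then show "germ_of g dvd 1"
    using germ_dvd_iff[OF g holomorphic2_near_0_const[of 1]] holomorphic2_near_0_inverse[OF g g0]
    by (auto simp: germ_of_1)
qed

text \<open>After division by \<open>y ^ n\<close> a positive constant would be bounded by a
  multiple of \<open>y ^ (m - n)\<close>, which tends to 0 if m > n. Used in both directions, it
  identifies two exponents.\<close>

lemma power_bounds_imp_eq:
  assumes "c > 0" "r > 0" and le: "\<And>y::real. 0 < y \<Longrightarrow> y < r \<Longrightarrow> c * y ^ n \<le> C * y ^ m"
  shows "m \<le> n"
proof (rule ccontr)
  assume "\<not> m \<le> n"
  then obtain d where d: "m = n + Suc d" using less_imp_Suc_add[of n m] by auto
  have "((\<lambda>y. C * y ^ Suc d) \<longlongrightarrow> C * 0 ^ Suc d) (at_right (0::real))"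
    by (intro tendsto_intros)
  moreover have "eventually (\<lambda>y. c \<le> C * y ^ Suc d) (at_right (0::real))"
    unfolding eventually_at_right_field
  proof (intro exI[of _ r] conjI allI impI)
    fix y :: real assume y: "0 < y" "y < r"
    have "c * y ^ n \<le> (C * y ^ Suc d) * y ^ n" using le[OF y] by (simp add: d power_add mult_ac)
    then show "c \<le> C * y ^ Suc d" using y by (meson mult_right_le_imp_le zero_less_power)
  qed (use assms in auto)
  ultimately have "c \<le> C * 0 ^ Suc d"
    by (intro tendsto_lowerbound[of _ _ "at_right (0::real)"]) auto
  with \<open>c > 0\<close> show False by simp
qed

section \<open>Intersection multiplicity along a branch\<close>

text \<open>A branch of the germ \<open>h\<close>, in the sheared coordinates \<open>(x + a y, y)\<close>.\<close>

locale germ_branch = branch p \<rho> \<phi> for p \<rho> \<phi> +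
  fixes h :: "complex^2 \<Rightarrow> complex" and a :: complex
  assumes h: "holomorphic2_near_0 h"
    and factor: "\<exists>u. holomorphic2_near_0 u \<and> u 0 \<noteq> 0 \<and> (\<forall>\<^sub>F z in nhds 0. shear a h z = u z * W (z $ 1) (z $ 2))"
begin

definition \<gamma> :: "complex \<Rightarrow> complex^2" where "\<gamma> t = vec2 (t ^ p + a * \<phi> t) (\<phi> t)"

lemma shear_\<gamma>: "shear a f (vec2 (t ^ p) (\<phi> t)) = f (\<gamma> t)"
  by (simp add: shear_vec2 \<gamma>_def)

lemma \<gamma>_0: "\<gamma> 0 = 0" using p \<phi>0 by (simp add: \<gamma>_def power_0_left)

lemma W_\<gamma>: "norm t < \<rho> \<Longrightarrow> W (t ^ p) (\<phi> t) = 0"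
  using W_power[of t "\<phi> t"] \<Omega> by (auto intro!: prod_zero bexI[of _ 1])

lemma eventually_curve:
  assumes "eventually P (nhds (0::complex^2))"
  shows "eventually (\<lambda>t. P (vec2 (t ^ p) (\<phi> t))) (nhds 0)"
proof -
  obtain r where r: "r > 0" "\<And>x y. norm x < r \<Longrightarrow> norm y < r \<Longrightarrow> P (vec2 x y)"
    using assms unfolding eventually_nhds_0_vec2 by blast
  obtain s where s: "s > 0" "\<And>t. norm t < s \<Longrightarrow> norm (\<phi> t) < r" using \<phi>_small[OF r(1)] by blast
  have "P (vec2 (t ^ p) (\<phi> t))" if "norm t < min s (min 1 r)" for t
  proof (rule r(2))
    have "norm t ^ p \<le> norm t ^ 1" using that p by (intro power_decreasing) auto
    then show "norm (t ^ p) < r" using that by (simp add: norm_power)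
  qed (use s(2) that in auto)
  moreover have "min s (min 1 r) > 0" using r s by simp
  ultimately show ?thesis unfolding eventually_nhds_metric by (metis dist_0_norm dist_commute)
qed

text \<open>Multiples of h vanish on the branch because \<open>W\<close> does. Conversely,
  \<open>quotient_by_W\<close> divides the sheared g by \<open>W\<close>; the unit between
  \<open>W\<close> and the sheared h is inverted and the shear undone.\<close>

lemma dvd_iff:
  assumes g: "holomorphic2_near_0 g"
  shows "germ_of h dvd germ_of g \<longleftrightarrow> (\<forall>\<^sub>F t in nhds 0. g (\<gamma> t) = 0)"
proof -
  obtain u where u: "holomorphic2_near_0 u" "u 0 \<noteq> 0" "\<forall>\<^sub>F z in nhds 0. shear a h z = u z * W (z $ 1) (z $ 2)"
    using factor by blast
  show ?thesis
  proof
    assume "germ_of h dvd germ_of g"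
    then obtain k where k: "\<forall>\<^sub>F z in nhds 0. g z = h z * k z" using germ_dvd_iff[OF h g] by blast
    have "\<forall>\<^sub>F t in nhds 0. norm t < \<rho>" using \<rho> by (auto simp: eventually_nhds_metric)
    with eventually_curve[OF u(3)] eventually_curve[OF eventually_shear[OF k, of a]]
    show "\<forall>\<^sub>F t in nhds 0. g (\<gamma> t) = 0"
    proof eventually_elim
      case (elim t)
      have "h (\<gamma> t) = 0" using elim(1) W_\<gamma>[OF elim(3)] by (simp add: shear_\<gamma>)
      then show ?case using elim(2) by (simp add: \<gamma>_def)
    qed
  next
    assume "\<forall>\<^sub>F t in nhds 0. g (\<gamma> t) = 0"
    then obtain d' where d': "d' > 0" "\<And>t. norm t < d' \<Longrightarrow> shear a g (vec2 (t ^ p) (\<phi> t)) = 0"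
      unfolding shear_\<gamma> by (auto simp: eventually_nhds_metric)
    obtain d where d: "d > 0" "hol2 (ball 0 d) (ball 0 d) (\<lambda>x y. shear a g (vec2 x y))"
      using hol2_if_holomorphic2_near_0[OF holomorphic2_near_0_shear[OF g]] by blast
    obtain e q where q: "e > 0" "hol2 (ball 0 e) (ball 0 e) q"
      "\<And>x y. norm x < e \<Longrightarrow> norm y < e \<Longrightarrow> shear a g (vec2 x y) = q x y * W x y"
      using quotient_by_W[OF d(2,1) d'] by blast
    define k where "k = (\<lambda>z::complex^2. q (z $ 1) (z $ 2) * inverse (u z))"
    have k: "holomorphic2_near_0 k" unfolding k_def
      by (intro holomorphic2_near_0_mult holomorphic2_near_0_inverse u(1,2) holomorphic2_near_0_if_hol2[OF open_ball _ q(1,2)])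
         (use q(1) in simp)
    have "\<forall>\<^sub>F z in nhds 0. shear a g z = q (z $ 1) (z $ 2) * W (z $ 1) (z $ 2)"
      unfolding eventually_nhds_0_vec2 using q(1,3) by auto
    moreover have "\<forall>\<^sub>F z in nhds 0. u z \<noteq> 0"
      using continuous_at_avoid[OF isCont_if_holomorphic2_near_0[OF u(1)] u(2)]
      by (auto simp: eventually_nhds_metric dist_commute)
    ultimately have "\<forall>\<^sub>F z in nhds 0. shear a g z = shear a h z * k z"
      using u(3) by eventually_elim (simp add: k_def)
    from eventually_shear[OF this, of "- a"]
    have "\<forall>\<^sub>F z in nhds 0. g z = h z * shear (- a) k z"
      by (simp add: shear_def)
    then show "germ_of h dvd germ_of g"
      using germ_dvd_iff[OF h g] holomorphic2_near_0_shear[OF k] by blast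
  qed
qed

lemma curve_has_fps_expansion:
  assumes g: "holomorphic2_near_0 g"
  shows "(\<lambda>t. g (\<gamma> t)) has_fps_expansion fps_expansion (\<lambda>t. g (\<gamma> t)) 0"
proof (rule analytic_at_imp_has_fps_expansion_0)
  have "(\<lambda>t. t ^ p + a * \<phi> t) holomorphic_on ball 0 \<rho>" by (intro holomorphic_intros hol_\<phi>)
  from holomorphic_on_curve[OF g this hol_\<phi> \<rho>] p \<phi>0
  obtain s where "s > 0" "(\<lambda>t. g (\<gamma> t)) holomorphic_on ball 0 s" by (auto simp: \<gamma>_def power_0_left)
  then show "(\<lambda>t. g (\<gamma> t)) analytic_on {0}" unfolding analytic_at by (intro exI[of _ "ball 0 s"]) auto
qed

text \<open>The pullback to the branch as a power series; by \<open>\<theta>_eqI\<close> the chosen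
  representative does not matter.\<close>

definition \<theta> :: "germ \<Rightarrow> complex fps" where
  "\<theta> A = fps_expansion (\<lambda>t. rep_germ A (\<gamma> t)) 0"

lemma eventually_\<gamma>: "eventually P (nhds 0) \<Longrightarrow> eventually (\<lambda>t. P (\<gamma> t)) (nhds 0)"
  using eventually_curve[OF eventually_shear[of P a]] by (simp add: \<gamma>_def)

lemma \<theta>_eqI:
  assumes g: "holomorphic2_near_0 g" and F: "(\<lambda>t. g (\<gamma> t)) has_fps_expansion F"
  shows "\<theta> (germ_of g) = F"
proof -
  let ?g = "rep_germ (germ_of g)"
  have g': "holomorphic2_near_0 ?g" "germ_of ?g = germ_of g"
    using Quotient3_rep_reflp[OF Quotient3_germ, of "germ_of g"] Quotient3_abs_rep[OF Quotient3_germ]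
    by (auto simp: germ_eq_def germ_of_def)
  then have "\<forall>\<^sub>F z in nhds 0. ?g z = g z" using germ_of_eq_iff[OF g'(1) g] by simp
  then have "\<forall>\<^sub>F t in nhds 0. ?g (\<gamma> t) = g (\<gamma> t)" by (rule eventually_\<gamma>)
  then have "(\<lambda>t. g (\<gamma> t)) has_fps_expansion fps_expansion (\<lambda>t. ?g (\<gamma> t)) 0"
    using curve_has_fps_expansion[OF g'(1)] has_fps_expansion_cong by fast
  then show ?thesis using F fps_expansion_unique_complex unfolding \<theta>_def by blast
qed

lemma \<theta>_expansion:
  "holomorphic2_near_0 g \<Longrightarrow> (\<lambda>t. g (\<gamma> t)) has_fps_expansion \<theta> (germ_of g)"
  using \<theta>_eqI curve_has_fps_expansion by metis

text \<open>For \<open>norm t < \<rho>\<close> this is the partial derivative of \<open>W\<close> in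
  y at the point (t ^ p, \<phi> t) of the branch: in the product rule only the summand that
  differentiates the factor of \<omega> = 1 survives.\<close>

definition D :: "complex \<Rightarrow> complex" where "D t = (\<Prod>\<omega>\<in>\<Omega>-{1}. \<phi> t - \<phi> (\<omega> * t))"

definition FD :: "complex fps" where "FD = fps_expansion D 0"

lemma FD: "D has_fps_expansion FD" "FD \<noteq> 0"
proof -
  have "D holomorphic_on ball 0 \<rho>" unfolding D_def by (intro holomorphic_intros hol_\<phi> hol_\<phi>_\<omega>) auto
  then have "D analytic_on {0}" unfolding analytic_at using \<rho> by (intro exI[of _ "ball 0 \<rho>"]) auto
  then show FD: "D has_fps_expansion FD" unfolding FD_def by (rule analytic_at_imp_has_fps_expansion_0)
  show "FD \<noteq> 0"
  proof
    assume "FD = 0"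
    then have "\<forall>\<^sub>F t in nhds 0. D t = 0" using FD by (simp add: has_fps_expansion_0_iff)
    then obtain d where d: "d > 0" "\<And>t. norm t < d \<Longrightarrow> D t = 0" by (auto simp: eventually_nhds_metric)
    define t where "t = complex_of_real (min d \<rho> / 2)"
    have t: "t \<noteq> 0" "norm t < d" "norm t < \<rho>" using d(1) \<rho> by (auto simp: t_def)
    have "\<phi> t \<noteq> \<phi> (\<omega> * t)" if "\<omega> \<in> \<Omega> - {1}" for \<omega>
      using inj_\<phi>[OF t(1,3), of 1 \<omega>] that by (auto simp: \<Omega>_def)
    then have "D t \<noteq> 0" using \<Omega>(1) by (auto simp: D_def prod_zero_iff)
    with d(2)[OF t(2)] show False by simp
  qed
qed

text \<open>Every multiple of \<open>FD\<close> by a convergent series is a pullback: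
  \<open>conductor\<close> supplies a function in sheared coordinates, and undoing the shear gives
  the germ.\<close>

lemma \<theta>_conductor:
  assumes f: "f has_fps_expansion F"
  shows "\<exists>A. \<theta> A = F * FD"
proof -
  obtain e where e: "e > 0" "f holomorphic_on ball 0 e"
    using has_fps_expansion_imp_analytic_0[OF f] by (auto simp: analytic_at_ball)
  define r where "r = min e \<rho>"
  have r: "0 < r" "r \<le> \<rho>" using e \<rho> by (auto simp: r_def)
  have "f holomorphic_on ball 0 r" by (rule holomorphic_on_subset[OF e(2)]) (auto simp: r_def)
  from conductor[OF this r] obtain G where G: "hol2 (ball 0 (r ^ p)) UNIV G"
    "\<And>t. norm t < r \<Longrightarrow> G (t ^ p) (\<phi> t) = f t * D t" unfolding D_def by blast
  define g where "g = shear (- a) (\<lambda>z. G (z $ 1) (z $ 2))"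
  have "holomorphic2_near_0 (\<lambda>z. G (z $ 1) (z $ 2))"
    by (rule holomorphic2_near_0_if_hol2[of "ball 0 (r ^ p)" 1]) (use hol2_subset[OF G(1)] r in auto)
  then have g: "holomorphic2_near_0 g" unfolding g_def by (rule holomorphic2_near_0_shear)
  have "g (\<gamma> t) = f t * D t" if "norm t < r" for t
    using G(2)[OF that] by (simp add: g_def shear_def \<gamma>_def)
  then have "\<forall>\<^sub>F t in nhds 0. f t * D t = g (\<gamma> t)"
    unfolding eventually_nhds_metric using r(1) by (intro exI[of _ r]) auto
  moreover have "(\<lambda>t. f t * D t) has_fps_expansion F * FD" by (intro has_fps_expansion_mult f FD)
  ultimately have "(\<lambda>t. g (\<gamma> t)) has_fps_expansion F * FD" using has_fps_expansion_cong by fast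
  then show ?thesis using \<theta>_eqI[OF g] by blast
qed

sublocale fps_valuation \<theta> "\<lambda>k. germ_of (\<lambda>_. k)" "germ_of h" "subdegree FD"
proof
  fix A B :: germ
  obtain f where f: "holomorphic2_near_0 f" "A = germ_of f" by (rule germ_cases)
  obtain g where g: "holomorphic2_near_0 g" "B = germ_of g" by (rule germ_cases)
  show "\<theta> (A + B) = \<theta> A + \<theta> B"
    unfolding f(2) g(2) germ_of_add[OF f(1) g(1)]
    by (intro \<theta>_eqI holomorphic2_near_0_add f(1) g(1) has_fps_expansion_add \<theta>_expansion)
  show "\<theta> (A * B) = \<theta> A * \<theta> B"
    unfolding f(2) g(2) germ_of_mult[OF f(1) g(1)]
    by (intro \<theta>_eqI holomorphic2_near_0_mult f(1) g(1) has_fps_expansion_mult \<theta>_expansion)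
  show "\<theta> A = 0 \<longleftrightarrow> germ_of h dvd A"
    unfolding f(2) dvd_iff[OF f(1)] has_fps_expansion_0_iff[symmetric]
    using \<theta>_expansion[OF f(1)] fps_expansion_unique_complex by metis
  show "\<exists>C. \<theta> A = \<theta> B * \<theta> C"
    if nz: "\<theta> B \<noteq> 0" "\<theta> A \<noteq> 0" and le: "subdegree (\<theta> B) + subdegree FD \<le> subdegree (\<theta> A)"
  proof -
    \<comment> \<open>The order condition makes \<open>\<theta> A / (\<theta> B * FD)\<close> a
      power series; as a quotient of convergent series it converges, so its product with
      \<open>FD\<close> is a pullback.\<close>
    have "subdegree (\<theta> B * FD) \<le> subdegree (\<theta> A)" using nz FD(2) le by simp
    then have dvd: "\<theta> B * FD dvd \<theta> A" using nz FD(2) by (subst fps_dvd_iff) auto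
    have "(\<lambda>t. g (\<gamma> t) * D t) has_fps_expansion \<theta> B * FD"
      unfolding g(2) by (intro has_fps_expansion_mult \<theta>_expansion g(1) FD(1))
    from has_fps_expansion_divide[OF \<theta>_expansion[OF f(1)] this _ _ refl] le nz FD(2)
    obtain q where "q has_fps_expansion \<theta> A / (\<theta> B * FD)" by (auto simp: f(2))
    from \<theta>_conductor[OF this] obtain C where "\<theta> C = \<theta> A / (\<theta> B * FD) * FD" by blast
    then have "\<theta> B * \<theta> C = \<theta> A / (\<theta> B * FD) * (\<theta> B * FD)" by (simp add: mult_ac)
    also have "\<dots> = \<theta> A" using dvd by (rule dvd_div_mult_self)
    finally show ?thesis by metis
  qed
next
  fix k assume "subdegree FD \<le> k"
  \<comment> \<open>A power of t times \<open>FD\<close> realizes any order from that of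
    \<open>FD\<close> on.\<close>
  have "(\<lambda>t::complex. t ^ (k - subdegree FD)) has_fps_expansion fps_X ^ (k - subdegree FD)"
    by (rule has_fps_expansion_fps_X_power)
  from \<theta>_conductor[OF this] obtain A where "\<theta> A = fps_X ^ (k - subdegree FD) * FD" by blast
  then show "\<exists>A. \<theta> A \<noteq> 0 \<and> subdegree (\<theta> A) = k"
    using \<open>subdegree FD \<le> k\<close> FD(2) by (intro exI[of _ A]) simp
next
  show "\<theta> (germ_of (\<lambda>_. k)) = fps_const k" for k
    by (intro \<theta>_eqI holomorphic2_near_0_const has_fps_expansion_const)
  show "germ_of (\<lambda>_. k + l) = germ_of (\<lambda>_. k) + germ_of (\<lambda>_. l)" for k l
    by (simp add: germ_of_add holomorphic2_near_0_const)
  show "germ_of (\<lambda>_. k * l) = germ_of (\<lambda>_. k) * germ_of (\<lambda>_. l)" for k l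
    by (simp add: germ_of_mult holomorphic2_near_0_const)
  show "germ_of (\<lambda>_. 1) = 1" by (simp add: germ_of_1)
qed

lemma intersection_mult_eq:
  assumes g: "holomorphic2_near_0 g" and g0: "g 0 = 0"
  shows "intersection_mult h g = (if \<theta> (germ_of g) = 0 then \<infinity> else enat (subdegree (\<theta> (germ_of g))))"
proof -
  have *: "fps_nth (\<theta> (germ_of g)) 0 = 0"
    using has_fps_expansion_imp_0_eq_fps_nth_0[OF \<theta>_expansion[OF g]] g0 \<gamma>_0 by simp
  show ?thesis
    using Inf_dimension[OF *] by (simp add: intersection_mult_def Let_def Q_def[OF *] K_def[OF *] \<pi>_def[OF *] I_def[OF *])
qed

end

section \<open>Existence of the branch\<close>

lemma hol2_nonvanishing_near_circle:
  assumes G: "hol2 (ball 0 R) (ball 0 R) G" and \<epsilon>: "0 < \<epsilon>" "\<epsilon> < R"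
    and nz: "\<And>w. norm w = \<epsilon> \<Longrightarrow> G 0 w \<noteq> 0"
  shows "\<exists>\<delta>>0. \<delta> \<le> R \<and> (\<forall>x w. norm x < \<delta> \<longrightarrow> norm w = \<epsilon> \<longrightarrow> G x w \<noteq> 0)"
proof -
  define N where "N = (ball 0 R \<times> ball 0 R) \<inter> (\<lambda>(x, y). G x y) -` (- {0})"
  have "open N"
    unfolding N_def using hol2_continuous[OF G] by (auto intro!: continuous_open_preimage open_Times)
  moreover have "{0} \<times> sphere 0 \<epsilon> \<subseteq> N" using \<epsilon> nz by (auto simp: N_def)
  ultimately obtain V where V: "open V" "0 \<in> V" "V \<times> sphere 0 \<epsilon> \<subseteq> N"
    by (rule tube_lemma_open[OF compact_sphere])
  then obtain d where d: "d > 0" "ball 0 d \<subseteq> V" by (meson openE)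
  have "G x w \<noteq> 0" if "norm x < d" "norm w = \<epsilon>" for x w
  proof -
    have "x \<in> V" using d(2) that(1) by auto
    then have "(x, w) \<in> N" using V(3) that(2) by auto
    then show ?thesis by (simp add: N_def)
  qed
  then show ?thesis using d(1) \<epsilon> by (intro exI[of _ "min d R"]) auto
qed

text \<open>The initial form keeps zeros off a cone about x = 0, which isolates the root 0 over x =
  0 and makes a Puiseux root available. Its polynomial \<open>W\<close> divides the sheared h and
  vanishes at 0, so irreducibility makes the cofactor a unit. On x = 0 then
  \<open>norm y ^ p\<close> and \<open>norm y ^ n\<close> have the same size, whence p = n.\<close>

lemma germ_branch_exists:
  assumes h: "holomorphic2_near_0 h" and irr: "Factorial_Ring.irreducible (germ_of h)"
    and low: "\<And>k l. k + l < n \<Longrightarrow> taylor_coeff h k l = 0"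
    and a: "(\<Sum>k\<le>n. taylor_coeff h k (n - k) * a ^ k) \<noteq> 0"
  obtains \<rho> \<phi> where "germ_branch n \<rho> \<phi> h a"
    "\<exists>K r. r > 0 \<and> (\<forall>t. norm t < r \<longrightarrow> norm (\<phi> t) \<le> K * norm t ^ n)"
proof -
  define G where "G = (\<lambda>x y. shear a h (vec2 x y))"
  obtain R where R: "R > 0" "hol2 (ball 0 R) (ball 0 R) G"
    unfolding G_def using hol2_if_holomorphic2_near_0[OF holomorphic2_near_0_shear[OF h]] by blast
  obtain c C \<eta> r0 where c: "c > 0" "C > 0" "\<eta> > 0" "r0 > 0"
    and bd: "\<And>x y. norm y < r0 \<Longrightarrow> y \<noteq> 0 \<Longrightarrow> norm x \<le> \<eta> * norm y \<Longrightarrow>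
      c * norm y ^ n \<le> norm (G x y) \<and> norm (G x y) \<le> C * norm y ^ n"
    using initial_form_bounds[OF h low a] unfolding G_def shear_vec2 by blast
  have nu: "\<not> germ_of h dvd 1" using irr by (rule irreducible_not_unit)
  then have h0: "h 0 = 0" using germ_unit_iff[OF h] by blast
  have G00: "G 0 0 = 0" by (simp add: G_def h0)
  have Gnz: "G x y \<noteq> 0" if "norm y < r0" "y \<noteq> 0" "norm x \<le> \<eta> * norm y" for x y
  proof
    assume "G x y = 0"
    with bd[OF that] have "c * norm y ^ n \<le> 0" by simp
    moreover have "0 < c * norm y ^ n" using c(1) that(2) by simp
    ultimately show False by linarith
  qed
  \<comment> \<open>Below r0 the line x = 0 carries no zero but the origin, so this circle is free
    of zeros over x = 0.\<close>
  define \<epsilon> where "\<epsilon> = min R r0 / 2"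
  have \<epsilon>: "0 < \<epsilon>" "\<epsilon> < R" "\<epsilon> < r0" using R c by (auto simp: \<epsilon>_def)
  have "G 0 w \<noteq> 0" if "norm w = \<epsilon>" for w using that \<epsilon> c by (intro Gnz) auto
  from hol2_nonvanishing_near_circle[OF R(2) \<epsilon>(1,2) this]
  obtain \<delta> where \<delta>: "\<delta> > 0" "\<delta> \<le> R" "\<And>x w. norm x < \<delta> \<Longrightarrow> norm w = \<epsilon> \<Longrightarrow> G x w \<noteq> 0" by blast
  interpret rd: root_disc G \<delta> R \<epsilon>
  proof
    show "hol2 (ball 0 \<delta>) (ball 0 R) G" by (rule hol2_subset[OF R(2)]) (use \<delta> in auto)
  qed (use \<delta> \<epsilon> in auto)
  obtain s \<delta>' where \<delta>': "0 < \<delta>'" "\<delta>' \<le> \<delta>" "\<And>x. 0 < norm x \<Longrightarrow> norm x < \<delta>' \<Longrightarrow> card (rd.Z x) = s"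
    using rd.card_Z_constant by blast
  interpret rr: regular_roots G \<delta> R \<epsilon> \<delta>' s
  proof
    show "G 0 p = 0 \<longleftrightarrow> p = 0" if "norm p \<le> \<epsilon>" for p
      using Gnz[of p 0] G00 that \<epsilon> c by auto
  qed (use \<delta>' in auto)
  obtain p :: nat and \<rho> \<phi> where p: "p > 0" "\<rho> > 0" "\<rho> ^ p \<le> \<delta>'" "\<phi> holomorphic_on ball 0 \<rho>" "\<phi> 0 = 0"
    and Z: "\<And>t. t \<noteq> 0 \<Longrightarrow> norm t < \<rho> \<Longrightarrow> \<phi> t \<in> rd.Z (t ^ p)"
    and dist: "\<And>t k l. t \<noteq> 0 \<Longrightarrow> norm t < \<rho> \<Longrightarrow> k < p \<Longrightarrow> l < p \<Longrightarrow> k \<noteq> l \<Longrightarrow>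
      \<phi> (exp (2 * pi * \<i> / p) ^ k * t) \<noteq> \<phi> (exp (2 * pi * \<i> / p) ^ l * t)"
    using rr.puiseux_root by blast
  have unity: "\<exists>k<p. \<omega> = exp (2 * pi * \<i> / p) ^ k" if "\<omega> ^ p = 1" for \<omega> :: complex
  proof -
    have "\<omega> \<in> {exp (2 * of_real pi * \<i> * of_nat j / of_nat p) | j. j < p}"
      using that complex_roots_unity[of p] p(1) by auto
    then obtain j where j: "j < p" "\<omega> = exp (2 * of_real pi * \<i> * of_nat j / of_nat p)" by blast
    then have "\<omega> = exp (2 * pi * \<i> / p) ^ j" by (subst exp_of_nat_mult[symmetric]) (simp add: mult_ac)
    then show ?thesis using j by blast
  qed
  interpret br: branch p \<rho> \<phi>
  proof
    fix t \<omega> \<nu> :: complex assume *: "t \<noteq> 0" "norm t < \<rho>" "\<omega> ^ p = 1" "\<nu> ^ p = 1" "\<omega> \<noteq> \<nu>"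
    obtain k l where kl: "k < p" "\<omega> = exp (2 * pi * \<i> / p) ^ k" "l < p" "\<nu> = exp (2 * pi * \<i> / p) ^ l"
      using unity *(3,4) by blast
    show "\<phi> (\<omega> * t) \<noteq> \<phi> (\<nu> * t)" unfolding kl(2,4) using *(5) by (intro dist[OF *(1,2) kl(1,3)]) (auto simp: kl)
  qed (use p in auto)
  have G\<phi>: "G (t ^ p) (\<phi> t) = 0" if "norm t < \<rho>" for t
    using Z[of t] that G00 p(1,5) by (cases "t = 0") (auto simp: rd.Z_def power_0_left)
  obtain e q where e: "e > 0" "hol2 (ball 0 e) (ball 0 e) q"
    "\<And>x y. norm x < e \<Longrightarrow> norm y < e \<Longrightarrow> G x y = q x y * br.W x y"
    using br.quotient_by_W[OF R(2,1) p(2) G\<phi>] by blast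
  define u where "u = (\<lambda>z::complex^2. q (z $ 1) (z $ 2))"
  define w where "w = (\<lambda>z::complex^2. br.W (z $ 1) (z $ 2))"
  have u: "holomorphic2_near_0 u" unfolding u_def
    by (rule holomorphic2_near_0_if_hol2[OF open_ball _ e(1,2)]) (use e in simp)
  have w: "holomorphic2_near_0 w" unfolding w_def
    by (rule holomorphic2_near_0_if_hol2[of "ball 0 (\<rho> ^ p)" 1]) (use hol2_subset[OF br.hol2_W] p in auto)
  have fac: "\<forall>\<^sub>F z in nhds 0. shear a h z = u z * w z"
    unfolding eventually_nhds_0_vec2 using e(1,3) by (auto simp: G_def u_def w_def)
  have w0: "w 0 = 0"
    using br.W_power[of 0 0] p br.\<Omega> by (auto simp: w_def power_0_left intro!: prod_zero bexI[of _ 1])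
  have u0: "u 0 \<noteq> 0"
  proof -
    have "\<forall>\<^sub>F z in nhds 0. h z = shear (- a) u z * shear (- a) w z"
      using eventually_shear[OF fac, of "- a"] by (simp add: shear_def)
    then have "germ_of h = germ_of (shear (- a) u) * germ_of (shear (- a) w)"
      using u w by (simp add: germ_of_mult germ_of_eq_iff h holomorphic2_near_0_shear holomorphic2_near_0_mult)
    from Factorial_Ring.irreducibleD[OF irr this] show ?thesis
      using u w w0 by (simp add: germ_unit_iff holomorphic2_near_0_shear)
  qed
  have "isCont u 0" by (rule isCont_if_holomorphic2_near_0[OF u])
  then have "(u \<longlongrightarrow> u 0) (nhds 0)"
    using tendsto_at_iff_tendsto_nhds[of u 0] by (simp add: isCont_def)
  then have "((\<lambda>z. norm (u z)) \<longlongrightarrow> norm (u 0)) (nhds 0)" by (rule tendsto_norm)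
  note lim = order_tendstoD[OF this]
  have "\<forall>\<^sub>F z in nhds 0. norm (u 0) / 2 < norm (u z)" "\<forall>\<^sub>F z in nhds 0. norm (u z) < 2 * norm (u 0)"
    using u0 by (intro lim; simp)+
  with fac have "\<forall>\<^sub>F z in nhds 0. shear a h z = u z * w z \<and> norm (u 0) / 2 < norm (u z) \<and> norm (u z) < 2 * norm (u 0)"
    by eventually_elim simp
  then obtain r1 where r1: "r1 > 0" "\<And>x y. norm x < r1 \<Longrightarrow> norm y < r1 \<Longrightarrow>
      G x y = u (vec2 x y) * br.W x y \<and> norm (u 0) / 2 < norm (u (vec2 x y)) \<and> norm (u (vec2 x y)) < 2 * norm (u 0)"
    unfolding eventually_nhds_0_vec2 by (auto simp: G_def w_def)
  have W0: "norm (br.W 0 y) = norm y ^ p" for y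
    using br.W_power[of 0 y] p br.\<Omega>(2) by (simp add: power_0_left norm_power)
  have "p \<le> n"
  proof (rule power_bounds_imp_eq[of c "min r0 r1" n "2 * norm (u 0)"])
    fix y :: real assume y: "0 < y" "y < min r0 r1"
    have "c * y ^ n \<le> norm (G 0 (of_real y))" using bd[of "of_real y" 0] y c by simp
    also have "\<dots> = norm (u (vec2 0 (of_real y))) * y ^ p"
      using r1(2)[of 0 "of_real y"] y r1(1) by (simp add: norm_mult W0)
    also have "\<dots> \<le> 2 * norm (u 0) * y ^ p"
      using r1(2)[of 0 "of_real y"] y r1(1) by (intro mult_right_mono) auto
    finally show "c * y ^ n \<le> 2 * norm (u 0) * y ^ p" .
  qed (use c r1 in auto)
  moreover have "n \<le> p"
  proof (rule power_bounds_imp_eq[of "norm (u 0) / 2" "min r0 r1" p C])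
    fix y :: real assume y: "0 < y" "y < min r0 r1"
    have "norm (u 0) / 2 * y ^ p \<le> norm (u (vec2 0 (of_real y))) * y ^ p"
      using r1(2)[of 0 "of_real y"] y r1(1) by (intro mult_right_mono) auto
    also have "\<dots> = norm (G 0 (of_real y))"
      using r1(2)[of 0 "of_real y"] y r1(1) by (simp add: norm_mult W0)
    also have "\<dots> \<le> C * y ^ n" using bd[of "of_real y" 0] y c by simp
    finally show "norm (u 0) / 2 * y ^ p \<le> C * y ^ n" .
  qed (use u0 c r1 in auto)
  ultimately have pn: "p = n" by simp
  have "germ_branch p \<rho> \<phi> h a"
    by unfold_locales (use h u u0 fac in \<open>auto simp: w_def\<close>)
  moreover obtain r2 where r2: "r2 > 0" "r2 \<le> \<rho>" "\<And>t. norm t < r2 \<Longrightarrow> norm (\<phi> t) < r0"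
    using br.\<phi>_small[OF c(4)] by blast
  \<comment> \<open>A larger value would put the zero (t ^ p, \<phi> t) into the cone.\<close>
  have "norm (\<phi> t) \<le> (1 / \<eta>) * norm t ^ p" if "norm t < r2" for t
  proof (rule ccontr)
    assume "\<not> ?thesis"
    then have "norm (t ^ p) < \<eta> * norm (\<phi> t)" using c by (simp add: norm_power field_simps)
    moreover from this have "\<phi> t \<noteq> 0" by (metis mult_zero_right norm_ge_zero norm_zero not_le)
    ultimately have "G (t ^ p) (\<phi> t) \<noteq> 0" using r2(3)[OF that] by (intro Gnz) auto
    then show False using G\<phi>[of t] that r2 by simp
  qed
  ultimately show ?thesis using that r2(1) unfolding pn by blast
qed

text \<open>In sheared coordinates f has no zeros on a cone about x = 0 except the vertex, so g
  vanishes there. For small fixed x the cone contains an annulus in y, from which the identity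
  theorem carries the vanishing to the whole disc.\<close>

lemma germ_mult_eq_0:
  assumes f: "holomorphic2_near_0 f" and nz: "germ_of f \<noteq> 0" and fA: "germ_of f * A = 0"
  shows "A = 0"
proof -
  obtain g where g: "holomorphic2_near_0 g" "A = germ_of g" by (rule germ_cases)
  obtain n where n': "\<forall>k l. k + l < n \<longrightarrow> taylor_coeff f k l = 0"
    and n: "finite {a. (\<Sum>k\<le>n. taylor_coeff f k (n - k) * a ^ k) = 0}"
    using ord_at_0_finite[OF f nz] by blast
  have low: "taylor_coeff f k l = 0" if "k + l < n" for k l using n' that by blast
  obtain a where a: "(\<Sum>k\<le>n. taylor_coeff f k (n - k) * a ^ k) \<noteq> 0"
    using ex_new_if_finite[OF infinite_UNIV_char_0 n] by blast
  obtain c C \<eta> r where c: "c > 0" "C > 0" "\<eta> > 0" "r > 0"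
    and bd: "\<And>x y. norm y < r \<Longrightarrow> y \<noteq> 0 \<Longrightarrow> norm x \<le> \<eta> * norm y \<Longrightarrow>
      c * norm y ^ n \<le> norm (f (vec2 (x + a * y) y)) \<and> norm (f (vec2 (x + a * y) y)) \<le> C * norm y ^ n"
    using initial_form_bounds[OF f low a] by blast
  have "germ_of (\<lambda>z. f z * g z) = germ_of (\<lambda>_. 0)" using fA by (simp add: g(2) germ_of_mult f g(1) germ_of_0)
  then have "\<forall>\<^sub>F z in nhds 0. f z * g z = 0"
    by (subst (asm) germ_of_eq_iff) (use f g holomorphic2_near_0_mult holomorphic2_near_0_const in auto)
  from eventually_shear[OF this, of a]
  obtain d where d: "d > 0" "\<And>x y. norm x < d \<Longrightarrow> norm y < d \<Longrightarrow> f (vec2 (x + a * y) y) * g (vec2 (x + a * y) y) = 0"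
    unfolding eventually_nhds_0_vec2 by auto
  obtain R where R: "R > 0" "hol2 (ball 0 R) (ball 0 R) (\<lambda>x y. shear a g (vec2 x y))"
    using hol2_if_holomorphic2_near_0[OF holomorphic2_near_0_shear[OF g(1)]] by blast
  define s where "s = min (min r d) R"
  have s: "s > 0" "s \<le> r" "s \<le> d" "s \<le> R" using c d R by (auto simp: s_def)
  have z1: "shear a g (vec2 x y) = 0" if "norm x < d" "norm y < s" "norm x \<le> \<eta> * norm y" "y \<noteq> 0" for x y
  proof -
    have "c * norm y ^ n \<le> norm (f (vec2 (x + a * y) y))" using bd[of y x] that s by auto
    moreover have "0 < c * norm y ^ n" using c(1) that(4) by simp
    ultimately have "f (vec2 (x + a * y) y) \<noteq> 0" by auto
    then show ?thesis using d(2)[of x y] that s by (simp add: shear_vec2)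
  qed
  \<comment> \<open>If \<open>norm x < \<eta> * s / 2\<close>, every y of norm above s / 2 lies in
    the cone over x.\<close>
  define s' where "s' = min s (\<eta> * s / 2)"
  have s': "s' > 0" "s' \<le> s" "s' \<le> \<eta> * s / 2" using s c by (auto simp: s'_def)
  have "shear a g (vec2 x y) = 0" if x: "norm x < s'" and y: "norm y < s'" for x y
  proof -
    have "shear a g (vec2 x y) = 0"
    proof (rule analytic_continuation_open[of "ball 0 s - cball 0 (s / 2)" "ball 0 s" "\<lambda>y. shear a g (vec2 x y)" "\<lambda>_. 0"])
      have "of_real (3 * s / 4) \<in> ball (0::complex) s - cball 0 (s / 2)" using s by simp
      then show "ball (0::complex) s - cball 0 (s / 2) \<noteq> {}" by blast
      show "(\<lambda>y. shear a g (vec2 x y)) holomorphic_on ball 0 s"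
        by (rule holomorphic_on_subset[OF hol2_holomorphic2[OF R(2)]]) (use x s' s in auto)
      show "shear a g (vec2 x z) = 0" if z: "z \<in> ball 0 s - cball 0 (s / 2)" for z
      proof (rule z1)
        have "norm z > s / 2" using z by simp
        then have "\<eta> * norm z \<ge> \<eta> * (s / 2)" using c by (intro mult_left_mono) auto
        then show "norm x \<le> \<eta> * norm z" using x s' by simp
      qed (use x z s s' in auto)
    qed (use y s' in \<open>auto intro: open_Diff\<close>)
    then show ?thesis .
  qed
  then have "\<forall>\<^sub>F z in nhds 0. shear a g z = 0" unfolding eventually_nhds_0_vec2 using s'(1) by blast
  from eventually_shear[OF this, of "- a"] have "\<forall>\<^sub>F z in nhds 0. g z = 0" by (simp add: shear_def)
  then show ?thesis by (simp add: g(2) germ_of_0 germ_of_eq_iff g(1) holomorphic2_near_0_const)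
qed

text \<open>Induction on the number of factors: a prime factor divides \<open>A\<close> or its
  cofactor and is cancelled on that side. Primality and cancellation are asked of the
  \<open>H i\<close> only; for germs the kernel of the pullback gives the former and
  \<open>germ_mult_eq_0\<close> the latter.\<close>

lemma dvd_prod_primes:
  fixes H :: "'i \<Rightarrow> 'a::comm_ring_1"
  assumes "finite I" and prime: "\<And>i A B. i \<in> I \<Longrightarrow> H i dvd A * B \<Longrightarrow> H i dvd A \<or> H i dvd B"
    and cancel: "\<And>i A. i \<in> I \<Longrightarrow> H i * A = 0 \<Longrightarrow> A = 0" and dvd: "A dvd (\<Prod>i\<in>I. H i)"
  shows "\<exists>J U. J \<subseteq> I \<and> U dvd 1 \<and> A = U * (\<Prod>i\<in>J. H i)"
  using assms
proof (induction I arbitrary: A)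
  case empty
  then show ?case by (intro exI[of _ "{}"] exI[of _ A]) auto
next
  case (insert i I)
  have cancel': "A = B" if "H i * A = H i * B" for A B
    using insert.prems(2)[of i "A - B"] that by (simp add: right_diff_distrib)
  obtain B where B: "H i * (\<Prod>i\<in>I. H i) = A * B" using insert.prems(3) insert.hyps by (auto elim: dvdE)
  then have "H i dvd A \<or> H i dvd B" using insert.prems(1)[of i A B] by (metis dvd_triv_left insertI1)
  then show ?case
  proof
    assume "H i dvd A"
    then obtain A' where A': "A = H i * A'" by (rule dvdE)
    have "(\<Prod>i\<in>I. H i) = A' * B" by (rule cancel') (simp add: B A' mult.assoc)
    then have "A' dvd (\<Prod>i\<in>I. H i)" by simp
    then have "\<exists>J U. J \<subseteq> I \<and> U dvd 1 \<and> A' = U * (\<Prod>i\<in>J. H i)"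
      using insert.prems(1,2) by (intro insert.IH) blast+
    then obtain J U where JU: "J \<subseteq> I" "U dvd 1" "A' = U * (\<Prod>i\<in>J. H i)" by blast
    have "i \<notin> J" "finite J" using JU(1) insert.hyps by (auto intro: finite_subset)
    then have "A = U * (\<Prod>i\<in>insert i J. H i)" by (simp add: A' JU(3) mult_ac)
    then show ?thesis using JU by (intro exI[of _ "insert i J"] exI[of _ U]) auto
  next
    assume "H i dvd B"
    then obtain B' where B': "B = H i * B'" by (rule dvdE)
    have "(\<Prod>i\<in>I. H i) = A * B'" by (rule cancel') (simp add: B B' mult_ac)
    then have "A dvd (\<Prod>i\<in>I. H i)" by simp
    then have "\<exists>J U. J \<subseteq> I \<and> U dvd 1 \<and> A = U * (\<Prod>i\<in>J. H i)"
      using insert.prems(1,2) by (intro insert.IH) blast+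
    then obtain J U where JU: "J \<subseteq> I" "U dvd 1" "A = U * (\<Prod>i\<in>J. H i)" by blast
    then show ?thesis by blast
  qed
qed

section \<open>Comparison with the nearest branch\<close>

text \<open>Near 0 the function is asymptotically equal to its leading term; c and C come from the
  two Landau estimates.\<close>

lemma fps_expansion_bounds:
  fixes f :: "complex \<Rightarrow> complex"
  assumes f: "f has_fps_expansion F" and F: "F \<noteq> 0"
  shows "\<exists>c C. c > 0 \<and> C > 0 \<and>
    (\<forall>\<^sub>F t in nhds 0. c * norm t ^ subdegree F \<le> norm (f t) \<and> norm (f t) \<le> C * norm t ^ subdegree F)"
proof -
  define A where "A = fps_nth F (subdegree F)"
  have A: "A \<noteq> 0" using F by (simp add: A_def)
  have th: "f \<in> \<Theta>[nhds 0](\<lambda>z. A * z ^ subdegree F)"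
    unfolding A_def by (rule asymp_equiv_imp_bigtheta[OF has_fps_expansion_imp_asymp_equiv_0[OF f]])
  have O: "f \<in> O[nhds 0](\<lambda>z. A * z ^ subdegree F)" "(\<lambda>z. A * z ^ subdegree F) \<in> O[nhds 0](f)"
    by (rule bigthetaD1[OF th]) (rule bigthetaD2[OF th, unfolded bigomega_iff_bigo])
  obtain C where C: "C > 0" "\<forall>\<^sub>F t in nhds 0. norm (f t) \<le> C * norm (A * t ^ subdegree F)"
    using O(1) by (rule landau_o.bigE)
  obtain C' where C': "C' > 0" "\<forall>\<^sub>F t in nhds 0. norm (A * t ^ subdegree F) \<le> C' * norm (f t)"
    using O(2) by (rule landau_o.bigE)
  have "\<forall>\<^sub>F t in nhds 0. norm A / C' * norm t ^ subdegree F \<le> norm (f t) \<and> norm (f t) \<le> C * norm A * norm t ^ subdegree F"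
    using C(2) C'(2)
  proof eventually_elim
    case (elim t)
    have "norm A * norm t ^ subdegree F \<le> norm (f t) * C'" using elim(2) by (simp add: norm_mult norm_power mult.commute)
    then have "norm A / C' * norm t ^ subdegree F \<le> norm (f t)" using C'(1) by (simp add: pos_divide_le_eq)
    then show ?case using elim(1) by (simp add: norm_mult norm_power mult.assoc)
  qed
  moreover have "norm A / C' > 0" "C * norm A > 0" using A C(1) C'(1) by auto
  ultimately show ?thesis by blast
qed

lemma unit_bounds:
  assumes v: "holomorphic2_near_0 v" and v0: "v 0 \<noteq> 0"
  shows "\<forall>\<^sub>F z in nhds 0. norm (v 0) / 2 \<le> norm (v z) \<and> norm (v z) \<le> 2 * norm (v 0)"
proof -
  have "(v \<longlongrightarrow> v 0) (nhds 0)"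
    using isCont_if_holomorphic2_near_0[OF v] tendsto_at_iff_tendsto_nhds[of v 0] by (simp add: isCont_def)
  note lim = order_tendstoD[OF tendsto_norm[OF this]]
  have "\<forall>\<^sub>F z in nhds 0. norm (v 0) / 2 < norm (v z)" "\<forall>\<^sub>F z in nhds 0. norm (v z) < 2 * norm (v 0)"
    using v0 by (intro lim; simp)+
  then show ?thesis by eventually_elim simp
qed

context germ_branch
begin

text \<open>The multiples of h are the kernel of \<theta>, whose values lie in an integral
  domain.\<close>

lemma prime: "germ_of h dvd A * B \<Longrightarrow> germ_of h dvd A \<or> germ_of h dvd B"
  by (simp add: \<theta>_mult flip: ker)

text \<open>Each multiplicity is the order of \<open>G j\<close> along the branch, so the minimum is
  the growth exponent of the largest component. The upper bound in t serves to estimate the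
  Lojasiewicz exponent from below, the lower bound to estimate it from above.\<close>

lemma branch_order:
  fixes G :: "'m::finite \<Rightarrow> complex^2 \<Rightarrow> complex"
  assumes G: "\<And>j. holomorphic2_near_0 (G j)" and G0: "\<And>j. G j 0 = 0"
  defines "E \<equiv> (MIN j. ereal_of_enat (intersection_mult h (G j)))"
  shows "(E = \<infinity> \<and> (\<forall>\<^sub>F t in nhds 0. \<forall>j. G j (\<gamma> t) = 0)) \<or>
    (\<exists>k c C. E = ereal (real k) \<and> c > 0 \<and> C > 0 \<and>
      (\<forall>\<^sub>F t in nhds 0. (\<forall>j. norm (G j (\<gamma> t)) \<le> C * norm t ^ k) \<and> (\<exists>j. c * norm t ^ k \<le> norm (G j (\<gamma> t)))))"
proof -
  define \<mu> where "\<mu> = (\<lambda>j. intersection_mult h (G j))"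
  define T where "T = (\<lambda>j. \<theta> (germ_of (G j)))"
  have T: "(\<lambda>t. G j (\<gamma> t)) has_fps_expansion T j" for j unfolding T_def by (rule \<theta>_expansion[OF G])
  have \<mu>: "\<mu> j = (if T j = 0 then \<infinity> else enat (subdegree (T j)))" for j
    unfolding \<mu>_def T_def by (rule intersection_mult_eq[OF G G0])
  have "E \<in> range (\<lambda>j. ereal_of_enat (\<mu> j))" unfolding E_def \<mu>_def by (intro Min_in) auto
  then obtain j0 where j0: "E = ereal_of_enat (\<mu> j0)" by blast
  have le: "\<mu> j0 \<le> \<mu> j" for j
  proof -
    have "E \<le> ereal_of_enat (\<mu> j)" unfolding E_def \<mu>_def by (intro Min_le) auto
    then show ?thesis by (simp add: j0)
  qed
  show ?thesis
  proof (cases "T j0 = 0")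
    case True
    then have "\<mu> j = \<infinity>" for j using le[of j] \<mu>[of j0] by simp
    then have "T j = 0" for j using \<mu>[of j] by (auto split: if_splits)
    then have "\<forall>\<^sub>F t in nhds 0. G j (\<gamma> t) = 0" for j
      using T[of j] by (simp add: has_fps_expansion_0_iff)
    then have "\<forall>\<^sub>F t in nhds 0. \<forall>j. G j (\<gamma> t) = 0" by (intro eventually_all_finite)
    moreover have "E = \<infinity>" using True \<mu>[of j0] j0 by simp
    ultimately show ?thesis by blast
  next
    case False
    define k where "k = subdegree (T j0)"
    have E: "E = ereal (real k)" using False \<mu>[of j0] j0 by (simp add: k_def)
    have "\<exists>C>0. \<forall>\<^sub>F t in nhds 0. norm (G j (\<gamma> t)) \<le> C * norm t ^ k" for j
    proof (cases "T j = 0")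
      case True
      then have "\<forall>\<^sub>F t in nhds 0. G j (\<gamma> t) = 0" using T[of j] by (simp add: has_fps_expansion_0_iff)
      then have "\<forall>\<^sub>F t in nhds 0. norm (G j (\<gamma> t)) \<le> 1 * norm t ^ k" by eventually_elim simp
      then show ?thesis by (intro exI[of _ 1]) simp
    next
      case nz: False
      have kd: "k \<le> subdegree (T j)" using le[of j] \<mu>[of j] \<mu>[of j0] nz False by (simp add: k_def)
      obtain C where C: "C > 0" "\<forall>\<^sub>F t in nhds 0. norm (G j (\<gamma> t)) \<le> C * norm t ^ subdegree (T j)"
        using fps_expansion_bounds[OF T nz] by (auto simp: eventually_conj_iff)
      have "\<forall>\<^sub>F t in nhds (0::complex). norm t < 1" by (auto simp: eventually_nhds_metric intro: exI[of _ 1])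
      with C(2) have "\<forall>\<^sub>F t in nhds 0. norm (G j (\<gamma> t)) \<le> C * norm t ^ k"
      proof eventually_elim
        case (elim t)
        have "norm t ^ subdegree (T j) \<le> norm t ^ k" using elim(2) kd by (intro power_decreasing) auto
        then have "C * norm t ^ subdegree (T j) \<le> C * norm t ^ k" using C(1) by (intro mult_left_mono) auto
        with elim(1) show ?case by linarith
      qed
      then show ?thesis using C(1) by blast
    qed
    then obtain C where C: "\<And>j. C j > 0" "\<And>j. \<forall>\<^sub>F t in nhds 0. norm (G j (\<gamma> t)) \<le> C j * norm t ^ k" by metis
    define D where "D = (\<Sum>j\<in>UNIV. C j)"
    have D: "C j \<le> D" for j unfolding D_def using C(1) by (intro member_le_sum) (auto intro: less_imp_le)
    have D0: "D > 0" unfolding D_def using C(1) by (intro sum_pos) auto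
    obtain c where c: "c > 0" "\<forall>\<^sub>F t in nhds 0. c * norm t ^ k \<le> norm (G j0 (\<gamma> t))"
      using fps_expansion_bounds[OF T False] by (auto simp: eventually_conj_iff k_def)
    have "\<forall>\<^sub>F t in nhds 0. \<forall>j. norm (G j (\<gamma> t)) \<le> C j * norm t ^ k" using C(2) by (intro eventually_all_finite)
    with c(2) have "\<forall>\<^sub>F t in nhds 0. (\<forall>j. norm (G j (\<gamma> t)) \<le> D * norm t ^ k) \<and> (\<exists>j. c * norm t ^ k \<le> norm (G j (\<gamma> t)))"
    proof eventually_elim
      case (elim t)
      have "C j * norm t ^ k \<le> D * norm t ^ k" for j using D by (intro mult_right_mono) auto
      with elim show ?case by (meson order_trans)
    qed
    then show ?thesis using E c(1) D0 by blast
  qed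
qed

end

text \<open>Comparison of \<open>(x, y)\<close> with a point of the curves \<open>W\<^sub>i = 0\<close>: the nearest root over the same
  abscissa inside the cone \<open>norm y \<le> 2 K norm x\<close>, and any root over the abscissa \<open>y\<close> outside of it.\<close>

lemma nearest_branch_point:
  fixes p :: "'i \<Rightarrow> nat" and \<phi> :: "'i \<Rightarrow> complex \<Rightarrow> complex"
  assumes I: "finite I" "I \<noteq> {}" and br: "\<And>i. i \<in> I \<Longrightarrow> branch (p i) (\<rho> i) (\<phi> i)"
    and K: "K \<ge> 1" and s: "s > 0" "\<And>i. i \<in> I \<Longrightarrow> s \<le> \<rho> i"
    and \<phi>: "\<And>i t. i \<in> I \<Longrightarrow> norm t < s \<Longrightarrow> norm (\<phi> i t) \<le> K * norm t ^ p i"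
  defines "W \<equiv> \<lambda>i. branch.W (p i) (\<rho> i) (\<phi> i)"
  shows "\<exists>r \<Lambda>. r > 0 \<and> \<Lambda> \<ge> 1 \<and> (\<forall>x y. norm x < r \<longrightarrow> norm y < r \<longrightarrow>
    (\<exists>i\<in>I. \<exists>\<tau>. norm \<tau> < s \<and> max (norm x) (norm y) \<le> 2 * K * norm \<tau> ^ p i \<and> norm \<tau> ^ p i \<le> max (norm x) (norm y) \<and>
      (\<forall>l\<in>I. norm (W l (\<tau> ^ p i) (\<phi> i \<tau>)) \<le> \<Lambda> * norm (W l x y))))"
proof -
  define r where "r = Min ((\<lambda>i. s ^ p i) ` I)"
  have r: "r > 0" "\<And>i. i \<in> I \<Longrightarrow> r \<le> s ^ p i" using I s(1) by (auto simp: r_def)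
  define N where "N = (\<Sum>i\<in>I. p i)"
  \<comment> \<open>The loss per linear factor is 2 inside the cone and 4 K outside, and no
    \<open>W l\<close> has more than N linear factors.\<close>
  define \<Lambda> where "\<Lambda> = (4 * K) ^ N"
  have p_N: "p i \<le> N" if "i \<in> I" for i unfolding N_def using that I(1) by (intro member_le_sum) auto
  have \<Lambda>: "\<Lambda> \<ge> 1" "(4 * K) ^ p i \<le> \<Lambda>" if "i \<in> I" for i
  proof -
    show "\<Lambda> \<ge> 1" unfolding \<Lambda>_def by (rule one_le_power) (use K in simp)
    show "(4 * K) ^ p i \<le> \<Lambda>" unfolding \<Lambda>_def by (rule power_increasing[OF p_N[OF that]]) (use K in simp)
  qed
  define \<Omega> where "\<Omega> = (\<lambda>i. branch.\<Omega> (p i))"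
  have \<Omega>: "finite (\<Omega> i)" "card (\<Omega> i) = p i" "1 \<in> \<Omega> i" if "i \<in> I" for i
    using branch.\<Omega>[OF br[OF that]] by (auto simp: \<Omega>_def)
  have \<Omega>1: "\<omega> ^ p i = 1" "norm (\<omega> * t) = norm t" if "i \<in> I" "\<omega> \<in> \<Omega> i" for i \<omega> t
    using that(2) branch.norm_\<Omega>[OF br[OF that(1)]] by (auto simp: \<Omega>_def branch.\<Omega>_def[OF br[OF that(1)]])
  have W: "norm (W i (t ^ p i) y) = (\<Prod>\<omega>\<in>\<Omega> i. norm (y - \<phi> i (\<omega> * t)))" if "i \<in> I" "norm t < s" for i t y
    using branch.W_power[OF br[OF that(1)], of t y] that s(2)[OF that(1)] by (simp add: W_def \<Omega>_def prod_norm)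
  have root: "\<exists>t. t ^ p i = x \<and> norm t < s" if "i \<in> I" "norm x < r" for i and x :: complex
  proof -
    have "norm x < s ^ p i" using r(2)[OF that(1)] that(2) by simp
    from exists_root_in_ball[OF branch.p[OF br[OF that(1)]] s(1) this] show ?thesis by blast
  qed
  have main: "\<exists>i\<in>I. \<exists>\<tau>. norm \<tau> < s \<and> max (norm x) (norm y) \<le> 2 * K * norm \<tau> ^ p i \<and> norm \<tau> ^ p i \<le> max (norm x) (norm y) \<and>
      (\<forall>l\<in>I. norm (W l (\<tau> ^ p i) (\<phi> i \<tau>)) \<le> \<Lambda> * norm (W l x y))"
    if x: "norm x < r" and y: "norm y < r" for x y
  proof -
    have "\<forall>i\<in>I. \<exists>v. v ^ p i = x \<and> norm v < s" using root[OF _ x] by (intro ballI)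
      from bchoice[OF this] obtain t where t: "\<And>i. i \<in> I \<Longrightarrow> t i ^ p i = x" "\<And>i. i \<in> I \<Longrightarrow> norm (t i) < s" by blast
    have Wx: "norm (W l x z) = (\<Prod>\<omega>\<in>\<Omega> l. norm (z - \<phi> l (\<omega> * t l)))" if "l \<in> I" for l z
      using W[OF that t(2)[OF that], of z] t(1)[OF that] by simp
    show ?thesis
    proof (cases "norm y \<le> 2 * K * norm x")
      case True
      define S where "S = Sigma I \<Omega>"
      have S: "finite S" "S \<noteq> {}" using I \<Omega>(1,3) unfolding S_def by blast+
      define dst where "dst = (\<lambda>(i, \<omega>). norm (y - \<phi> i (\<omega> * t i)))"
      obtain q where q: "q \<in> S" "\<And>q'. q' \<in> S \<Longrightarrow> dst q \<le> dst q'"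
        using ex_is_arg_min_if_finite[OF S, of dst] by (auto simp: is_arg_min_linorder)
      obtain i \<omega> where i: "q = (i, \<omega>)" "i \<in> I" "\<omega> \<in> \<Omega> i" using q(1) by (auto simp: S_def)
      define \<tau> where "\<tau> = \<omega> * t i"
      have \<tau>: "norm \<tau> < s" "\<tau> ^ p i = x"
        using \<Omega>1[OF i(2,3)] t(1,2)[OF i(2)] by (auto simp: \<tau>_def power_mult_distrib)
      \<comment> \<open>The chosen root is at least as close to y as the other one, so the triangle
        inequality through y gives the factor 2.\<close>
      have near: "norm (\<phi> i \<tau> - \<phi> l (\<nu> * t l)) \<le> 2 * norm (y - \<phi> l (\<nu> * t l))" if "l \<in> I" "\<nu> \<in> \<Omega> l" for l \<nu>
      proof -
        have "norm (y - \<phi> i \<tau>) \<le> norm (y - \<phi> l (\<nu> * t l))"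
          using q(2)[of "(l, \<nu>)"] that by (simp add: S_def dst_def i(1) \<tau>_def)
        moreover have "norm (\<phi> i \<tau> - \<phi> l (\<nu> * t l)) \<le> norm (\<phi> i \<tau> - y) + norm (y - \<phi> l (\<nu> * t l))"
          using norm_triangle_ineq[of "\<phi> i \<tau> - y" "y - \<phi> l (\<nu> * t l)"] by simp
        ultimately show ?thesis by (simp add: norm_minus_commute)
      qed
      have "norm (W l (\<tau> ^ p i) (\<phi> i \<tau>)) \<le> \<Lambda> * norm (W l x y)" if l: "l \<in> I" for l
      proof -
        have "norm (W l (\<tau> ^ p i) (\<phi> i \<tau>)) = (\<Prod>\<nu>\<in>\<Omega> l. norm (\<phi> i \<tau> - \<phi> l (\<nu> * t l)))"
          unfolding \<tau>(2) by (rule Wx[OF l])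
        also have "\<dots> \<le> (\<Prod>\<nu>\<in>\<Omega> l. 2 * norm (y - \<phi> l (\<nu> * t l)))" using near[OF l] by (intro prod_mono) auto
        also have "\<dots> = 2 ^ p l * norm (W l x y)" by (simp add: Wx[OF l] prod.distrib \<Omega>(2)[OF l])
        also have "\<dots> \<le> (4 * K) ^ p l * norm (W l x y)" using K by (intro mult_right_mono power_mono) auto
        also have "\<dots> \<le> \<Lambda> * norm (W l x y)" using \<Lambda>(2)[OF l] by (intro mult_right_mono) auto
        finally show ?thesis .
      qed
      moreover have "norm \<tau> ^ p i = norm x" using \<tau>(2) by (metis norm_power)
      moreover have "norm x \<le> 2 * K * norm x" using K by (simp add: mult_le_cancel_right1)
      ultimately show ?thesis using True i(2) \<tau>(1)
        by (intro bexI[of _ i] exI[of _ \<tau>] conjI ballI) simp_all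
    next
      case False
      \<comment> \<open>Outside the cone y dominates. The roots over x have norm at most K norm x <
        norm y / 2, so each factor of \<open>W l x y\<close> is at least norm y / 2; the roots over
        the abscissa y have norm at most K norm y, so each factor at the new point is at most 2 K
        norm y.\<close>
      obtain i where i: "i \<in> I" using I by blast
      have "\<forall>i\<in>I. \<exists>v. v ^ p i = y \<and> norm v < s" using root[OF _ y] by (intro ballI)
      from bchoice[OF this] obtain u where u: "\<And>i. i \<in> I \<Longrightarrow> u i ^ p i = y" "\<And>i. i \<in> I \<Longrightarrow> norm (u i) < s" by blast
      have Wy: "norm (W l y z) = (\<Prod>\<omega>\<in>\<Omega> l. norm (z - \<phi> l (\<omega> * u l)))" if "l \<in> I" for l z
        using W[OF that u(2)[OF that], of z] u(1)[OF that] by simp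
      define \<tau> where "\<tau> = u i"
      have \<tau>: "norm \<tau> < s" "\<tau> ^ p i = y" using u i by (auto simp: \<tau>_def)
      have nu: "norm (u l) ^ p l = norm y" if "l \<in> I" for l using u(1)[OF that] by (metis norm_power)
      have nt: "norm (t l) ^ p l = norm x" if "l \<in> I" for l using t(1)[OF that] by (metis norm_power)
      have b1: "norm (\<phi> l (\<nu> * u l)) \<le> K * norm y" if "l \<in> I" "\<nu> \<in> \<Omega> l" for l \<nu>
        using \<phi>[OF that(1), of "\<nu> * u l"] \<Omega>1(2)[OF that] u(2)[OF that(1)] nu[OF that(1)] by simp
      have b2: "norm (\<phi> l (\<nu> * t l)) \<le> K * norm x" if "l \<in> I" "\<nu> \<in> \<Omega> l" for l \<nu>
        using \<phi>[OF that(1), of "\<nu> * t l"] \<Omega>1(2)[OF that] t(2)[OF that(1)] nt[OF that(1)] by simp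
      have b3: "norm (\<phi> i \<tau>) \<le> K * norm y" using b1[OF i \<Omega>(3)[OF i]] by (simp add: \<tau>_def)
      have "norm (W l (\<tau> ^ p i) (\<phi> i \<tau>)) \<le> \<Lambda> * norm (W l x y)" if l: "l \<in> I" for l
      proof -
        have "norm (W l (\<tau> ^ p i) (\<phi> i \<tau>)) = (\<Prod>\<nu>\<in>\<Omega> l. norm (\<phi> i \<tau> - \<phi> l (\<nu> * u l)))"
          unfolding \<tau>(2) by (rule Wy[OF l])
        also have "\<dots> \<le> (\<Prod>\<nu>\<in>\<Omega> l. 4 * K * norm (y - \<phi> l (\<nu> * t l)))"
        proof (intro prod_mono conjI)
          fix \<nu> assume \<nu>: "\<nu> \<in> \<Omega> l"
          have "norm (\<phi> i \<tau> - \<phi> l (\<nu> * u l)) \<le> K * norm y + K * norm y"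
            using norm_triangle_ineq4[of "\<phi> i \<tau>" "\<phi> l (\<nu> * u l)"] b3 b1[OF l \<nu>] by linarith
          also have "\<dots> = 4 * K * (norm y / 2)" by simp
          also have "norm y / 2 \<le> norm (y - \<phi> l (\<nu> * t l))"
            using norm_triangle_ineq2[of y "\<phi> l (\<nu> * t l)"] b2[OF l \<nu>] False by linarith
          then have "4 * K * (norm y / 2) \<le> 4 * K * norm (y - \<phi> l (\<nu> * t l))"
            using K by (intro mult_left_mono) auto
          finally show "norm (\<phi> i \<tau> - \<phi> l (\<nu> * u l)) \<le> 4 * K * norm (y - \<phi> l (\<nu> * t l))" .
        qed auto
        also have "\<dots> = (4 * K) ^ p l * norm (W l x y)" by (simp add: Wx[OF l] prod.distrib \<Omega>(2)[OF l])
        also have "\<dots> \<le> \<Lambda> * norm (W l x y)" using \<Lambda>(2)[OF l] by (intro mult_right_mono) auto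
        finally show ?thesis .
      qed
      moreover have "norm \<tau> ^ p i = norm y" using nu[OF i] by (simp add: \<tau>_def)
      moreover have "norm x \<le> norm y"
      proof -
        have "norm x \<le> 2 * K * norm x" using K by (simp add: mult_le_cancel_right1)
        then show ?thesis using False by linarith
      qed
      moreover have "norm y \<le> 2 * K * norm y" using K by (simp add: mult_le_cancel_right1)
      ultimately show ?thesis using i \<tau>(1)
        by (intro bexI[of _ i] exI[of _ \<tau>] conjI ballI) simp_all
    qed
  qed
  obtain i where "i \<in> I" using I by blast
  then show ?thesis using main r(1) \<Lambda>(1) by blast
qed

section \<open>The maximum norm\<close>

lemma norm_le_max_norm: "norm (z $ i) \<le> max_norm z"
  unfolding max_norm_def by (intro Max_ge) auto

lemma max_norm_le: "(\<And>i. norm (z $ i) \<le> B) \<Longrightarrow> max_norm z \<le> B"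
  unfolding max_norm_def by (intro Max.boundedI) auto

lemma max_norm_nonneg: "0 \<le> max_norm z"
  using order_trans[OF norm_ge_zero norm_le_max_norm] .

lemma max_norm_vec2_le: "norm x \<le> B \<Longrightarrow> norm y \<le> B \<Longrightarrow> max_norm (vec2 x y) \<le> B"
  by (rule max_norm_le) (simp add: vec2_def)

section \<open>The Lojasiewicz exponent\<close>

text \<open>If \<beta> exceeded \<alpha>, a positive constant would be bounded by a multiple of
  \<open>y powr (\<beta> - \<alpha>)\<close>, which tends to 0.\<close>

lemma powr_bounds_imp_le:
  assumes c: "c > 0" and le: "\<forall>\<^sub>F y in at_right (0::real). c * y powr \<alpha> \<le> C * y powr \<beta>"
  shows "\<beta> \<le> \<alpha>"
proof (rule ccontr)
  assume "\<not> \<beta> \<le> \<alpha>"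
  then have "((\<lambda>y. y powr (\<beta> - \<alpha>)) \<longlongrightarrow> 0) (at_right (0::real))"
    by (intro tendsto_zero_powrI[OF tendsto_ident_at tendsto_const])
       (auto simp: eventually_at_right_field intro: exI[of _ 1])
  then have "((\<lambda>y. C * y powr (\<beta> - \<alpha>)) \<longlongrightarrow> C * 0) (at_right (0::real))" by (intro tendsto_intros)
  moreover have "\<forall>\<^sub>F y in at_right (0::real). 0 < y" by (auto simp: eventually_at_right_field intro: exI[of _ 1])
  with le have "\<forall>\<^sub>F y in at_right (0::real). c \<le> C * y powr (\<beta> - \<alpha>)"
  proof eventually_elim
    case (elim y)
    have "y powr \<beta> = y powr (\<beta> - \<alpha>) * y powr \<alpha>" by (simp flip: powr_add)
    then have "c * y powr \<alpha> \<le> (C * y powr (\<beta> - \<alpha>)) * y powr \<alpha>" using elim(1) by simp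
    moreover have "y powr \<alpha> > 0" using elim(2) by simp
    ultimately show ?case by (rule mult_right_le_imp_le)
  qed
  ultimately have "c \<le> C * 0" by (intro tendsto_lowerbound[of _ _ "at_right (0::real)"]) auto
  with c show False by simp
qed

lemma max_norm_le_norm: "max_norm z \<le> norm z"
  by (rule max_norm_le) (rule Finite_Cartesian_Product.norm_nth_le)

lemma norm_unshear_le: "norm (z $ 1 - a * z $ 2) \<le> (1 + norm a) * max_norm (z :: complex^2)"
proof -
  have "norm (z $ 1 - a * z $ 2) \<le> norm (z $ 1) + norm a * norm (z $ 2)"
    using norm_triangle_ineq4[of "z $ 1" "a * z $ 2"] by (simp add: norm_mult)
  also have "\<dots> \<le> max_norm z + norm a * max_norm z"
    by (intro add_mono mult_left_mono norm_le_max_norm) auto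
  finally show ?thesis by (simp add: algebra_simps)
qed

context germ_branch
begin

text \<open>Insert the branch into the inequality: its points have size at least a multiple of
  \<open>norm t ^ p\<close>, while F is at most a multiple of \<open>norm t ^ k\<close> there, so k
  \<le> p \<eta>. If the minimum is infinite, F vanishes along the branch and no \<eta> is
  admissible.\<close>

lemma lojasiewicz_set_lower_bound:
  fixes F :: "complex^2 \<Rightarrow> complex^'m"
  assumes U: "open U" "0 \<in> U" and F: "\<And>j. holomorphic2_near_0 (\<lambda>z. F z $ j)" and F0: "F 0 = 0"
    and \<eta>: "\<eta> \<in> lojasiewicz_set U F"
  shows "1 / ereal (real p) * (MIN j. ereal_of_enat (intersection_mult h (\<lambda>z. F z $ j))) \<le> ereal \<eta>"
proof -
  define E where "E = (MIN j. ereal_of_enat (intersection_mult h (\<lambda>z. F z $ j)))"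
  obtain A B where A: "A > 0" "B > 0" "\<And>z. z \<in> U \<Longrightarrow> max_norm z < B \<Longrightarrow> A * max_norm z powr \<eta> \<le> max_norm (F z)"
    and "\<eta> \<ge> 0" using \<eta> unfolding lojasiewicz_set_def by blast
  have "\<forall>\<^sub>F z in nhds 0. z \<in> U" using U by (intro eventually_nhds_in_open)
  moreover have "\<forall>\<^sub>F z in nhds (0::complex^2). norm z < B"
    using A(2) by (auto simp: eventually_nhds_metric)
  ultimately have "\<forall>\<^sub>F z in nhds 0. A * max_norm z powr \<eta> \<le> max_norm (F z)"
    by eventually_elim (use A(3) max_norm_le_norm le_less_trans in blast)
  from eventually_\<gamma>[OF this]
  have ev: "\<forall>\<^sub>F t in nhds 0. A * max_norm (\<gamma> t) powr \<eta> \<le> max_norm (F (\<gamma> t))" .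
  define L where "L = 1 + norm a"
  have L: "L > 0" by (simp add: L_def add_pos_nonneg)
  \<comment> \<open>The abscissa \<open>t ^ p\<close> is recovered from \<gamma> t by undoing the
    shear, which costs the factor L.\<close>
  have low: "norm t ^ p / L \<le> max_norm (\<gamma> t)" for t
    using norm_unshear_le[of "\<gamma> t" a] L by (simp add: \<gamma>_def norm_power L_def pos_divide_le_eq mult.commute)
  have ev': "\<forall>\<^sub>F t in nhds 0. A * (norm t ^ p / L) powr \<eta> \<le> max_norm (F (\<gamma> t))"
    using ev
  proof eventually_elim
    case (elim t)
    have "A * (norm t ^ p / L) powr \<eta> \<le> A * max_norm (\<gamma> t) powr \<eta>"
      using A(1) \<open>\<eta> \<ge> 0\<close> low L by (intro mult_left_mono powr_mono2) auto
    with elim show ?case by linarith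
  qed
  have ev_real: "\<forall>\<^sub>F y in at_right (0::real). P (complex_of_real y) \<and> 0 < y" if P: "\<forall>\<^sub>F t in nhds 0. P t" for P
  proof -
    obtain d where d: "d > 0" "\<And>t. norm t < d \<Longrightarrow> P t" using P by (auto simp: eventually_nhds_metric)
    then show ?thesis unfolding eventually_at_right_field by (intro exI[of _ d]) auto
  qed
  have dich: "(E = \<infinity> \<and> (\<forall>\<^sub>F t in nhds 0. \<forall>j. F (\<gamma> t) $ j = 0)) \<or>
    (\<exists>k c C. E = ereal (real k) \<and> c > 0 \<and> C > 0 \<and>
      (\<forall>\<^sub>F t in nhds 0. (\<forall>j. norm (F (\<gamma> t) $ j) \<le> C * norm t ^ k) \<and> (\<exists>j. c * norm t ^ k \<le> norm (F (\<gamma> t) $ j))))"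
    unfolding E_def by (rule branch_order) (use F F0 in auto)
  have "1 / ereal (real p) * E \<le> ereal \<eta>"
    using dich
  proof (elim disjE exE conjE)
    assume "\<forall>\<^sub>F t in nhds 0. \<forall>j. F (\<gamma> t) $ j = 0"
    with ev' have "\<forall>\<^sub>F t in nhds (0::complex). A * (norm t ^ p / L) powr \<eta> \<le> 0"
    proof eventually_elim
      case (elim t)
      have "max_norm (F (\<gamma> t)) \<le> 0" using elim(2) by (intro max_norm_le) simp
      with elim(1) show ?case by linarith
    qed
    from eventually_happens'[OF trivial_limit_at_right_real ev_real[OF this]]
    obtain y :: real where y: "A * (y ^ p / L) powr \<eta> \<le> 0" "0 < y" by auto
    then have "0 < A * (y ^ p / L) powr \<eta>" using A(1) L by simp
    with y(1) show ?thesis by linarith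
  next
    fix k c C
    assume E: "E = ereal (real k)" and C: "C > 0"
      and bd: "\<forall>\<^sub>F t in nhds 0. (\<forall>j. norm (F (\<gamma> t) $ j) \<le> C * norm t ^ k) \<and> (\<exists>j. c * norm t ^ k \<le> norm (F (\<gamma> t) $ j))"
    have "\<forall>\<^sub>F t in nhds (0::complex). A * (norm t ^ p / L) powr \<eta> \<le> C * norm t ^ k"
      using ev' bd
    proof eventually_elim
      case (elim t)
      have "max_norm (F (\<gamma> t)) \<le> C * norm t ^ k" using elim(2) by (intro max_norm_le) blast
      with elim(1) show ?case by linarith
    qed
    from ev_real[OF this]
    have "\<forall>\<^sub>F y in at_right (0::real). (A * (1 / L) powr \<eta>) * y powr (real p * \<eta>) \<le> C * y powr real k"
    proof eventually_elim
      case (elim y)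
      then have y: "0 < y" and le: "A * (y ^ p / L) powr \<eta> \<le> C * y ^ k" by auto
      have "(y ^ p / L) powr \<eta> = (y ^ p) powr \<eta> * (1 / L) powr \<eta>"
        using y L by (subst powr_mult[symmetric]) auto
      also have "(y ^ p) powr \<eta> = y powr (real p * \<eta>)" using y by (simp add: powr_realpow[symmetric] powr_powr)
      finally show ?case using le y by (simp add: powr_realpow mult_ac)
    qed
    moreover have "A * (1 / L) powr \<eta> > 0" using A(1) L by simp
    ultimately have "real k \<le> real p * \<eta>" by (intro powr_bounds_imp_le)
    then have "real k / real p \<le> \<eta>" using p by (simp add: field_simps)
    then show ?thesis using p by (simp add: E)
  qed
  then show ?thesis by (simp add: E_def)
qed

end

text \<open>J is a set of indices, so associated factors are counted as often as they divide g. The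
  constants come from the unit that relates the sheared g to the product of the \<open>W i\<close>:
  near 0 it is bounded and bounded away from 0.\<close>

lemma shear_factor_bounds:
  assumes I: "finite I" and gb: "\<And>i. i \<in> I \<Longrightarrow> germ_branch (p i) (\<rho> i) (\<phi> i) (h i) a"
    and nz: "\<And>i. i \<in> I \<Longrightarrow> germ_of (h i) \<noteq> 0"
    and g: "holomorphic2_near_0 g" and dvd: "germ_of g dvd (\<Prod>i\<in>I. germ_of (h i))"
  shows "\<exists>J c C. J \<subseteq> I \<and> c > 0 \<and> C > 0 \<and> (\<forall>\<^sub>F z in nhds 0.
    c * (\<Prod>i\<in>J. norm (branch.W (p i) (\<rho> i) (\<phi> i) (z $ 1) (z $ 2))) \<le> norm (shear a g z) \<and>
    norm (shear a g z) \<le> C * (\<Prod>i\<in>J. norm (branch.W (p i) (\<rho> i) (\<phi> i) (z $ 1) (z $ 2))))"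
proof -
  define W where "W = (\<lambda>i. branch.W (p i) (\<rho> i) (\<phi> i))"
  have hh: "holomorphic2_near_0 (h i)" if "i \<in> I" for i using germ_branch.h[OF gb[OF that]] .
  have "\<exists>J V. J \<subseteq> I \<and> V dvd 1 \<and> germ_of g = V * (\<Prod>i\<in>J. germ_of (h i))"
  proof (rule dvd_prod_primes[OF I _ _ dvd])
    show "germ_of (h i) dvd A \<or> germ_of (h i) dvd B" if "i \<in> I" "germ_of (h i) dvd A * B" for i A B
      by (rule germ_branch.prime[OF gb[OF that(1)] that(2)])
    show "A = 0" if "i \<in> I" "germ_of (h i) * A = 0" for i A
      by (rule germ_mult_eq_0[OF hh[OF that(1)] nz[OF that(1)] that(2)])
  qed
  then obtain J V where J: "J \<subseteq> I" and V: "V dvd 1" "germ_of g = V * (\<Prod>i\<in>J. germ_of (h i))" by blast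
  have finJ: "finite J" using J I by (rule finite_subset)
  obtain v where v: "holomorphic2_near_0 v" "V = germ_of v" by (rule germ_cases)
  have v0: "v 0 \<noteq> 0" using V(1) v germ_unit_iff by simp
  have hJ: "holomorphic2_near_0 (\<lambda>z. \<Prod>i\<in>J. h i z)" using hh J by (intro holomorphic2_near_0_prod) auto
  have "germ_of g = germ_of (\<lambda>z. v z * (\<Prod>i\<in>J. h i z))"
    using V(2) v hJ hh J by (subst (asm) germ_of_prod) (auto simp: germ_of_mult)
  then have "\<forall>\<^sub>F z in nhds 0. g z = v z * (\<Prod>i\<in>J. h i z)"
    by (subst (asm) germ_of_eq_iff) (use g v hJ holomorphic2_near_0_mult in auto)
  from eventually_shear[OF this, of a]
  have fac1: "\<forall>\<^sub>F z in nhds 0. shear a g z = shear a v z * (\<Prod>i\<in>J. shear a (h i) z)" by (simp add: shear_def)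
  have "\<forall>i\<in>J. \<exists>u. holomorphic2_near_0 u \<and> u 0 \<noteq> 0 \<and> (\<forall>\<^sub>F z in nhds 0. shear a (h i) z = u z * W i (z $ 1) (z $ 2))"
    unfolding W_def using germ_branch.factor[OF gb] J by blast
  from bchoice[OF this] obtain u where u: "\<And>i. i \<in> J \<Longrightarrow> holomorphic2_near_0 (u i)" "\<And>i. i \<in> J \<Longrightarrow> u i 0 \<noteq> 0"
    "\<And>i. i \<in> J \<Longrightarrow> \<forall>\<^sub>F z in nhds 0. shear a (h i) z = u i z * W i (z $ 1) (z $ 2)" by blast
  have fac2: "\<forall>\<^sub>F z in nhds 0. \<forall>i\<in>J. shear a (h i) z = u i z * W i (z $ 1) (z $ 2)"
    using u(3) finJ by (intro eventually_ball_finite) auto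
  define w where "w = (\<lambda>z. shear a v z * (\<Prod>i\<in>J. u i z))"
  have w: "holomorphic2_near_0 w" unfolding w_def
    by (intro holomorphic2_near_0_mult holomorphic2_near_0_prod holomorphic2_near_0_shear v u)
  have w0: "w 0 \<noteq> 0" using v0 u(2) finJ by (simp add: w_def)
  have "\<forall>\<^sub>F z in nhds 0. norm (w 0) / 2 * (\<Prod>i\<in>J. norm (W i (z $ 1) (z $ 2))) \<le> norm (shear a g z) \<and>
    norm (shear a g z) \<le> 2 * norm (w 0) * (\<Prod>i\<in>J. norm (W i (z $ 1) (z $ 2)))"
    using fac1 fac2 unit_bounds[OF w w0]
  proof eventually_elim
    case (elim z)
    have "shear a g z = shear a v z * (\<Prod>i\<in>J. u i z * W i (z $ 1) (z $ 2))" using elim(1,2) by simp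
    also have "\<dots> = w z * (\<Prod>i\<in>J. W i (z $ 1) (z $ 2))" by (simp add: w_def prod.distrib)
    finally have "norm (shear a g z) = norm (w z) * (\<Prod>i\<in>J. norm (W i (z $ 1) (z $ 2)))"
      by (simp add: norm_mult prod_norm)
    moreover have "0 \<le> (\<Prod>i\<in>J. norm (W i (z $ 1) (z $ 2)))" by (intro prod_nonneg) auto
    note mult_right_mono[OF elim(3)[THEN conjunct1] this] mult_right_mono[OF elim(3)[THEN conjunct2] this]
    ultimately show ?case by simp
  qed
  then show ?thesis unfolding W_def using J w0
    by (intro exI[of _ J] exI[of _ "norm (w 0) / 2"] exI[of _ "2 * norm (w 0)"] conjI) auto
qed

text \<open>Take the component j that is large at the nearby branch point. One and the same product
  of the \<open>W i\<close> bounds it from above there and from below at (x, y), so it is comparably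
  large at (x, y). Thus N itself, and not just every larger number, is an admissible
  exponent.\<close>

lemma lojasiewicz_set_memI:
  fixes F :: "complex^2 \<Rightarrow> complex^'m" and p :: "'i \<Rightarrow> nat"
  assumes I: "finite I" "I \<noteq> {}" and gb: "\<And>i. i \<in> I \<Longrightarrow> germ_branch (p i) (\<rho> i) (\<phi> i) (h i) a"
    and bd: "\<And>i. i \<in> I \<Longrightarrow> \<exists>K r. r > 0 \<and> (\<forall>t. norm t < r \<longrightarrow> norm (\<phi> i t) \<le> K * norm t ^ p i)"
    and nz: "\<And>i. i \<in> I \<Longrightarrow> germ_of (h i) \<noteq> 0"
    and F: "\<And>j. holomorphic2_near_0 (\<lambda>z. F z $ j)" and F0: "F 0 = 0"
    and dvd: "\<And>j. germ_of (\<lambda>z. F z $ j) dvd (\<Prod>i\<in>I. germ_of (h i))"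
    and E: "\<And>i. i \<in> I \<Longrightarrow> (MIN j. ereal_of_enat (intersection_mult (h i) (\<lambda>z. F z $ j))) = ereal (real (k i))"
    and N: "\<And>i. i \<in> I \<Longrightarrow> real (k i) / real (p i) \<le> N" "0 \<le> N"
  shows "N \<in> lojasiewicz_set U F"
proof -
  have br: "branch (p i) (\<rho> i) (\<phi> i)" if "i \<in> I" for i using germ_branch.axioms(1)[OF gb[OF that]] .
  define W where "W = (\<lambda>i. branch.W (p i) (\<rho> i) (\<phi> i))"
  define \<gamma> where "\<gamma> = (\<lambda>i. germ_branch.\<gamma> (p i) (\<phi> i) a)"
  obtain K' r' where K': "\<And>i. i \<in> I \<Longrightarrow> r' i > 0" "\<And>i t. i \<in> I \<Longrightarrow> norm t < r' i \<Longrightarrow> norm (\<phi> i t) \<le> K' i * norm t ^ p i"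
  proof -
    have "\<forall>i\<in>I. \<exists>q. snd q > 0 \<and> (\<forall>t. norm t < snd q \<longrightarrow> norm (\<phi> i t) \<le> fst q * norm t ^ p i)"
      using bd by (metis fst_conv snd_conv)
    from bchoice[OF this] obtain q where "\<forall>i\<in>I. snd (q i) > 0 \<and> (\<forall>t. norm t < snd (q i) \<longrightarrow> norm (\<phi> i t) \<le> fst (q i) * norm t ^ p i)" ..
    then show ?thesis using that[of "\<lambda>i. snd (q i)" "\<lambda>i. fst (q i)"] by blast
  qed
  have "\<forall>i\<in>I. \<exists>c>0. \<forall>\<^sub>F t in nhds 0. \<exists>j. c * norm t ^ k i \<le> norm (F (\<gamma> i t) $ j)"
  proof
    fix i assume i: "i \<in> I"
    have "(ereal (real (k i)) = \<infinity> \<and> (\<forall>\<^sub>F t in nhds 0. \<forall>j. F (\<gamma> i t) $ j = 0)) \<or>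
      (\<exists>k' c C. ereal (real (k i)) = ereal (real k') \<and> c > 0 \<and> C > 0 \<and>
      (\<forall>\<^sub>F t in nhds 0. (\<forall>j. norm (F (\<gamma> i t) $ j) \<le> C * norm t ^ k') \<and> (\<exists>j. c * norm t ^ k' \<le> norm (F (\<gamma> i t) $ j))))"
      unfolding E[OF i, symmetric] \<gamma>_def by (rule germ_branch.branch_order[OF gb[OF i]]) (use F F0 in auto)
    then obtain c where "c > 0" "\<forall>\<^sub>F t in nhds 0. \<exists>j. c * norm t ^ k i \<le> norm (F (\<gamma> i t) $ j)"
      by (auto simp: eventually_conj_iff)
    then show "\<exists>c>0. \<forall>\<^sub>F t in nhds 0. \<exists>j. c * norm t ^ k i \<le> norm (F (\<gamma> i t) $ j)" by blast
  qed
  from bchoice[OF this] obtain c where c: "\<And>i. i \<in> I \<Longrightarrow> c i > 0"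
    "\<And>i. i \<in> I \<Longrightarrow> \<forall>\<^sub>F t in nhds 0. \<exists>j. c i * norm t ^ k i \<le> norm (F (\<gamma> i t) $ j)" by blast
  have "\<forall>\<^sub>F t in nhds (0::complex). \<forall>i\<in>I. norm t < r' i \<and> norm t < \<rho> i \<and> (\<exists>j. c i * norm t ^ k i \<le> norm (F (\<gamma> i t) $ j))"
  proof (rule eventually_ball_finite[OF I(1)], rule ballI, intro eventually_conj)
    fix i assume i: "i \<in> I"
    show "\<forall>\<^sub>F t in nhds (0::complex). norm t < r' i" "\<forall>\<^sub>F t in nhds (0::complex). norm t < \<rho> i"
      using K'(1)[OF i] branch.\<rho>[OF br[OF i]] by (auto simp: eventually_nhds_metric)
  qed (use c(2) in blast)
  then obtain s where s0: "s > 0" "\<forall>t::complex. dist t 0 < s \<longrightarrow>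
      (\<forall>i\<in>I. norm t < r' i \<and> norm t < \<rho> i \<and> (\<exists>j. c i * norm t ^ k i \<le> norm (F (\<gamma> i t) $ j)))"
    unfolding eventually_nhds_metric by blast
  have s: "s > 0" "\<And>(t::complex) i. norm t < s \<Longrightarrow> i \<in> I \<Longrightarrow> norm t < r' i"
    "\<And>(t::complex) i. norm t < s \<Longrightarrow> i \<in> I \<Longrightarrow> norm t < \<rho> i"
    "\<And>t i. norm t < s \<Longrightarrow> i \<in> I \<Longrightarrow> \<exists>j. c i * norm t ^ k i \<le> norm (F (\<gamma> i t) $ j)"
    using s0 unfolding dist_0_norm dist_commute[of _ "0::complex"] by blast+
  have s\<rho>: "s \<le> \<rho> i" if i: "i \<in> I" for i
  proof (rule ccontr)
    assume "\<not> s \<le> \<rho> i"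
    then have "norm (complex_of_real (\<rho> i)) < s" using branch.\<rho>[OF br[OF i]] by simp
    from s(3)[OF this i] branch.\<rho>[OF br[OF i]] show False by simp
  qed
  define K where "K = 1 + (\<Sum>i\<in>I. \<bar>K' i\<bar>)"
  have K: "K \<ge> 1" by (simp add: K_def sum_nonneg)
  have K'K: "K' i \<le> K" if "i \<in> I" for i
  proof -
    have "\<bar>K' i\<bar> \<le> (\<Sum>i\<in>I. \<bar>K' i\<bar>)" using that I(1) by (intro member_le_sum) auto
    then show ?thesis by (simp add: K_def)
  qed
  have \<phi>K: "norm (\<phi> i t) \<le> K * norm t ^ p i" if "i \<in> I" "norm t < s" for i t
  proof -
    have "norm (\<phi> i t) \<le> K' i * norm t ^ p i" by (rule K'(2)[OF that(1) s(2)[OF that(2,1)]])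
    also have "\<dots> \<le> K * norm t ^ p i" using K'K[OF that(1)] by (intro mult_right_mono) auto
    finally show ?thesis .
  qed
  have "\<exists>r \<Lambda>. r > 0 \<and> \<Lambda> \<ge> 1 \<and> (\<forall>x y. norm x < r \<longrightarrow> norm y < r \<longrightarrow> (\<exists>i\<in>I. \<exists>\<tau>. norm \<tau> < s \<and> max (norm x) (norm y) \<le> 2 * K * norm \<tau> ^ p i \<and> norm \<tau> ^ p i \<le> max (norm x) (norm y) \<and>
      (\<forall>l\<in>I. norm (W l (\<tau> ^ p i) (\<phi> i \<tau>)) \<le> \<Lambda> * norm (W l x y))))"
    unfolding W_def by (rule nearest_branch_point[of I p \<rho> \<phi> K s, OF I br K s(1) s\<rho> \<phi>K])
  then obtain r \<Lambda> where r: "r > 0" "\<Lambda> \<ge> 1" and near: "\<forall>x y. norm x < r \<longrightarrow> norm y < r \<longrightarrow> (\<exists>i\<in>I. \<exists>\<tau>. norm \<tau> < s \<and> max (norm x) (norm y) \<le> 2 * K * norm \<tau> ^ p i \<and> norm \<tau> ^ p i \<le> max (norm x) (norm y) \<and>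
      (\<forall>l\<in>I. norm (W l (\<tau> ^ p i) (\<phi> i \<tau>)) \<le> \<Lambda> * norm (W l x y)))"
    by (elim exE conjE)
  have "\<forall>j. \<exists>q. fst q \<subseteq> I \<and> fst (snd q) > 0 \<and> snd (snd q) > 0 \<and> (\<forall>\<^sub>F z in nhds 0.
    fst (snd q) * (\<Prod>i\<in>fst q. norm (W i (z $ 1) (z $ 2))) \<le> norm (shear a (\<lambda>z. F z $ j) z) \<and>
    norm (shear a (\<lambda>z. F z $ j) z) \<le> snd (snd q) * (\<Prod>i\<in>fst q. norm (W i (z $ 1) (z $ 2))))"
  proof
    fix j
    have "\<exists>J c C. J \<subseteq> I \<and> c > 0 \<and> C > 0 \<and> (\<forall>\<^sub>F z in nhds 0.
      c * (\<Prod>i\<in>J. norm (W i (z $ 1) (z $ 2))) \<le> norm (shear a (\<lambda>z. F z $ j) z) \<and>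
      norm (shear a (\<lambda>z. F z $ j) z) \<le> C * (\<Prod>i\<in>J. norm (W i (z $ 1) (z $ 2))))"
      unfolding W_def by (rule shear_factor_bounds[of I p \<rho> \<phi> h a, OF I(1) gb nz F dvd])
    then obtain J c C where "J \<subseteq> I \<and> c > 0 \<and> C > 0 \<and> (\<forall>\<^sub>F z in nhds 0.
      c * (\<Prod>i\<in>J. norm (W i (z $ 1) (z $ 2))) \<le> norm (shear a (\<lambda>z. F z $ j) z) \<and>
      norm (shear a (\<lambda>z. F z $ j) z) \<le> C * (\<Prod>i\<in>J. norm (W i (z $ 1) (z $ 2))))" by (elim exE)
    then show "\<exists>q. fst q \<subseteq> I \<and> fst (snd q) > 0 \<and> snd (snd q) > 0 \<and> (\<forall>\<^sub>F z in nhds 0.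
      fst (snd q) * (\<Prod>i\<in>fst q. norm (W i (z $ 1) (z $ 2))) \<le> norm (shear a (\<lambda>z. F z $ j) z) \<and>
      norm (shear a (\<lambda>z. F z $ j) z) \<le> snd (snd q) * (\<Prod>i\<in>fst q. norm (W i (z $ 1) (z $ 2))))"
      by (intro exI[of _ "(J, c, C)"]) simp
  qed
  from choice[OF this] obtain q where q: "\<And>j. fst (q j) \<subseteq> I" "\<And>j. fst (snd (q j)) > 0" "\<And>j. snd (snd (q j)) > 0"
    "\<And>j. \<forall>\<^sub>F z in nhds 0.
    fst (snd (q j)) * (\<Prod>i\<in>fst (q j). norm (W i (z $ 1) (z $ 2))) \<le> norm (shear a (\<lambda>z. F z $ j) z) \<and>
    norm (shear a (\<lambda>z. F z $ j) z) \<le> snd (snd (q j)) * (\<Prod>i\<in>fst (q j). norm (W i (z $ 1) (z $ 2)))" by blast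
  define J c1 C1 where "J = (\<lambda>j. fst (q j))" and "c1 = (\<lambda>j. fst (snd (q j)))" and "C1 = (\<lambda>j. snd (snd (q j)))"
  have J: "J j \<subseteq> I" "c1 j > 0" "C1 j > 0" for j using q(1-3) by (auto simp: J_def c1_def C1_def)
  have "\<forall>\<^sub>F z in nhds 0. \<forall>j.
    c1 j * (\<Prod>i\<in>J j. norm (W i (z $ 1) (z $ 2))) \<le> norm (shear a (\<lambda>z. F z $ j) z) \<and>
    norm (shear a (\<lambda>z. F z $ j) z) \<le> C1 j * (\<Prod>i\<in>J j. norm (W i (z $ 1) (z $ 2)))"
    unfolding J_def c1_def C1_def by (intro eventually_all_finite q(4))
  then obtain R where R: "R > 0" and shF: "\<And>x y j. norm x < R \<Longrightarrow> norm y < R \<Longrightarrow>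
    c1 j * (\<Prod>i\<in>J j. norm (W i x y)) \<le> norm (F (vec2 (x + a * y) y) $ j) \<and>
    norm (F (vec2 (x + a * y) y) $ j) \<le> C1 j * (\<Prod>i\<in>J j. norm (W i x y))"
    unfolding eventually_nhds_0_vec2 shear_vec2 by auto
  \<comment> \<open>Component j loses \<Lambda> for each of its \<open>card (J j)\<close> factors,
    and the ratio of its two constants; the sum serves all components.\<close>
  define D where "D = (\<Sum>j\<in>UNIV. C1 j * \<Lambda> ^ card (J j) / c1 j)"
  have Dj: "C1 j * \<Lambda> ^ card (J j) / c1 j \<le> D" "0 < C1 j * \<Lambda> ^ card (J j) / c1 j" for j
  proof -
    have pos: "0 < C1 j * \<Lambda> ^ card (J j) / c1 j" for j using J(2,3)[of j] r(2) by simp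
    then show "0 < C1 j * \<Lambda> ^ card (J j) / c1 j" .
    show "C1 j * \<Lambda> ^ card (J j) / c1 j \<le> D"
      unfolding D_def using pos by (intro member_le_sum) (auto intro: less_imp_le)
  qed
  then have D: "D > 0" using less_le_trans by blast
  define c0 where "c0 = Min (c ` I)"
  have c0: "c0 > 0" "\<And>i. i \<in> I \<Longrightarrow> c0 \<le> c i" using I c(1) by (auto simp: c0_def)
  \<comment> \<open>The bound r admits \<open>near\<close>; R / K keeps the branch point, whose
    coordinates are at most K times as large, in the domain of the estimates; and 1 ensures m / (2
    K) \<le> 1.\<close>
  define Q where "Q = min (min r (R / K)) 1"
  have Q: "Q > 0" "Q \<le> r" "Q \<le> R / K" "Q \<le> 1" using r R K by (auto simp: Q_def)
  have QR: "K * m < R" if "m < Q" for m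
  proof -
    have "K * m < K * (R / K)" using that Q K by (intro mult_strict_left_mono) auto
    then show ?thesis using K by simp
  qed
  have main: "\<exists>j. c0 / D * (max (norm x) (norm y) / (2 * K)) powr N \<le> norm (F (vec2 (x + a * y) y) $ j)"
    if x: "norm x < Q" and y: "norm y < Q" and nz: "max (norm x) (norm y) > 0" for x y
  proof -
    define m where "m = max (norm x) (norm y)"
    have m: "0 < m" "m < Q" "m \<le> K * m" using x y nz K by (auto simp: m_def mult_le_cancel_right1)
    obtain i \<tau> where i: "i \<in> I" and \<tau>: "norm \<tau> < s" "m \<le> 2 * K * norm \<tau> ^ p i" "norm \<tau> ^ p i \<le> m"
      and Wl: "\<And>l. l \<in> I \<Longrightarrow> norm (W l (\<tau> ^ p i) (\<phi> i \<tau>)) \<le> \<Lambda> * norm (W l x y)"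
    proof -
      have "norm x < r" "norm y < r" using x y Q by auto
      then obtain i \<tau> where "i \<in> I" "norm \<tau> < s \<and> max (norm x) (norm y) \<le> 2 * K * norm \<tau> ^ p i \<and> norm \<tau> ^ p i \<le> max (norm x) (norm y) \<and>
        (\<forall>l\<in>I. norm (W l (\<tau> ^ p i) (\<phi> i \<tau>)) \<le> \<Lambda> * norm (W l x y))"
        using near[rule_format, of x y] by blast
      then show ?thesis using that[of i \<tau>] by (simp add: m_def)
    qed
    have pi: "p i > 0" by (rule branch.p[OF br[OF i]])
    obtain j where j: "c i * norm \<tau> ^ k i \<le> norm (F (\<gamma> i \<tau>) $ j)" using s(4)[OF \<tau>(1) i] by blast
    have small: "norm (\<tau> ^ p i) < R" "norm (\<phi> i \<tau>) < R"
    proof -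
      show "norm (\<tau> ^ p i) < R" using \<tau>(3) m(3) QR[OF m(2)] by (simp add: norm_power)
      have "norm (\<phi> i \<tau>) \<le> K * norm \<tau> ^ p i" by (rule \<phi>K[OF i \<tau>(1)])
      also have "\<dots> \<le> K * m" using K \<tau>(3) by (intro mult_left_mono) auto
      finally show "norm (\<phi> i \<tau>) < R" using QR[OF m(2)] by linarith
    qed
    have xyR: "norm x < R" "norm y < R" using m(3) QR[OF m(2)] by (auto simp: m_def)
    have "norm (F (\<gamma> i \<tau>) $ j) \<le> C1 j * (\<Prod>l\<in>J j. norm (W l (\<tau> ^ p i) (\<phi> i \<tau>)))"
      using shF[OF small, of j] unfolding \<gamma>_def germ_branch.\<gamma>_def[OF gb[OF i]] by simp
    also have "\<dots> \<le> C1 j * (\<Prod>l\<in>J j. \<Lambda> * norm (W l x y))"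
      using J(1)[of j] J(3)[of j] Wl by (intro mult_left_mono prod_mono) auto
    also have "\<dots> = C1 j * \<Lambda> ^ card (J j) / c1 j * (c1 j * (\<Prod>l\<in>J j. norm (W l x y)))"
      using J(2)[of j] by (simp add: prod.distrib)
    also have "\<dots> \<le> C1 j * \<Lambda> ^ card (J j) / c1 j * norm (F (vec2 (x + a * y) y) $ j)"
      using shF[OF xyR, of j] Dj(2)[of j] by (intro mult_left_mono) auto
    also have "\<dots> \<le> D * norm (F (vec2 (x + a * y) y) $ j)" using Dj(1) by (intro mult_right_mono) auto
    finally have 1: "norm (F (\<gamma> i \<tau>) $ j) \<le> D * norm (F (vec2 (x + a * y) y) $ j)" .
    have m1: "0 < m / (2 * K)" "m / (2 * K) \<le> 1" "m / (2 * K) \<le> norm \<tau> ^ p i"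
    proof -
      show "0 < m / (2 * K)" using m K by simp
      show "m / (2 * K) \<le> norm \<tau> ^ p i" using \<tau>(2) K by (simp add: pos_divide_le_eq mult.commute)
      show "m / (2 * K) \<le> 1" using m Q K by (simp add: pos_divide_le_eq)
    qed
    have \<tau>pos: "0 < norm \<tau>"
    proof (rule ccontr)
      assume "\<not> 0 < norm \<tau>"
      then have "norm \<tau> ^ p i = 0" using pi by (simp add: power_0_left)
      with m1(1,3) show False by linarith
    qed
    \<comment> \<open>The base is at most 1, so raising the exponent from k i / p i to N only lowers
      the power.\<close>
    have "(m / (2 * K)) powr N \<le> (m / (2 * K)) powr (real (k i) / real (p i))"
      using m1 N(1)[OF i] by (intro powr_mono') auto
    also have "\<dots> \<le> (norm \<tau> ^ p i) powr (real (k i) / real (p i))" using m1 by (intro powr_mono2) auto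
    also have "\<dots> = norm \<tau> ^ k i" using \<tau>pos pi by (simp add: powr_realpow[symmetric] powr_powr)
    finally have 2: "(m / (2 * K)) powr N \<le> norm \<tau> ^ k i" .
    have "c0 * (m / (2 * K)) powr N \<le> c i * norm \<tau> ^ k i"
      using c0(1) c0(2)[OF i] 2 c(1)[OF i] by (intro mult_mono) auto
    also have "\<dots> \<le> D * norm (F (vec2 (x + a * y) y) $ j)" using j 1 by linarith
    finally have "c0 / D * (m / (2 * K)) powr N \<le> norm (F (vec2 (x + a * y) y) $ j)"
      using D by (simp add: pos_divide_le_eq mult.commute)
    then show ?thesis unfolding m_def by blast
  qed
  define L where "L = 1 + norm a"
  have L: "L \<ge> 1" by (simp add: L_def)
  \<comment> \<open>Back to the original coordinates: the shear and its inverse change the maximum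
    norm by at most the factor L.\<close>
  have "c0 / D * (1 / (2 * K * L)) powr N * max_norm z powr N \<le> max_norm (F z)" if z: "max_norm z < Q / L" for z
  proof (cases "max_norm z = 0")
    \<comment> \<open>Here \<open>0 powr N\<close> is 0, even for N = 0.\<close>
    case True
    then show ?thesis using max_norm_nonneg by simp
  next
    case False
    then have mz: "max_norm z > 0" using max_norm_nonneg[of z] by simp
    define x y where "x = z $ 1 - a * z $ 2" and "y = z $ 2"
    have zxy: "z = vec2 (x + a * y) y" by (simp add: x_def y_def)
    have LQ: "L * max_norm z < Q" using z L by (simp add: pos_less_divide_eq mult.commute)
    have "norm x \<le> L * max_norm z" using norm_unshear_le[of z a] by (simp add: x_def L_def)
    moreover have "norm y \<le> L * max_norm z"
    proof -
      have "norm y \<le> 1 * max_norm z" using norm_le_max_norm[of z 2] by (simp add: y_def)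
      also have "\<dots> \<le> L * max_norm z" using L max_norm_nonneg by (intro mult_right_mono)
      finally show ?thesis .
    qed
    ultimately have xyQ: "norm x < Q" "norm y < Q" using LQ by linarith+
    have mL: "max_norm z \<le> L * max (norm x) (norm y)"
    proof -
      have "norm (x + a * y) \<le> norm x + norm a * norm y" using norm_triangle_ineq[of x "a * y"] by (simp add: norm_mult)
      also have "\<dots> \<le> max (norm x) (norm y) + norm a * max (norm x) (norm y)"
        by (intro add_mono mult_left_mono) auto
      also have "\<dots> = L * max (norm x) (norm y)" by (simp add: L_def algebra_simps)
      finally have "norm (x + a * y) \<le> L * max (norm x) (norm y)" .
      moreover have "norm y \<le> L * max (norm x) (norm y)"
      proof -
        have "1 * max (norm x) (norm y) \<le> L * max (norm x) (norm y)" using L by (intro mult_right_mono) (auto simp: le_max_iff_disj)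
        then show ?thesis by linarith
      qed
      ultimately show ?thesis unfolding zxy by (rule max_norm_vec2_le)
    qed
    then have mpos: "max (norm x) (norm y) > 0" using mz L by (smt (verit) mult_nonneg_nonpos)
    obtain j where j: "c0 / D * (max (norm x) (norm y) / (2 * K)) powr N \<le> norm (F z $ j)"
      using main[OF xyQ mpos] unfolding zxy[symmetric] by blast
    have "(1 / (2 * K * L)) powr N * max_norm z powr N = (max_norm z / L / (2 * K)) powr N"
      using K L mz by (subst powr_mult[symmetric]) (auto simp: mult_ac)
    also have "\<dots> \<le> (max (norm x) (norm y) / (2 * K)) powr N"
      using mL L K mz N(2) by (intro powr_mono2 divide_right_mono) (auto simp: pos_divide_le_eq mult.commute)
    finally have "c0 / D * ((1 / (2 * K * L)) powr N * max_norm z powr N) \<le> c0 / D * (max (norm x) (norm y) / (2 * K)) powr N"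
      using c0 D by (intro mult_left_mono) auto
    also have "\<dots> \<le> max_norm (F z)" using j norm_le_max_norm[of "F z" j] by linarith
    finally show ?thesis by (simp add: mult.assoc)
  qed
  moreover have "Q / L > 0" "c0 / D * (1 / (2 * K * L)) powr N > 0" using Q L c0 D K by auto
  ultimately show ?thesis unfolding lojasiewicz_set_def using N(2) by blast
qed

theorem theorem2:
  fixes U :: "(complex^2) set"
    and F :: "complex^2 \<Rightarrow> complex^'m"
    and f :: "complex^2 \<Rightarrow> complex"
    and h :: "nat \<Rightarrow> complex^2 \<Rightarrow> complex"
    and r :: nat
  assumes "open U" and "0 \<in> U"
    and "\<And>j. holomorphic2_on (\<lambda>z. F z $ j) U"
    and "F 0 = 0"
    and "f = (\<lambda>z. \<Prod>j\<in>UNIV. F z $ j)"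
    and "germ_of f \<noteq> 0"
    and "\<And>i. i \<in> {1..r} \<Longrightarrow> holomorphic2_near_0 (h i)"
    and "\<And>i. i \<in> {1..r} \<Longrightarrow> Factorial_Ring.irreducible (germ_of (h i))"
    and "germ_of f = (\<Prod>i\<in>{1..r}. germ_of (h i))"
  shows "lojasiewicz_exponent U F =
    (MAX i\<in>{1..r}. 1 / ereal_of_enat (ord_at_0 (h i)) *
      (MIN j. ereal_of_enat (intersection_mult (h i) (\<lambda>z. F z $ j))))"
proof -
  define I where "I = {1..r}"
  have hh: "holomorphic2_near_0 (h i)" and irr: "Factorial_Ring.irreducible (germ_of (h i))" if "i \<in> I" for i
    using assms(7,8) that by (auto simp: I_def)
  have F: "holomorphic2_near_0 (\<lambda>z. F z $ j)" for j
    using assms(1-3) unfolding holomorphic2_near_0_def by blast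
  have fprod: "germ_of f = (\<Prod>j\<in>UNIV. germ_of (\<lambda>z. F z $ j))"
    unfolding assms(5) by (rule germ_of_prod[symmetric]) (rule F)
  have fI: "germ_of f = (\<Prod>i\<in>I. germ_of (h i))" using assms(9) by (simp add: I_def)
  have dvd: "germ_of (\<lambda>z. F z $ j) dvd (\<Prod>i\<in>I. germ_of (h i))" for j
    unfolding fI[symmetric] fprod by (rule dvd_prodI) auto
  have I: "finite I" "I \<noteq> {}"
  proof -
    show "finite I" by (simp add: I_def)
    \<comment> \<open>An empty product would be 1 and make every component a unit, whereas all
      components vanish at 0.\<close>
    show "I \<noteq> {}"
    proof
      assume "I = {}"
      then have "germ_of (\<lambda>z. F z $ undefined) dvd 1" using dvd[of undefined] by simp
      then show False using germ_unit_iff[OF F] assms(4) by simp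
    qed
  qed
  have nz: "germ_of (h i) \<noteq> 0" if "i \<in> I" for i
    using irr[OF that] by (simp add: Factorial_Ring.irreducible_def)
  have "\<forall>i\<in>I. \<exists>n. ord_at_0 (h i) = enat n \<and> (\<forall>k l. k + l < n \<longrightarrow> taylor_coeff (h i) k l = 0) \<and>
    finite {a. (\<Sum>k\<le>n. taylor_coeff (h i) k (n - k) * a ^ k) = 0}"
    using ord_at_0_finite hh nz by blast
  from bchoice[OF this] obtain n where n: "\<forall>i\<in>I. ord_at_0 (h i) = enat (n i) \<and>
    (\<forall>k l. k + l < n i \<longrightarrow> taylor_coeff (h i) k l = 0) \<and>
    finite {a. (\<Sum>k\<le>n i. taylor_coeff (h i) k (n i - k) * a ^ k) = 0}" ..
  have ord: "ord_at_0 (h i) = enat (n i)" and low: "k + l < n i \<Longrightarrow> taylor_coeff (h i) k l = 0"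
    and fin: "finite {a. (\<Sum>k\<le>n i. taylor_coeff (h i) k (n i - k) * a ^ k) = 0}" if "i \<in> I" for i k l
    using n that by blast+
  \<comment> \<open>One direction a avoids the zeros of all initial forms at once, so that all
    branches live in the same sheared coordinates and can be compared.\<close>
  have "finite (\<Union>i\<in>I. {a. (\<Sum>k\<le>n i. taylor_coeff (h i) k (n i - k) * a ^ k) = 0})"
    using I(1) fin by (intro finite_UN_I)
  then obtain a where "a \<notin> (\<Union>i\<in>I. {a. (\<Sum>k\<le>n i. taylor_coeff (h i) k (n i - k) * a ^ k) = 0})"
    using ex_new_if_finite[OF infinite_UNIV_char_0] by blast
  then have a: "(\<Sum>k\<le>n i. taylor_coeff (h i) k (n i - k) * a ^ k) \<noteq> 0" if "i \<in> I" for i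
    using that by blast
  have "\<forall>i\<in>I. \<exists>q. germ_branch (n i) (fst q) (snd q) (h i) a \<and>
    (\<exists>K r. r > 0 \<and> (\<forall>t. norm t < r \<longrightarrow> norm (snd q t) \<le> K * norm t ^ n i))"
  proof
    fix i assume i: "i \<in> I"
    show "\<exists>q. germ_branch (n i) (fst q) (snd q) (h i) a \<and>
      (\<exists>K r. r > 0 \<and> (\<forall>t. norm t < r \<longrightarrow> norm (snd q t) \<le> K * norm t ^ n i))"
    proof (rule germ_branch_exists[OF hh[OF i] irr[OF i] low[OF i] a[OF i]])
      fix \<rho> \<phi> assume "germ_branch (n i) \<rho> \<phi> (h i) a"
        "\<exists>K r. r > 0 \<and> (\<forall>t. norm t < r \<longrightarrow> norm (\<phi> t) \<le> K * norm t ^ n i)"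
      then show ?thesis by (intro exI[of _ "(\<rho>, \<phi>)"]) simp
    qed
  qed
  from bchoice[OF this] obtain q where q: "\<forall>i\<in>I. germ_branch (n i) (fst (q i)) (snd (q i)) (h i) a \<and>
    (\<exists>K r. r > 0 \<and> (\<forall>t. norm t < r \<longrightarrow> norm (snd (q i) t) \<le> K * norm t ^ n i))" ..
  define \<rho> \<phi> where "\<rho> = (\<lambda>i. fst (q i))" and "\<phi> = (\<lambda>i. snd (q i))"
  have gb: "germ_branch (n i) (\<rho> i) (\<phi> i) (h i) a"
    and bd: "\<exists>K r. r > 0 \<and> (\<forall>t. norm t < r \<longrightarrow> norm (\<phi> i t) \<le> K * norm t ^ n i)" if "i \<in> I" for i
    using q that by (auto simp: \<rho>_def \<phi>_def)
  have n0: "n i > 0" if "i \<in> I" for i by (rule branch.p[OF germ_branch.axioms(1)[OF gb[OF that]]])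
  define E where "E = (\<lambda>i. MIN j. ereal_of_enat (intersection_mult (h i) (\<lambda>z. F z $ j)))"
  define v where "v = (\<lambda>i. 1 / ereal_of_enat (ord_at_0 (h i)) * E i)"
  have v: "v i = 1 / ereal (real (n i)) * E i" if "i \<in> I" for i using ord[OF that] by (simp add: v_def)
  have "lojasiewicz_exponent U F = Max (v ` I)"
  proof (rule antisym)
    show "Max (v ` I) \<le> lojasiewicz_exponent U F"
      unfolding lojasiewicz_exponent_def
    proof (rule Inf_greatest)
      fix e assume "e \<in> ereal ` lojasiewicz_set U F"
      then obtain \<eta> where \<eta>: "\<eta> \<in> lojasiewicz_set U F" "e = ereal \<eta>" by blast
      have "v i \<le> e" if "i \<in> I" for i
        unfolding v[OF that] \<eta>(2) E_def
        by (rule germ_branch.lojasiewicz_set_lower_bound[OF gb[OF that] assms(1,2) F assms(4) \<eta>(1)])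
      then show "Max (v ` I) \<le> e" using I by (intro Max.boundedI) auto
    qed
  next
    have dich: "E i = \<infinity> \<or> (\<exists>k. E i = ereal (real k))" if "i \<in> I" for i
      using germ_branch.branch_order[OF gb[OF that], of "\<lambda>j z. F z $ j", OF F] assms(4)
      unfolding E_def by auto
    show "lojasiewicz_exponent U F \<le> Max (v ` I)"
    proof (cases "\<exists>i\<in>I. E i = \<infinity>")
      case True
      then obtain i where i: "i \<in> I" "E i = \<infinity>" by blast
      have "v i = \<infinity>" using v[OF i(1)] i(2) n0[OF i(1)] by (simp add: one_ereal_def)
      moreover have "v i \<le> Max (v ` I)" using i(1) I by (intro Max_ge) auto
      ultimately show ?thesis by simp
    next
      case False
      then have "\<forall>i\<in>I. \<exists>k. E i = ereal (real k)" using dich by blast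
      from bchoice[OF this] obtain k where k: "\<And>i. i \<in> I \<Longrightarrow> E i = ereal (real (k i))" by blast
      have vk: "v i = ereal (real (k i) / real (n i))" if "i \<in> I" for i
        using v[OF that] k[OF that] n0[OF that] by (simp add: one_ereal_def)
      have "Max (v ` I) \<in> v ` I" using I by (intro Max_in) auto
      then obtain i0 where i0: "i0 \<in> I" "Max (v ` I) = v i0" by blast
      have "real (k i0) / real (n i0) \<in> lojasiewicz_set U F"
      proof (rule lojasiewicz_set_memI[of I n \<rho> \<phi> h a, OF I gb bd nz F assms(4) dvd])
        show "(MIN j. ereal_of_enat (intersection_mult (h i) (\<lambda>z. F z $ j))) = ereal (real (k i))" if "i \<in> I" for i
          using k[OF that] by (simp add: E_def)
        show "real (k i) / real (n i) \<le> real (k i0) / real (n i0)" if "i \<in> I" for i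
        proof -
          have "v i \<le> v i0" using i0(2) that I by (metis Max_ge finite_imageI imageI)
          then show ?thesis using vk[OF that] vk[OF i0(1)] by simp
        qed
      qed auto
      then show ?thesis
        unfolding lojasiewicz_exponent_def i0(2) vk[OF i0(1)] by (intro Inf_lower imageI)
    qed
  qed
  then show ?thesis by (simp add: v_def E_def I_def)
qed

end
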